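(* Let $D\subset\mathbb{R}^2$ be a bounded domain and $n\geq 1$ an integer, and let $\{(h,f)_\nabla : f\in H(D)\}$ be a Gaussian free field on $D$. Let $L$ be the standard triangular lattice in $\mathbb{R}^2$ (the dual of the honeycomb lattice, with edge length $1$ and all faces equilateral triangles), and let $H_n(D)$ be the finite-dimensional space of continuous functions that are affine on each of the triangles of $\frac1n L$ and that vanish on the boundary of $D$, regarded as a subspace of $H(D)$ with the Dirichlet inner product. Let $h_n$ be the random element of $H_n(D)$ determined by the Gaussian free field through $(h_n,f)_\nabla=(h,f)_\nabla$ for all $f\in H_n(D)$, so that $h_n$ has probability density on $H_n(D)$ proportional to $\exp[-\|h_n\|_\nabla^2/2]$. Then $h_n$, which is determined by its values on the vertices of the triangular mesh, is distributed like $3^{1/4}$ times the harmonic crystal with unit weights (and zero boundary values) on the set of vertices of $\frac1n L\cap D$, with edges joining nearest neighbours, where the boundary vertices are precisely those that lie on a triangle of $\frac1n L$ which is not completely contained in $D$.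
   Context: For a domain $D\subset\mathbb{R}^d$, $H_s(D)$ is the space of smooth real-valued functions on $\mathbb{R}^d$ supported on a compact subset of $D$, with Dirichlet inner product $(f_1,f_2)_\nabla=\int_D \nabla f_1\cdot\nabla f_2\,dx$ and $\|f\|_\nabla=(f,f)_\nabla^{1/2}$. $H(D)$ is the Hilbert space completion of $H_s(D)$ under this inner product. A Gaussian free field on $D$ is a Gaussian Hilbert space (a closed subspace of a real $L^2$ space of a probability space, consisting of centered Gaussian variables) of random variables denoted $(h,f)_\nabla$, one for each $f\in H(D)$, such that $f\mapsto (h,f)_\nabla$ is linear and $\mathbb{E}[(h,a)_\nabla(h,b)_\nabla]=(a,b)_\nabla$ for all $a,b\in H(D)$. For a finite graph $\Lambda$ with edge weights $w$ and a set $\partial\Lambda$ of boundary vertices, the Dirichlet inner product of functions on the vertices is $(\phi_1,\phi_2)_\nabla=\sum_{e=(x,y)}w(e)(\phi_1(y)-\phi_1(x))(\phi_2(y)-\phi_2(x))$, the sum being over all (unoriented) edges. The harmonic crystal on $\Lambda$ with zero boundary values is the random function $\phi$ in the finite-dimensional space of real functions on the vertices of $\Lambda$ vanishing on $\partial\Lambda$ whose probability density (with respect to Lebesgue measure on that space) is proportional to $e^{-\|\phi\|_\nabla^2/2}$, where $\|\phi\|_\nabla^2=(\phi,\phi)_\nabla$. Unit weights means $w(e)=1$ for every edge $e$.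
   Formalization: Functions in H_n(D) are required to have compact support in D rather than only to vanish pointwise on the boundary of D; with pointwise vanishing the description of the boundary vertices fails, e.g. for a disc of radius 1/n centred at a mesh vertex. *)

theory Defs
  imports "HOL-Analysis.Analysis" "HOL-Probability.Probability"
begin

section \<open>The Dirichlet inner product and the space \<open>H(D)\<close>\<close>

definition grad :: "('a::euclidean_space \<Rightarrow> real) \<Rightarrow> 'a \<Rightarrow> 'a" where
  "grad f x = (THE v. GDERIV f x :> v)"

text \<open>Integration is against the completed measure: the gradient of a piecewise affine function
  is specified only off a null set.\<close>

definition dirichlet :: "'a::euclidean_space set \<Rightarrow> ('a \<Rightarrow> real) \<Rightarrow> ('a \<Rightarrow> real) \<Rightarrow> real" where
  "dirichlet D f g = (LINT x:D|lebesgue. grad f x \<bullet> grad g x)"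

primrec Ck :: "nat \<Rightarrow> ('a::euclidean_space \<Rightarrow> real) \<Rightarrow> bool" where
  "Ck 0 f \<longleftrightarrow> continuous_on UNIV f"
| "Ck (Suc k) f \<longleftrightarrow>
     (\<forall>x. f differentiable (at x)) \<and> (\<forall>i\<in>Basis. Ck k (\<lambda>x. frechet_derivative f (at x) i))"

definition smooth :: "('a::euclidean_space \<Rightarrow> real) \<Rightarrow> bool" where
  "smooth f \<longleftrightarrow> (\<forall>k. Ck k f)"

definition compactly_supported_in :: "('a::euclidean_space \<Rightarrow> real) \<Rightarrow> 'a set \<Rightarrow> bool" where
  "compactly_supported_in f D \<longleftrightarrow> (\<exists>K. compact K \<and> K \<subseteq> D \<and> (\<forall>x. x \<notin> K \<longrightarrow> f x = 0))"

definition Hs :: "'a::euclidean_space set \<Rightarrow> ('a \<Rightarrow> real) set" where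
  "Hs D = {f. smooth f \<and> compactly_supported_in f D}"

text \<open>The Hilbert space \<open>H(D)\<close> is unique only up to isometry, so it is described as a
  complete inner product type together with an isometric linear map from \<open>Hs D\<close> onto a dense
  subset. The values of \<open>\<iota>\<close> off \<open>Hs D\<close> are irrelevant.\<close>

definition dirichlet_completion ::
    "'a::euclidean_space set \<Rightarrow> (('a \<Rightarrow> real) \<Rightarrow> 'h::{real_inner,complete_space}) \<Rightarrow> bool" where
  "dirichlet_completion D \<iota> \<longleftrightarrow>
     (\<forall>f\<in>Hs D. \<forall>g\<in>Hs D. \<forall>a b. \<iota> (\<lambda>x. a * f x + b * g x) = a *\<^sub>R \<iota> f + b *\<^sub>R \<iota> g) \<and>
     (\<forall>f\<in>Hs D. \<forall>g\<in>Hs D. \<iota> f \<bullet> \<iota> g = dirichlet D f g) \<and>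
     closure (\<iota> ` Hs D) = UNIV"

text \<open>The element \<open>u\<close> of \<open>H(D)\<close> is the function \<open>f\<close>, which need not be smooth:
  some sequence in \<open>Hs D\<close> converges to \<open>f\<close> in the Dirichlet norm and to \<open>u\<close> in \<open>H(D)\<close>.\<close>

definition represents ::
    "'a::euclidean_space set \<Rightarrow> (('a \<Rightarrow> real) \<Rightarrow> 'h::{real_inner,complete_space})
      \<Rightarrow> ('a \<Rightarrow> real) \<Rightarrow> 'h \<Rightarrow> bool" where
  "represents D \<iota> f u \<longleftrightarrow>
     (\<exists>F. (\<forall>k::nat. F k \<in> Hs D \<and>
              set_integrable lebesgue D (\<lambda>x. (norm (grad (\<lambda>y. F k y - f y) x))\<^sup>2)) \<and>
          (\<lambda>k. dirichlet D (\<lambda>y. F k y - f y) (\<lambda>y. F k y - f y)) \<longlonglongrightarrow> 0 \<and>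
          (\<lambda>k. \<iota> (F k)) \<longlonglongrightarrow> u)"

section \<open>Gaussian free fields\<close>

definition centered_gaussian :: "'w measure \<Rightarrow> ('w \<Rightarrow> real) \<Rightarrow> bool" where
  "centered_gaussian M Y \<longleftrightarrow> Y \<in> borel_measurable M \<and>
     ((AE \<omega> in M. Y \<omega> = 0) \<or>
      (\<exists>\<sigma>>0. distributed M lborel Y (\<lambda>x. ennreal (normal_density 0 \<sigma> x))))"

text \<open>An element of \<open>L\<^sup>2\<close> is given by its representatives; closedness forces the
  set \<open>G\<close> to contain all random variables almost surely equal to one of its members.\<close>

definition gaussian_hilbert_space :: "'w measure \<Rightarrow> ('w \<Rightarrow> real) set \<Rightarrow> bool" where
  "gaussian_hilbert_space M G \<longleftrightarrow>
     prob_space M \<and>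
     (\<forall>Y\<in>G. centered_gaussian M Y) \<and>
     (\<lambda>\<omega>. 0) \<in> G \<and>
     (\<forall>Y\<in>G. \<forall>Z\<in>G. \<forall>a b. (\<lambda>\<omega>. a * Y \<omega> + b * Z \<omega>) \<in> G) \<and>
     (\<forall>Y\<in>borel_measurable M. integrable M (\<lambda>\<omega>. (Y \<omega>)\<^sup>2) \<longrightarrow>
        (\<forall>\<epsilon>>0. \<exists>Z\<in>G. (LINT \<omega>|M. (Z \<omega> - Y \<omega>)\<^sup>2) < \<epsilon>) \<longrightarrow> Y \<in> G)"

text \<open>\<open>X u\<close> is the random variable \<open>(h, u)\<close>; as these are elements of \<open>L\<^sup>2\<close>, linearity
  means almost sure linearity.\<close>

definition gaussian_free_field ::
    "'w measure \<Rightarrow> ('h::{real_inner,complete_space} \<Rightarrow> 'w \<Rightarrow> real) \<Rightarrow> bool" where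
  "gaussian_free_field M X \<longleftrightarrow>
     (\<forall>u. X u \<in> borel_measurable M) \<and>
     gaussian_hilbert_space M {Y \<in> borel_measurable M. \<exists>u. AE \<omega> in M. Y \<omega> = X u \<omega>} \<and>
     (\<forall>u v a b. AE \<omega> in M. X (a *\<^sub>R u + b *\<^sub>R v) \<omega> = a * X u \<omega> + b * X v \<omega>) \<and>
     (\<forall>u v. (LINT \<omega>|M. X u \<omega> * X v \<omega>) = u \<bullet> v)"

section \<open>Densities on finite-dimensional function spaces\<close>

definition lincomb :: "'i set \<Rightarrow> ('i \<Rightarrow> 'v \<Rightarrow> real) \<Rightarrow> ('i \<Rightarrow> real) \<Rightarrow> 'v \<Rightarrow> real" where
  "lincomb I b c = (\<lambda>x. \<Sum>i\<in>I. c i * b i x)"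

definition finite_basis :: "('v \<Rightarrow> real) set \<Rightarrow> 'i set \<Rightarrow> ('i \<Rightarrow> 'v \<Rightarrow> real) \<Rightarrow> bool" where
  "finite_basis V I b \<longleftrightarrow> finite I \<and> V = range (lincomb I b) \<and>
     (\<forall>c. lincomb I b c = (\<lambda>x. 0) \<longrightarrow> (\<forall>i\<in>I. c i = 0))"

text \<open>The probability measure with density proportional to \<open>exp (- Q f / 2)\<close> with respect to
  Lebesgue measure on the span of the basis \<open>b\<close>. Lebesgue measure is transported from the
  coordinates; changing the basis multiplies it by a constant, which the normalisation cancels.\<close>

definition boltzmann_law ::
    "'i set \<Rightarrow> ('i \<Rightarrow> 'v \<Rightarrow> real) \<Rightarrow> (('v \<Rightarrow> real) \<Rightarrow> real) \<Rightarrow> ('v \<Rightarrow> real) measure" where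
  "boltzmann_law I b Q =
     (let \<mu> = (\<Pi>\<^sub>M i\<in>I. lborel);
          p = (\<lambda>c. ennreal (exp (- Q (lincomb I b c) / 2)))
      in distr (density \<mu> (\<lambda>c. p c / (\<integral>\<^sup>+ c'. p c' \<partial>\<mu>))) (\<Pi>\<^sub>M x\<in>UNIV. borel) (lincomb I b))"

section \<open>The harmonic crystal\<close>

text \<open>\<open>E\<close> is a set of two-element sets. Each edge occurs as two ordered pairs, whence the
  factor \<open>1/2\<close>.\<close>

definition graph_dirichlet ::
    "'v set set \<Rightarrow> ('v set \<Rightarrow> real) \<Rightarrow> ('v \<Rightarrow> real) \<Rightarrow> ('v \<Rightarrow> real) \<Rightarrow> real" where
  "graph_dirichlet E w \<phi> \<psi> =
     (\<Sum>(x, y) | x \<noteq> y \<and> {x, y} \<in> E. w {x, y} * (\<phi> y - \<phi> x) * (\<psi> y - \<psi> x)) / 2"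

text \<open>Functions on the vertex set \<open>\<Lambda>\<close> are extended by \<open>0\<close>; those vanishing on \<open>B\<close> have
  the indicators of the vertices in \<open>\<Lambda> - B\<close> as their standard basis.\<close>

definition harmonic_crystal ::
    "'v set \<Rightarrow> 'v set set \<Rightarrow> ('v set \<Rightarrow> real) \<Rightarrow> 'v set \<Rightarrow> ('v \<Rightarrow> real) measure" where
  "harmonic_crystal \<Lambda> E w B =
     boltzmann_law (\<Lambda> - B) (\<lambda>v. indicator {v}) (\<lambda>\<phi>. graph_dirichlet E w \<phi> \<phi>)"

section \<open>The triangular mesh\<close>

definition triangular_lattice :: "(real^2) set" where
  "triangular_lattice =
     {of_int a *\<^sub>R vector [1, 0] + of_int b *\<^sub>R vector [1/2, sqrt 3 / 2] | a b :: int. True}"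

definition mesh_vertices :: "nat \<Rightarrow> (real^2) set" where
  "mesh_vertices n = (\<lambda>v. (1 / real n) *\<^sub>R v) ` triangular_lattice"

definition mesh_triangles :: "nat \<Rightarrow> (real^2) set set" where
  "mesh_triangles n = {convex hull {x, y, z} | x y z.
     {x, y, z} \<subseteq> mesh_vertices n \<and>
     dist x y = 1 / real n \<and> dist y z = 1 / real n \<and> dist z x = 1 / real n}"

text \<open>Vanishing on the boundary of \<open>D\<close> is taken in the sense used for \<open>Hs D\<close>. Pointwise
  vanishing on \<open>frontier D\<close> would be too weak: for \<open>D\<close> the interior of the hexagon formed by the
  six triangles at a mesh vertex \<open>v\<close>, or a disc slit along a segment inside a triangle, it allows
  functions that are nonzero on triangles not contained in \<open>D\<close>.\<close>

definition Hn :: "(real^2) set \<Rightarrow> nat \<Rightarrow> (real^2 \<Rightarrow> real) set" where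
  "Hn D n = {f. continuous_on UNIV f \<and>
     (\<forall>T\<in>mesh_triangles n. \<exists>a c. \<forall>x\<in>T. f x = a \<bullet> x + c) \<and>
     compactly_supported_in f D}"

definition mesh_graph_vertices :: "(real^2) set \<Rightarrow> nat \<Rightarrow> (real^2) set" where
  "mesh_graph_vertices D n = mesh_vertices n \<inter> D"

definition mesh_graph_edges :: "(real^2) set \<Rightarrow> nat \<Rightarrow> (real^2) set set" where
  "mesh_graph_edges D n = {{x, y} | x y.
     x \<in> mesh_graph_vertices D n \<and> y \<in> mesh_graph_vertices D n \<and> dist x y = 1 / real n}"

definition mesh_graph_boundary :: "(real^2) set \<Rightarrow> nat \<Rightarrow> (real^2) set" where
  "mesh_graph_boundary D n =
     {v \<in> mesh_graph_vertices D n. \<exists>T\<in>mesh_triangles n. v \<in> T \<and> \<not> T \<subseteq> D}"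

section \<open>The projection of the field to the mesh functions\<close>

text \<open>The identity is required almost surely for each \<open>f\<close> separately, since the right-hand
  side is defined only up to null sets.\<close>

definition gff_mesh_projection ::
    "(real^2) set \<Rightarrow> nat \<Rightarrow> ((real^2 \<Rightarrow> real) \<Rightarrow> 'h::{real_inner,complete_space})
      \<Rightarrow> 'w measure \<Rightarrow> ('h \<Rightarrow> 'w \<Rightarrow> real) \<Rightarrow> ('w \<Rightarrow> real^2 \<Rightarrow> real) \<Rightarrow> bool" where
  "gff_mesh_projection D n \<iota> M X hn \<longleftrightarrow>
     hn \<in> measurable M (\<Pi>\<^sub>M x\<in>UNIV. borel) \<and>
     (\<forall>\<omega>\<in>space M. hn \<omega> \<in> Hn D n) \<and>
     (\<forall>f\<in>Hn D n. \<exists>u. represents D \<iota> f u \<and> (AE \<omega> in M. dirichlet D (hn \<omega>) f = X u \<omega>))"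

end

(*
  In an orthonormal basis e_i of H_n(D) the projected field is the sum of (h, e_i) e_i, and the
  coefficients are independent standard normal variables.  Independence of jointly Gaussian
  uncorrelated variables is reduced to the one-dimensional uniqueness theorem for characteristic
  functions: under the positive weights 1 + cos Z and 1 + sin Z, with Z a linear combination of the
  remaining variables, the law of the first variable does not change.  Gram-Schmidt is a sequence of
  scalings and shears of the coordinates, so the Boltzmann law may be computed in any basis, in
  particular in the basis of tent functions.

  The Dirichlet form: for the three edge directions d of the mesh, |grad f|^2 is 2/3 times the sum of
  the squared directional derivatives, and the derivative of a mesh function in direction d is
  constant on the parallelogram formed by the two triangles sharing an edge parallel to d.  Each
  parallelogram has area sqrt 3 / (2 n^2), whence the Dirichlet form is 3^(-1/2) times that of the
  graph with unit weights, and rescaling by 3^(1/4) matches the densities.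

  A mesh function belongs to H(D): in lattice coordinates s, t the tent function is the positive part
  of 1 - (|s| + |t| + |s + t|) / 2, and replacing the positive part of y by the smooth function
  y exp (- e / y) gives smooth functions with the same support and convergent gradients.
*)
theory Submission
  imports Defs "HOL-Real_Asymp.Real_Asymp"
begin

section \<open>Independence from the joint characteristic function\<close>

text \<open>The space \<open>H(D)\<close> is given only up to isometry and the values of
  \<open>X\<close> only up to null sets, so a mesh function enters through an unspecified limit of
  smooth functions. One estimate, which compares two smooth functions through a mesh function,
  settles both the existence and the uniqueness of that limit. From then on only inner products of
  the limits matter, and a choice that preserves inner products is automatically linear.

  Gradients are computed off the mesh lines, a null set. The three edge directions are used because
  unit vectors at angles of 60 degrees form a tight frame of the plane; along a single direction the
  derivative is a sum of vertex differences times indicators of disjoint parallelograms, so no cross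
  terms survive integration.

  The factor 3^(1/4) is put into the basis and not into the law. In the basis of tents multiplied by
  3^(1/4) the Dirichlet form in coordinates is the graph form itself, and both random functions
  become images of one measure on coordinates.\<close>

lemma char_weighted_imp_law:
  fixes X w :: "'w \<Rightarrow> real"
  assumes "prob_space M" "real_distribution N"
    and [measurable]: "X \<in> borel_measurable M"
    and w: "integrable M w" "\<And>\<omega>. w \<omega> \<ge> 0"
    and char: "\<And>s. (CLINT \<omega>|M. of_real (w \<omega>) * iexp (s * X \<omega>)) = char N s * of_real (LINT \<omega>|M. w \<omega>)"
    and A[measurable]: "A \<in> sets borel"
  shows "(LINT \<omega>|M. w \<omega> * indicator A (X \<omega>)) = measure N A * (LINT \<omega>|M. w \<omega>)"
proof -
  interpret M: prob_space M by fact
  interpret N: real_distribution N by fact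
  have [measurable]: "w \<in> borel_measurable M" using w by auto
  define c where "c = (LINT \<omega>|M. w \<omega>)"
  have c0: "c \<ge> 0" unfolding c_def using w by simp
  show ?thesis
  proof (cases "c = 0")
    case True
    then have "AE \<omega> in M. w \<omega> = 0"
      using w integral_nonneg_eq_0_iff_AE[of M w] unfolding c_def by auto
    then have "(LINT \<omega>|M. w \<omega> * indicator A (X \<omega>)) = (LINT \<omega>|M. 0)"
      by (intro integral_cong_AE) auto
    then show ?thesis using True c_def by simp
  next
    case False
    then have c: "c > 0" using c0 by simp
    \<comment> \<open>Under the probability measure with density \<open>w / c\<close> the
      characteristic function of \<open>X\<close> is that of \<open>N\<close>, so the
      one-dimensional uniqueness theorem applies. The case \<open>c = 0\<close>, where nothing can
      be normalised, has been split off.\<close>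
    define M' where "M' = density M (\<lambda>\<omega>. ennreal (w \<omega> / c))"
    have [measurable]: "X \<in> borel_measurable M'" by (simp add: M'_def)
    have "emeasure M' (space M') = (\<integral>\<^sup>+ \<omega>. ennreal (w \<omega> / c) \<partial>M)"
      unfolding M'_def by (simp add: emeasure_density)
    also have "\<dots> = ennreal (LINT \<omega>|M. w \<omega> / c)"
      using w c by (intro nn_integral_eq_integral) auto
    also have "\<dots> = 1" using c by (simp add: c_def[symmetric])
    finally interpret M': prob_space M' by (intro prob_spaceI)
    define N' where "N' = distr M' borel X"
    interpret N': real_distribution N'
      unfolding N'_def by (intro M'.real_distribution_distr) auto
    have eq: "N' = N"
    proof (rule Levy_uniqueness)
      show "real_distribution N'" "real_distribution N" by unfold_locales
      show "char N' = char N"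
      proof
        fix s
        have "char N' s = (CLINT \<omega>|M'. iexp (s * X \<omega>))"
          unfolding N'_def char_def by (subst integral_distr) auto
        also have "\<dots> = (CLINT \<omega>|M. (w \<omega> / c) *\<^sub>R iexp (s * X \<omega>))"
          unfolding M'_def using w c by (subst integral_density) auto
        also have "\<dots> = (CLINT \<omega>|M. of_real (w \<omega>) * iexp (s * X \<omega>) / of_real c)"
          by (intro Bochner_Integration.integral_cong) (auto simp: scaleR_conv_of_real)
        also have "\<dots> = (CLINT \<omega>|M. of_real (w \<omega>) * iexp (s * X \<omega>)) / of_real c"
          by simp
        also have "\<dots> = char N s" using char[of s] c by (simp add: c_def[symmetric])
        finally show "char N' s = char N s" .
      qed
    qed
    have "measure N A = (LINT x|N'. indicator A x)"
      unfolding eq by simp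
    also have "\<dots> = (LINT \<omega>|M'. indicator A (X \<omega>))"
      unfolding N'_def by (subst integral_distr) auto
    also have "\<dots> = (LINT \<omega>|M. (w \<omega> / c) *\<^sub>R indicator A (X \<omega>))"
      unfolding M'_def using w c by (subst integral_density) auto
    also have "\<dots> = (LINT \<omega>|M. w \<omega> * indicator A (X \<omega>) / c)"
      by (intro Bochner_Integration.integral_cong) auto
    also have "\<dots> = (LINT \<omega>|M. w \<omega> * indicator A (X \<omega>)) / c" by simp
    finally show ?thesis using c by (simp add: c_def[symmetric] field_simps)
  qed
qed

text \<open>The complex weight \<open>iexp (Z \<omega>)\<close> is not a density. It is recovered by
  linearity from the nonnegative weights a + b cos Z + d sin Z with |b| + |d| \<le> a, whose
  transforms involve just the frequencies -1, 0 and 1 of Z. The factor \<open>W\<close> will hold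
  the indicators of variables already treated.\<close>

lemma char_weighted_imp_law_iexp:
  fixes X W Z :: "'w \<Rightarrow> real" and k :: "real \<Rightarrow> complex"
  assumes "prob_space M" "real_distribution N"
    and [measurable]: "X \<in> borel_measurable M" "W \<in> borel_measurable M" "Z \<in> borel_measurable M"
    and W: "\<And>\<omega>. 0 \<le> W \<omega>" "\<And>\<omega>. W \<omega> \<le> 1"
    and char: "\<And>s \<sigma>. \<sigma> \<in> {-1, 0, 1} \<Longrightarrow>
      (CLINT \<omega>|M. of_real (W \<omega>) * iexp (s * X \<omega> + \<sigma> * Z \<omega>)) = char N s * k \<sigma>"
    and A[measurable]: "A \<in> sets borel"
  shows "(CLINT \<omega>|M. of_real (W \<omega> * indicator A (X \<omega>)) * iexp (Z \<omega>)) = measure N A * k 1"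
proof -
  interpret M: prob_space M by fact
  interpret N: real_distribution N by fact
  have bnd: "integrable M f" if "f \<in> borel_measurable M" "\<And>\<omega>. norm (f \<omega>) \<le> 3" for f :: "'w \<Rightarrow> complex"
    by (rule M.integrable_const_bound[of _ 3]) (use that in auto)
  have bndr: "integrable M f" if "f \<in> borel_measurable M" "\<And>\<omega>. norm (f \<omega>) \<le> 3" for f :: "'w \<Rightarrow> real"
    by (rule M.integrable_const_bound[of _ 3]) (use that in auto)
  have W1: "\<bar>W \<omega>\<bar> \<le> 1" for \<omega> using W[of \<omega>] by simp
  have i1: "integrable M (\<lambda>\<omega>. of_real (W \<omega>) * iexp (s * X \<omega> + \<sigma> * Z \<omega>))" for s \<sigma> :: real
    by (rule bnd) (use W1 in \<open>auto simp: norm_mult intro: order_trans[OF W1]\<close>)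
  have k: "(CLINT \<omega>|M. of_real (W \<omega>) * iexp (\<sigma> * Z \<omega>)) = k \<sigma>" if "\<sigma> \<in> {-1,0,1}" for \<sigma>
    using char[OF that, of 0] N.char_zero by simp
  have key: "(LINT \<omega>|M. (W \<omega> * (a + b * cos (Z \<omega>) + d * sin (Z \<omega>))) * indicator A (X \<omega>))
      = measure N A * (LINT \<omega>|M. W \<omega> * (a + b * cos (Z \<omega>) + d * sin (Z \<omega>)))"
    if abd: "\<bar>b\<bar> + \<bar>d\<bar> \<le> a" "a \<le> 1" for a b d
  proof -
    define w where "w \<omega> = W \<omega> * (a + b * cos (Z \<omega>) + d * sin (Z \<omega>))" for \<omega>
    have [measurable]: "w \<in> borel_measurable M" unfolding w_def by measurable
    have bc: "\<bar>b * cos z\<bar> \<le> \<bar>b\<bar>" "\<bar>d * sin z\<bar> \<le> \<bar>d\<bar>" for z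
      by (auto simp: abs_mult intro!: mult_left_le)
    have w0: "w \<omega> \<ge> 0" for \<omega>
      unfolding w_def using bc[of "Z \<omega>"] abd by (intro mult_nonneg_nonneg W) linarith
    have w2: "w \<omega> \<le> 2" for \<omega>
    proof -
      have "w \<omega> \<le> 1 * (a + b * cos (Z \<omega>) + d * sin (Z \<omega>))"
        unfolding w_def by (rule mult_right_mono[OF W(2)]) (use bc[of "Z \<omega>"] abd in linarith)
      moreover have "b * cos (Z \<omega>) \<le> \<bar>b\<bar>" "d * sin (Z \<omega>) \<le> \<bar>d\<bar>"
        using bc[of "Z \<omega>"] by (auto dest: abs_le_D1)
      ultimately show ?thesis using abd by simp
    qed
    have iw: "integrable M w" by (rule bndr) (use w0 w2 in \<open>auto intro: order_trans[OF w2]\<close>)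
    \<comment> \<open>Euler's formulas for cos and sin, with \<open>k\<close> evaluated at the three
      frequencies. The case s = 0 in \<open>Cw\<close> identifies this constant as the total
      weight.\<close>
    define C where "C = of_real a * k 0 + of_real b * (k 1 + k (-1)) / 2 - \<i> * of_real d * (k 1 - k (-1)) / 2"
    have ch: "(CLINT \<omega>|M. of_real (w \<omega>) * iexp (s * X \<omega>)) = char N s * C" for s
    proof -
      define e where "e \<sigma> \<omega> = of_real (W \<omega>) * iexp (s * X \<omega> + \<sigma> * Z \<omega>)" for \<sigma> \<omega>
      have e0: "iexp (s * X \<omega> + \<sigma> * Z \<omega>) = iexp (s * X \<omega>) * iexp (\<sigma> * Z \<omega>)" for \<sigma> \<omega>
        by (simp add: exp_add[symmetric] algebra_simps)
      have tr: "of_real (cos z) = (iexp z + iexp (- z)) / 2" "of_real (sin z) = - \<i> * (iexp z - iexp (- z)) / 2" for z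
        by (auto simp: complex_eq_iff Re_exp Im_exp)
      have "of_real (w \<omega>) * iexp (s * X \<omega>) =
        of_real a * e 0 \<omega> + (of_real b / 2) * (e 1 \<omega> + e (-1) \<omega>) - (\<i> * of_real d / 2) * (e 1 \<omega> - e (-1) \<omega>)" for \<omega>
      proof -
        have alg: "W * (a + b * ((u + v) / 2) + d * (- \<i> * (u - v) / 2)) * P
          = a * (W * (P * 1)) + (b / 2) * (W * (P * u) + W * (P * v)) - (\<i> * d / 2) * (W * (P * u) - W * (P * v))"
          for W a b d u v P :: complex by (simp add: field_simps)
        have z: "iexp (1 * Z \<omega>) = iexp (Z \<omega>)" "iexp (-1 * Z \<omega>) = iexp (- Z \<omega>)" "iexp (0 * Z \<omega>) = 1"
          by simp_all
        show ?thesis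
          unfolding w_def e_def e0 z
          unfolding of_real_mult[of "W \<omega>"] of_real_add of_real_mult[of b] of_real_mult[of d] tr
          by (rule alg)
      qed
      then have "(CLINT \<omega>|M. of_real (w \<omega>) * iexp (s * X \<omega>)) = (CLINT \<omega>|M.
        of_real a * e 0 \<omega> + (of_real b / 2) * (e 1 \<omega> + e (-1) \<omega>) - (\<i> * of_real d / 2) * (e 1 \<omega> - e (-1) \<omega>))"
        by simp
      also have "\<dots> = of_real a * (CLINT \<omega>|M. e 0 \<omega>) + (of_real b / 2) * ((CLINT \<omega>|M. e 1 \<omega>) + (CLINT \<omega>|M. e (-1) \<omega>)) - (\<i> * of_real d / 2) * ((CLINT \<omega>|M. e 1 \<omega>) - (CLINT \<omega>|M. e (-1) \<omega>))"
      proof -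
        have i: "integrable M (e \<sigma>)" for \<sigma> using i1[of s \<sigma>] by (simp add: e_def[abs_def])
        show ?thesis using i by (simp del: of_real_add)
      qed
      also have "\<dots> = char N s * C"
      proof -
        have "(CLINT \<omega>|M. e \<sigma> \<omega>) = char N s * k \<sigma>" if "\<sigma> \<in> {-1, 0, 1}" for \<sigma>
          unfolding e_def by (rule char[OF that])
        then show ?thesis by (simp add: C_def field_simps)
      qed
      finally show ?thesis .
    qed
    have Cw: "of_real (LINT \<omega>|M. w \<omega>) = C"
      using ch[of 0] N.char_zero by simp
    have "(LINT \<omega>|M. w \<omega> * indicator A (X \<omega>)) = measure N A * (LINT \<omega>|M. w \<omega>)"
      by (rule char_weighted_imp_law[OF assms(1,2)]) (use iw w0 ch Cw in auto)
    then show ?thesis unfolding w_def .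
  qed
  define L where "L a b d = (LINT \<omega>|M. (W \<omega> * (a + b * cos (Z \<omega>) + d * sin (Z \<omega>))) * indicator A (X \<omega>))" for a b d
  define K where "K a b d = (LINT \<omega>|M. W \<omega> * (a + b * cos (Z \<omega>) + d * sin (Z \<omega>)))" for a b d
  have tri: "\<bar>W \<omega> * f (Z \<omega>)\<bar> \<le> 1" if "\<And>z. \<bar>f z\<bar> \<le> (1::real)" for f \<omega>
    using mult_mono[OF W1 that] by (simp add: abs_mult)
  have iW: "integrable M W" by (rule bndr) (use W1 in \<open>auto intro: order_trans[OF W1]\<close>)
  have iC: "integrable M (\<lambda>\<omega>. W \<omega> * cos (Z \<omega>))"
    by (rule bndr) (auto intro: order_trans[OF tri])
  have iS: "integrable M (\<lambda>\<omega>. W \<omega> * sin (Z \<omega>))"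
    by (rule bndr) (auto intro: order_trans[OF tri])
  have jj: "integrable M (\<lambda>\<omega>. f \<omega> * indicator A (X \<omega>))" if "integrable M f" for f :: "'w \<Rightarrow> real"
    by (rule Bochner_Integration.integrable_bound[OF that]) (use that in \<open>auto simp: indicator_def\<close>)
  have L: "L a b d = a * (LINT \<omega>|M. W \<omega> * indicator A (X \<omega>)) + b * (LINT \<omega>|M. W \<omega> * cos (Z \<omega>) * indicator A (X \<omega>))
      + d * (LINT \<omega>|M. W \<omega> * sin (Z \<omega>) * indicator A (X \<omega>))" for a b d
  proof -
    have "L a b d = (LINT \<omega>|M. a * (W \<omega> * indicator A (X \<omega>)) + b * (W \<omega> * cos (Z \<omega>) * indicator A (X \<omega>))
      + d * (W \<omega> * sin (Z \<omega>) * indicator A (X \<omega>)))"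
      unfolding L_def by (intro Bochner_Integration.integral_cong) (auto simp: algebra_simps)
    then show ?thesis using jj[OF iW] jj[OF iC] jj[OF iS] by simp
  qed
  have K: "K a b d = a * (LINT \<omega>|M. W \<omega>) + b * (LINT \<omega>|M. W \<omega> * cos (Z \<omega>))
      + d * (LINT \<omega>|M. W \<omega> * sin (Z \<omega>))" for a b d
  proof -
    have "K a b d = (LINT \<omega>|M. a * W \<omega> + b * (W \<omega> * cos (Z \<omega>)) + d * (W \<omega> * sin (Z \<omega>)))"
      unfolding K_def by (intro Bochner_Integration.integral_cong) (auto simp: algebra_simps)
    then show ?thesis using iW iC iS by simp
  qed
  have LK: "L a b d = measure N A * K a b d" if "\<bar>b\<bar> + \<bar>d\<bar> \<le> a" "a \<le> 1" for a b d
    using key[OF that] unfolding L_def K_def .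
  \<comment> \<open>The weights 1 and 1 + cos Z are admissible and their difference is cos Z; the
    instantiations are for \<open>b\<close>, \<open>d\<close>, \<open>a\<close> in this
    order.\<close>
  have 1: "(LINT \<omega>|M. W \<omega> * cos (Z \<omega>) * indicator A (X \<omega>)) = measure N A * (LINT \<omega>|M. W \<omega> * cos (Z \<omega>))"
    using LK[of 0 0 1] LK[of 1 0 1] unfolding L K by (simp add: algebra_simps)
  have 2: "(LINT \<omega>|M. W \<omega> * sin (Z \<omega>) * indicator A (X \<omega>)) = measure N A * (LINT \<omega>|M. W \<omega> * sin (Z \<omega>))"
    using LK[of 0 0 1] LK[of 0 1 1] unfolding L K by (simp add: algebra_simps)
  have ie: "iexp z = of_real (cos z) + \<i> * of_real (sin z)" for z
    by (auto simp: complex_eq_iff cis_conv_exp[symmetric])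
  have split: "(CLINT \<omega>|M. of_real (W \<omega>  * g \<omega>) * iexp (Z \<omega>)) =
      of_real (LINT \<omega>|M. W \<omega> * cos (Z \<omega>) * g \<omega>) + \<i> * of_real (LINT \<omega>|M. W \<omega> * sin (Z \<omega>) * g \<omega>)"
    if "integrable M (\<lambda>\<omega>. W \<omega> * cos (Z \<omega>) * g \<omega>)" "integrable M (\<lambda>\<omega>. W \<omega> * sin (Z \<omega>) * g \<omega>)" for g
  proof -
    have "(CLINT \<omega>|M. of_real (W \<omega>  * g \<omega>) * iexp (Z \<omega>)) =
      (CLINT \<omega>|M. of_real (W \<omega> * cos (Z \<omega>) * g \<omega>) + \<i> * of_real (W \<omega> * sin (Z \<omega>) * g \<omega>))"
      unfolding ie by (intro Bochner_Integration.integral_cong) (auto simp: algebra_simps)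
    also have "\<dots> = (CLINT \<omega>|M. of_real (W \<omega> * cos (Z \<omega>) * g \<omega>)) + (CLINT \<omega>|M. \<i> * of_real (W \<omega> * sin (Z \<omega>) * g \<omega>))"
      by (intro Bochner_Integration.integral_add integrable_mult_right integrable_of_real that)
    also have "(CLINT \<omega>|M. \<i> * of_real (W \<omega> * sin (Z \<omega>) * g \<omega>)) = \<i> * (CLINT \<omega>|M. of_real (W \<omega> * sin (Z \<omega>) * g \<omega>))"
      by (rule Bochner_Integration.integral_mult_right_zero)
    finally show ?thesis by (simp only: integral_complex_of_real)
  qed
  have "(CLINT \<omega>|M. of_real (W \<omega> * indicator A (X \<omega>)) * iexp (Z \<omega>)) =
     measure N A * (of_real (LINT \<omega>|M. W \<omega> * cos (Z \<omega>) * 1) + \<i> * of_real (LINT \<omega>|M. W \<omega> * sin (Z \<omega>) * 1))"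
    unfolding split[OF jj[OF iC] jj[OF iS]] 1 2 by (simp add: algebra_simps)
  also have "\<dots> = measure N A * (CLINT \<omega>|M. of_real (W \<omega> * 1) * iexp (Z \<omega>))"
    by (subst split) (use iC iS in auto)
  also have "\<dots> = measure N A * k 1" using k[of 1] by simp
  finally show ?thesis .
qed

text \<open>Coordinates move one at a time from the exponent, where a frequency is tested, to an
  indicator, where an event is tested. \<open>J = {}\<close> is the hypothesis on the joint
  characteristic function and \<open>J = I\<close> the product formula for rectangles.\<close>

lemma joint_char_imp_indep:
  fixes X :: "'i \<Rightarrow> 'w \<Rightarrow> real"
  assumes "prob_space M" "finite I"
    and N: "\<And>i. real_distribution (N i)"
    and X[measurable]: "\<And>i. i \<in> I \<Longrightarrow> X i \<in> borel_measurable M"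
    and char: "\<And>t. (CLINT \<omega>|M. iexp (\<Sum>i\<in>I. t i * X i \<omega>)) = (\<Prod>i\<in>I. char (N i) (t i))"
    and A[measurable]: "\<And>i. i \<in> I \<Longrightarrow> A i \<in> sets borel"
    and "J \<subseteq> I"
  shows "(CLINT \<omega>|M. of_real (\<Prod>i\<in>J. indicator (A i) (X i \<omega>)) * iexp (\<Sum>i\<in>I - J. t i * X i \<omega>))
    = (\<Prod>i\<in>J. of_real (measure (N i) (A i))) * (\<Prod>i\<in>I - J. char (N i) (t i))"
proof -
  have "finite J" using assms(2) \<open>J \<subseteq> I\<close> by (rule rev_finite_subset)
  then show ?thesis using \<open>J \<subseteq> I\<close>
  proof (induction J arbitrary: t)
    case empty
    then show ?case using char by simp
  next
    case (insert j J)
    then have j: "j \<in> I" "j \<notin> J" and J: "J \<subseteq> I" and fin: "finite J" by auto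
    define R where "R = I - insert j J"
    have IJ: "I - J = insert j R" "j \<notin> R" "finite R" using j J assms(2) by (auto simp: R_def)
    define k where "k \<sigma> = (\<Prod>i\<in>J. of_real (measure (N i) (A i))) * (\<Prod>i\<in>R. char (N i) (\<sigma> * t i))" for \<sigma>
    have RI: "i \<in> I" if "i \<in> R" for i using that by (auto simp: R_def)
    have Rj: "i \<noteq> j" if "i \<in> R" for i using that by (auto simp: R_def)
    have "(CLINT \<omega>|M. of_real ((\<Prod>i\<in>J. indicator (A i) (X i \<omega>)) * indicator (A j) (X j \<omega>)) * iexp (\<Sum>i\<in>R. t i * X i \<omega>))
      = measure (N j) (A j) * k 1"
    proof (rule char_weighted_imp_law_iexp[where k = k and Z = "\<lambda>\<omega>. \<Sum>i\<in>R. t i * X i \<omega>"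
          and W = "\<lambda>\<omega>. \<Prod>i\<in>J. indicator (A i) (X i \<omega>)"])
      fix s \<sigma> :: real
      \<comment> \<open>The induction hypothesis is taken with frequency \<open>s\<close> at
        \<open>j\<close> and all other frequencies multiplied by \<sigma>, which separates
        \<open>X j\<close> from the remaining linear combination. This is why \<open>t\<close> is
        arbitrary in the induction.\<close>
      have e1: "(CLINT \<omega>|M. of_real (\<Prod>i\<in>J. indicator (A i) (X i \<omega>)) * iexp (\<Sum>i\<in>I - J. ((\<lambda>i. \<sigma> * t i)(j := s)) i * X i \<omega>))
        = (\<Prod>i\<in>J. of_real (measure (N i) (A i))) * (\<Prod>i\<in>I - J. char (N i) (((\<lambda>i. \<sigma> * t i)(j := s)) i))"
        by (rule insert.IH[OF J])
      have e2: "(\<Sum>i\<in>I - J. ((\<lambda>i. \<sigma> * t i)(j := s)) i * X i \<omega>) = s * X j \<omega> + \<sigma> * (\<Sum>i\<in>R. t i * X i \<omega>)" for \<omega>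
      proof -
        have "(\<Sum>i\<in>R. ((\<lambda>i. \<sigma> * t i)(j := s)) i * X i \<omega>) = (\<Sum>i\<in>R. \<sigma> * t i * X i \<omega>)"
          by (intro sum.cong) (auto simp: Rj)
        then show ?thesis unfolding IJ(1) using IJ by (simp add: sum_distrib_left algebra_simps)
      qed
      have e3: "(\<Prod>i\<in>I - J. char (N i) (((\<lambda>i. \<sigma> * t i)(j := s)) i)) = char (N j) s * (\<Prod>i\<in>R. char (N i) (\<sigma> * t i))"
      proof -
        have "(\<Prod>i\<in>R. char (N i) (((\<lambda>i. \<sigma> * t i)(j := s)) i)) = (\<Prod>i\<in>R. char (N i) (\<sigma> * t i))"
          by (intro prod.cong) (auto simp: Rj)
        then show ?thesis unfolding IJ(1) using IJ by simp
      qed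
      show "(CLINT \<omega>|M. of_real (\<Prod>i\<in>J. indicator (A i) (X i \<omega>)) * iexp (s * X j \<omega> + \<sigma> * (\<Sum>i\<in>R. t i * X i \<omega>)))
         = char (N j) s * k \<sigma>" using e1 unfolding e2 e3 k_def by (simp only: mult_ac)
    next
      show "(\<lambda>\<omega>. \<Prod>i\<in>J. indicator (A i) (X i \<omega>) :: real) \<in> borel_measurable M"
        using J by (intro borel_measurable_prod measurable_compose[OF X borel_measurable_indicator] A) auto
      show "(\<lambda>\<omega>. \<Sum>i\<in>R. t i * X i \<omega>) \<in> borel_measurable M"
        using RI by measurable
      fix \<omega>
      show "0 \<le> (\<Prod>i\<in>J. indicator (A i) (X i \<omega>) :: real)" by (intro prod_nonneg) auto
      show "(\<Prod>i\<in>J. indicator (A i) (X i \<omega>) :: real) \<le> 1" by (intro prod_le_1) (auto simp: indicator_def)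
    qed (use assms j in auto)
    then show ?case unfolding R_def[symmetric] k_def using fin j by (simp add: mult_ac)
  qed
qed

lemma joint_char_imp_distr_PiM:
  fixes X :: "'i \<Rightarrow> 'w \<Rightarrow> real"
  assumes "prob_space M" "finite I"
    and N: "\<And>i. real_distribution (N i)"
    and X[measurable]: "\<And>i. i \<in> I \<Longrightarrow> X i \<in> borel_measurable M"
    and char: "\<And>t. (CLINT \<omega>|M. iexp (\<Sum>i\<in>I. t i * X i \<omega>)) = (\<Prod>i\<in>I. char (N i) (t i))"
  shows "distr M (\<Pi>\<^sub>M i\<in>I. borel) (\<lambda>\<omega>. \<lambda>i\<in>I. X i \<omega>) = (\<Pi>\<^sub>M i\<in>I. N i)"
proof -
  interpret M: prob_space M by fact
  interpret N: product_sigma_finite N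
    using N by (intro product_sigma_finite.intro)
      (metis prob_space_imp_sigma_finite real_distribution.axioms(1))
  show ?thesis
  proof (rule N.PiM_eqI)
    have meas: "(\<lambda>\<omega>. \<lambda>i\<in>I. X i \<omega>) \<in> measurable M (\<Pi>\<^sub>M i\<in>I. borel)"
      by (intro measurable_restrict) auto
    show "finite I" by fact
    fix A assume A0: "\<And>i. i \<in> I \<Longrightarrow> A i \<in> sets (N i)"
    then have A: "A i \<in> sets borel" if "i \<in> I" for i using A0[OF that] N real_distribution.events_eq_borel by metis
    interpret D: prob_space "distr M (\<Pi>\<^sub>M i\<in>I. borel) (\<lambda>\<omega>. \<lambda>i\<in>I. X i \<omega>)"
      by (rule M.prob_space_distr[OF meas])
    have mE: "Pi\<^sub>E I A \<in> sets (\<Pi>\<^sub>M i\<in>I. borel)" using A by (intro sets_PiM_I_finite assms) auto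
    have "measure (distr M (\<Pi>\<^sub>M i\<in>I. borel) (\<lambda>\<omega>. \<lambda>i\<in>I. X i \<omega>)) (Pi\<^sub>E I A)
       = measure M ((\<lambda>\<omega>. \<lambda>i\<in>I. X i \<omega>) -` Pi\<^sub>E I A \<inter> space M)"
      using meas mE by (rule measure_distr)
    also have "\<dots> = (LINT \<omega>|M. indicator ((\<lambda>\<omega>. \<lambda>i\<in>I. X i \<omega>) -` Pi\<^sub>E I A) \<omega>)"
      by simp
    also have "\<dots> = (LINT \<omega>|M. (\<Prod>i\<in>I. indicator (A i) (X i \<omega>)))"
    proof (intro Bochner_Integration.integral_cong refl)
      fix \<omega>
      show "indicator ((\<lambda>\<omega>. \<lambda>i\<in>I. X i \<omega>) -` Pi\<^sub>E I A) \<omega> = (\<Prod>i\<in>I. indicator (A i) (X i \<omega>) :: real)"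
      proof (cases "\<forall>i\<in>I. X i \<omega> \<in> A i")
        case True then show ?thesis by (auto simp: indicator_def PiE_iff)
      next
        case False
        then obtain i where "i \<in> I" "X i \<omega> \<notin> A i" by auto
        then have "(\<Prod>i\<in>I. indicator (A i) (X i \<omega>) :: real) = 0"
          using assms(2) by (intro prod_zero) (auto intro!: bexI[of _ i])
        with False show ?thesis by (auto simp: indicator_def PiE_iff)
      qed
    qed
    also have "\<dots> = (\<Prod>i\<in>I. measure (N i) (A i))"
    proof -
      have "complex_of_real (LINT \<omega>|M. (\<Prod>i\<in>I. indicator (A i) (X i \<omega>))) =
          (CLINT \<omega>|M. of_real (\<Prod>i\<in>I. indicator (A i) (X i \<omega>)))"
        by (simp only: integral_complex_of_real)
      also have "\<dots> = of_real (\<Prod>i\<in>I. measure (N i) (A i))"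
        using joint_char_imp_indep[OF assms(1,2) N X char A order_refl, where t = "\<lambda>_. 0"] by simp
      finally show ?thesis by (simp only: of_real_eq_iff)
    qed
    finally show "emeasure (distr M (\<Pi>\<^sub>M i\<in>I. borel) (\<lambda>\<omega>. \<lambda>i\<in>I. X i \<omega>)) (Pi\<^sub>E I A) = (\<Prod>i\<in>I. emeasure (N i) (A i))"
    proof -
      assume *: "Sigma_Algebra.measure (distr M (Pi\<^sub>M I (\<lambda>i. borel)) (\<lambda>\<omega>. \<lambda>i\<in>I. X i \<omega>)) (Pi\<^sub>E I A) =
      (\<Prod>i\<in>I. Sigma_Algebra.measure (N i) (A i))"
      have "emeasure (N i) (A i) = ennreal (measure (N i) (A i))" if "i \<in> I" for i
      proof -
        interpret real_distribution "N i" by (rule N)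
        show ?thesis by (rule emeasure_eq_measure)
      qed
      then have "(\<Prod>i\<in>I. emeasure (N i) (A i)) = (\<Prod>i\<in>I. ennreal (measure (N i) (A i)))" by simp
      also have "\<dots> = ennreal (\<Prod>i\<in>I. measure (N i) (A i))" by (rule prod_ennreal) auto
      finally show ?thesis using * D.emeasure_eq_measure by simp
    qed
  next
    show "sets (distr M (Pi\<^sub>M I (\<lambda>i. borel)) (\<lambda>\<omega>. \<lambda>i\<in>I. X i \<omega>)) = sets (Pi\<^sub>M I N)"
      using N by (auto intro!: sets_PiM_cong simp: real_distribution.events_eq_borel)
  qed
qed

section \<open>Boltzmann laws and change of basis\<close>

lemma lincomb_measurable:
  assumes "finite I"
  shows "lincomb I b \<in> measurable (\<Pi>\<^sub>M i\<in>I. lborel) (\<Pi>\<^sub>M x\<in>UNIV. borel)"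
proof -
  have "(\<lambda>c. \<lambda>x\<in>UNIV. \<Sum>i\<in>I. c i * b i x) \<in> measurable (\<Pi>\<^sub>M i\<in>I. lborel) (\<Pi>\<^sub>M x\<in>UNIV. borel)"
    by (intro measurable_restrict) measurable
  then show ?thesis unfolding lincomb_def[abs_def] by (simp add: restrict_def)
qed

text \<open>Fubini isolates coordinate \<open>i\<close>, where the substitution is an affine map of
  the line. Its offset is constant in the inner integral because \<open>S\<close> ignores coordinate
  \<open>i\<close>, so |d| is the whole Jacobian.\<close>

lemma nn_integral_PiM_lborel_update:
  fixes S :: "('i \<Rightarrow> real) \<Rightarrow> real"
  assumes "finite I" "i \<in> I" "d \<noteq> 0"
    and S: "S \<in> borel_measurable (\<Pi>\<^sub>M i\<in>I. lborel)" "\<And>c x. S (c(i := x)) = S c"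
    and F[measurable]: "F \<in> borel_measurable (\<Pi>\<^sub>M i\<in>I. lborel)"
  shows "(\<integral>\<^sup>+ c. F c \<partial>(\<Pi>\<^sub>M i\<in>I. lborel)) =
    ennreal \<bar>d\<bar> * (\<integral>\<^sup>+ c. F (c(i := d * c i + S c)) \<partial>(\<Pi>\<^sub>M i\<in>I. lborel))"
proof -
  interpret product_sigma_finite "\<lambda>_::'i. lborel :: real measure" by standard
  note S(1)[measurable]
  obtain J where J: "I = insert i J" "i \<notin> J" "finite J"
    using assms(1,2) by (metis finite_insert mk_disjoint_insert)
  have upd: "(\<lambda>c. c(i := d * c i + S c)) \<in> measurable (\<Pi>\<^sub>M i\<in>I. lborel) (\<Pi>\<^sub>M i\<in>I. lborel)"
    using \<open>i \<in> I\<close> by (intro measurable_fun_upd[where J = I]) (auto simp: insert_absorb)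
  have G: "(\<lambda>c. F (c(i := d * c i + S c))) \<in> borel_measurable (\<Pi>\<^sub>M i\<in>insert i J. lborel)"
    using measurable_compose[OF upd F] unfolding J(1) .
  have F': "F \<in> borel_measurable (\<Pi>\<^sub>M i\<in>insert i J. lborel)" using F unfolding J(1) .
  have "(\<integral>\<^sup>+ c. F c \<partial>(\<Pi>\<^sub>M i\<in>I. lborel)) = (\<integral>\<^sup>+ c. (\<integral>\<^sup>+ y. F (c(i := y)) \<partial>lborel) \<partial>(\<Pi>\<^sub>M i\<in>J. lborel))"
    unfolding J(1) by (rule product_nn_integral_insert[OF J(3,2) F'])
  also have "\<dots> = (\<integral>\<^sup>+ c. ennreal \<bar>d\<bar> * (\<integral>\<^sup>+ y. F (c(i := S c + d * y)) \<partial>lborel) \<partial>(\<Pi>\<^sub>M i\<in>J. lborel))"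
  proof (intro nn_integral_cong nn_integral_real_affine \<open>d \<noteq> 0\<close>)
    fix c assume "c \<in> space (\<Pi>\<^sub>M i\<in>J. (lborel :: real measure))"
    then have "(\<lambda>y. c(i := y)) \<in> measurable lborel (\<Pi>\<^sub>M i\<in>insert i J. lborel)"
      by (intro measurable_fun_upd[where J = J]) auto
    from measurable_compose[OF this F'] show "(\<lambda>y. F (c(i := y))) \<in> borel_measurable borel" by simp
  qed
  also have "\<dots> = ennreal \<bar>d\<bar> * (\<integral>\<^sup>+ c. (\<integral>\<^sup>+ y. F (c(i := S c + d * y)) \<partial>lborel) \<partial>(\<Pi>\<^sub>M i\<in>J. lborel))"
  proof (rule nn_integral_cmult)
    have "(\<lambda>(c, y). c(i := y)) \<in> measurable ((\<Pi>\<^sub>M i\<in>J. lborel) \<Otimes>\<^sub>M lborel) (\<Pi>\<^sub>M i\<in>insert i J. (lborel :: real measure))"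
      by (rule measurable_add_dim)
    from measurable_compose[OF this G]
    have "(\<lambda>(c, y). F (c(i := S c + d * y))) \<in> borel_measurable ((\<Pi>\<^sub>M i\<in>J. lborel) \<Otimes>\<^sub>M lborel)"
      by (simp add: case_prod_beta' S(2) add.commute)
    then show "(\<lambda>c. \<integral>\<^sup>+ y. F (c(i := S c + d * y)) \<partial>lborel) \<in> borel_measurable (\<Pi>\<^sub>M i\<in>J. lborel)"
      by (rule lborel.borel_measurable_nn_integral)
  qed
  also have "(\<integral>\<^sup>+ c. (\<integral>\<^sup>+ y. F (c(i := S c + d * y)) \<partial>lborel) \<partial>(\<Pi>\<^sub>M i\<in>J. lborel)) =
      (\<integral>\<^sup>+ c. F (c(i := d * c i + S c)) \<partial>(\<Pi>\<^sub>M i\<in>I. lborel))"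
    unfolding J(1) by (subst product_nn_integral_insert[OF J(3,2) G]) (simp add: S(2) add.commute)
  finally show ?thesis .
qed

text \<open>The Jacobian |d| multiplies the numerator and the partition function alike.\<close>

lemma boltzmann_law_update:
  fixes S :: "('i \<Rightarrow> real) \<Rightarrow> real"
  assumes "finite I" "i \<in> I" "d \<noteq> 0"
    and S: "S \<in> borel_measurable (\<Pi>\<^sub>M i\<in>I. lborel)" "\<And>c x. S (c(i := x)) = S c"
    and b': "\<And>c. lincomb I b' c = lincomb I b (c(i := d * c i + S c))"
    and Q: "(\<lambda>c. Q (lincomb I b c)) \<in> borel_measurable (\<Pi>\<^sub>M i\<in>I. lborel)"
  shows "boltzmann_law I b' Q = boltzmann_law I b Q"
proof -
  let ?\<mu> = "\<Pi>\<^sub>M i\<in>I. (lborel :: real measure)"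
  define T where "T c = c(i := d * c i + S c)" for c
  define p where "p c = ennreal (exp (- Q (lincomb I b c) / 2))" for c
  note Q[measurable] S(1)[measurable]
  have p[measurable]: "p \<in> borel_measurable ?\<mu>" unfolding p_def by measurable
  have T[measurable]: "T \<in> measurable ?\<mu> ?\<mu>"
    unfolding T_def using \<open>i \<in> I\<close> by (intro measurable_fun_upd[where J = I]) (auto simp: insert_absorb)
  have L[measurable]: "lincomb I b \<in> measurable ?\<mu> (\<Pi>\<^sub>M x\<in>UNIV. borel)"
    "lincomb I b' \<in> measurable ?\<mu> (\<Pi>\<^sub>M x\<in>UNIV. borel)" using lincomb_measurable assms(1) by blast+
  have b'': "lincomb I b' = (\<lambda>c. lincomb I b (T c))" unfolding T_def using b' by auto
  have int: "(\<integral>\<^sup>+ c. F c \<partial>?\<mu>) = ennreal \<bar>d\<bar> * (\<integral>\<^sup>+ c. F (T c) \<partial>?\<mu>)" if "F \<in> borel_measurable ?\<mu>" for F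
    unfolding T_def by (rule nn_integral_PiM_lborel_update) (use assms that in auto)
  define Z where "Z = (\<integral>\<^sup>+ c. p (T c) \<partial>?\<mu>)"
  have Z: "(\<integral>\<^sup>+ c. p c \<partial>?\<mu>) = ennreal \<bar>d\<bar> * Z" unfolding Z_def by (rule int) measurable
  show ?thesis
  proof (rule measure_eqI)
    show "sets (boltzmann_law I b' Q) = sets (boltzmann_law I b Q)"
      by (simp add: boltzmann_law_def Let_def)
    fix A assume "A \<in> sets (boltzmann_law I b' Q)"
    then have A[measurable]: "A \<in> sets (\<Pi>\<^sub>M x\<in>UNIV. borel)" by (simp add: boltzmann_law_def Let_def)
    have ems: "emeasure (distr (density ?\<mu> f) (\<Pi>\<^sub>M x\<in>UNIV. borel) g) A = (\<integral>\<^sup>+ c. f c * indicator A (g c) \<partial>?\<mu>)"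
      if [measurable]: "f \<in> borel_measurable ?\<mu>" "g \<in> measurable ?\<mu> (\<Pi>\<^sub>M x\<in>UNIV. borel)" for f g
      by (subst emeasure_distr) (auto simp: emeasure_density intro!: nn_integral_cong simp: indicator_def space_density)
    have "emeasure (boltzmann_law I b Q) A = (\<integral>\<^sup>+ c. p c / (ennreal \<bar>d\<bar> * Z) * indicator A (lincomb I b c) \<partial>?\<mu>)"
      unfolding boltzmann_law_def Let_def p_def[symmetric] Z by (rule ems) measurable
    also have "\<dots> = ennreal \<bar>d\<bar> * (\<integral>\<^sup>+ c. p (T c) / (ennreal \<bar>d\<bar> * Z) * indicator A (lincomb I b (T c)) \<partial>?\<mu>)"
      by (rule int) measurable
    also have "\<dots> = (\<integral>\<^sup>+ c. ennreal \<bar>d\<bar> * (p (T c) / (ennreal \<bar>d\<bar> * Z) * indicator A (lincomb I b (T c))) \<partial>?\<mu>)"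
      by (rule nn_integral_cmult[symmetric]) measurable
    also have "\<dots> = (\<integral>\<^sup>+ c. p (T c) / Z * indicator A (lincomb I b (T c)) \<partial>?\<mu>)"
    proof (intro nn_integral_cong)
      fix c
      \<comment> \<open>The partition function \<open>Z\<close> is not known to be positive and
        finite at this point; the quotient splits because |d| is neither 0 nor infinite.\<close>
      have d: "ennreal \<bar>d\<bar> \<noteq> 0" "ennreal \<bar>d\<bar> \<noteq> top" using \<open>d \<noteq> 0\<close> by auto
      then have "ennreal \<bar>d\<bar> * inverse (ennreal \<bar>d\<bar>) = 1"
        by (metis ennreal_divide_self divide_ennreal_def less_top)
      moreover have "inverse (ennreal \<bar>d\<bar> * Z) = inverse (ennreal \<bar>d\<bar>) * inverse Z"
        using d by (intro ennreal_inverse_mult') auto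
      ultimately show "ennreal \<bar>d\<bar> * (p (T c) / (ennreal \<bar>d\<bar> * Z) * indicator A (lincomb I b (T c)))
          = p (T c) / Z * indicator A (lincomb I b (T c))"
        unfolding divide_ennreal_def by (metis (no_types, lifting) mult.assoc mult.left_commute mult_1)
    qed
    also have "\<dots> = emeasure (boltzmann_law I b' Q) A"
      unfolding boltzmann_law_def Let_def b'' p_def[symmetric] Z_def by (rule ems[symmetric]) measurable
    finally show "emeasure (boltzmann_law I b' Q) A = emeasure (boltzmann_law I b Q) A" ..
  qed
qed

section \<open>Elementary operations on a basis\<close>

lemma lincomb_scale:
  assumes "finite I" "i \<in> I"
  shows "lincomb I (b(i := (\<lambda>x. d * b i x))) c = lincomb I b (c(i := d * c i))"
  unfolding lincomb_def using assms by (auto simp: fun_eq_iff intro!: sum.cong)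

text \<open>Coordinates transform dually to basis vectors: adding a multiple of vector
  \<open>j\<close> to vector \<open>i\<close> alters coordinate \<open>j\<close>, not coordinate
  \<open>i\<close>.\<close>

lemma lincomb_shear:
  assumes "finite I" "i \<in> I" "j \<in> I" "i \<noteq> j"
  shows "lincomb I (b(i := (\<lambda>x. b i x + s * b j x))) c = lincomb I b (c(j := c j + s * c i))"
proof
  fix x
  have I: "I = insert i (insert j (I - {i, j}))" using assms by auto
  have [simp]: "finite (I - {i,j})" using assms by auto
  have 1: "(\<Sum>k\<in>I - {i,j}. c k * (b(i := (\<lambda>x. b i x + s * b j x))) k x) = (\<Sum>k\<in>I - {i,j}. (c(j := c j + s * c i)) k * b k x)"
    by (intro sum.cong) auto
  show "lincomb I (b(i := (\<lambda>x. b i x + s * b j x))) c x = lincomb I b (c(j := c j + s * c i)) x"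
    unfolding lincomb_def by (subst (1 2) I) (use assms 1 in \<open>simp add: algebra_simps\<close>)
qed

text \<open>Span, independence and law travel together so that operations compose. Independence and
  measurability are implications from the old family to the new one, which makes the relation
  reflexive and transitive on arbitrary families.\<close>

definition basis_op_equiv ::
    "'i set \<Rightarrow> (('v \<Rightarrow> real) \<Rightarrow> real) \<Rightarrow> ('i \<Rightarrow> 'v \<Rightarrow> real) \<Rightarrow> ('i \<Rightarrow> 'v \<Rightarrow> real) \<Rightarrow> bool" where
  "basis_op_equiv I Q b b' \<longleftrightarrow> range (lincomb I b') = range (lincomb I b) \<and>
     ((\<forall>c. lincomb I b c = (\<lambda>x. 0) \<longrightarrow> (\<forall>i\<in>I. c i = 0)) \<longrightarrow>
      (\<forall>c. lincomb I b' c = (\<lambda>x. 0) \<longrightarrow> (\<forall>i\<in>I. c i = 0))) \<and>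
     ((\<lambda>c. Q (lincomb I b c)) \<in> borel_measurable (\<Pi>\<^sub>M i\<in>I. lborel) \<longrightarrow>
      (\<lambda>c. Q (lincomb I b' c)) \<in> borel_measurable (\<Pi>\<^sub>M i\<in>I. lborel) \<and>
      boltzmann_law I b' Q = boltzmann_law I b Q)"

lemma basis_op_equiv_refl: "basis_op_equiv I Q b b"
  by (auto simp: basis_op_equiv_def)

lemma basis_op_equiv_trans:
  "basis_op_equiv I Q b b' \<Longrightarrow> basis_op_equiv I Q b' b'' \<Longrightarrow> basis_op_equiv I Q b b''"
  unfolding basis_op_equiv_def by auto

text \<open>A triangular substitution with nonzero diagonal entry is invertible. The condition that
  \<open>S\<close> vanishes with all coordinates other than \<open>i\<close> is what transfers
  linear independence.\<close>

lemma basis_op_equiv_update: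
  fixes S :: "('i \<Rightarrow> real) \<Rightarrow> real"
  assumes "finite I" "i \<in> I" "d \<noteq> 0"
    and S: "S \<in> borel_measurable (\<Pi>\<^sub>M i\<in>I. lborel)" "\<And>c x. S (c(i := x)) = S c"
      "\<And>c. (\<forall>j\<in>I - {i}. c j = 0) \<Longrightarrow> S c = 0"
    and b': "\<And>c. lincomb I b' c = lincomb I b (c(i := d * c i + S c))"
  shows "basis_op_equiv I Q b b'"
proof -
  have "lincomb I b c \<in> range (lincomb I b')" for c
  proof -
    \<comment> \<open>The solution x of d x + S c = c i at coordinate \<open>i\<close>;
      \<open>S\<close> takes the same value at \<open>c'\<close> and at \<open>c\<close>.\<close>
    define c' where "c' = c(i := (c i - S c) / d)"
    have "c'(i := d * c' i + S c') = c" using \<open>d \<noteq> 0\<close> by (auto simp: c'_def S(2))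
    then have "lincomb I b' c' = lincomb I b c" using b' by simp
    then show ?thesis by (metis rangeI)
  qed
  moreover have "lincomb I b' c \<in> range (lincomb I b)" for c using b' by auto
  ultimately have "range (lincomb I b') = range (lincomb I b)" by blast
  moreover have "\<forall>j\<in>I. c j = 0" if ind: "\<And>c. lincomb I b c = (\<lambda>x. 0) \<Longrightarrow> (\<forall>i\<in>I. c i = 0)"
      and c: "lincomb I b' c = (\<lambda>x. 0)" for c
  proof -
    have *: "\<forall>j\<in>I. (c(i := d * c i + S c)) j = 0" using ind c b' by metis
    have "\<forall>j\<in>I - {i}. c j = 0"
    proof
      fix j assume "j \<in> I - {i}"
      then show "c j = 0" using bspec[OF *, of j] by simp
    qed
    then have "S c = 0" by (rule S(3))
    with * \<open>i \<in> I\<close> \<open>d \<noteq> 0\<close> have "c i = 0" by auto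
    with \<open>\<forall>j\<in>I - {i}. c j = 0\<close> show ?thesis by auto
  qed
  moreover have "(\<lambda>c. Q (lincomb I b' c)) \<in> borel_measurable (\<Pi>\<^sub>M i\<in>I. lborel)"
    if m: "(\<lambda>c. Q (lincomb I b c)) \<in> borel_measurable (\<Pi>\<^sub>M i\<in>I. lborel)"
  proof -
    note S(1)[measurable]
    have "(\<lambda>c. c(i := d * c i + S c)) \<in> measurable (\<Pi>\<^sub>M i\<in>I. lborel) (\<Pi>\<^sub>M i\<in>I. lborel)"
      using \<open>i \<in> I\<close> by (intro measurable_fun_upd[where J = I]) (auto simp: insert_absorb)
    from measurable_compose[OF this m] show ?thesis by (simp add: b')
  qed
  ultimately show ?thesis
    unfolding basis_op_equiv_def using boltzmann_law_update[OF assms(1-3) S(1,2) b', where Q = Q] by blast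
qed

lemma basis_op_equiv_scale:
  assumes "finite I" "i \<in> I" "d \<noteq> 0"
  shows "basis_op_equiv I Q b (b(i := (\<lambda>x. d * b i x)))"
  by (rule basis_op_equiv_update[OF assms, where S = "\<lambda>_. 0"]) (use assms in \<open>auto simp: lincomb_scale\<close>)

lemma basis_op_equiv_shear:
  assumes "finite I" "i \<in> I" "j \<in> I" "i \<noteq> j"
  shows "basis_op_equiv I Q b (b(i := (\<lambda>x. b i x + s * b j x)))"
  by (rule basis_op_equiv_update[OF assms(1,3) one_neq_zero, where S = "\<lambda>c. s * c i"])
    (use assms in \<open>auto simp: lincomb_shear\<close>)

lemma basis_op_equiv_shear_sum:
  assumes "finite I" "i \<in> I" "finite J" "J \<subseteq> I" "i \<notin> J"
  shows "basis_op_equiv I Q b (b(i := (\<lambda>x. b i x + (\<Sum>j\<in>J. s j * b j x))))"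
  using assms(3,4,5)
proof (induction J)
  case empty
  then show ?case by (simp add: basis_op_equiv_refl)
next
  case (insert j J)
  let ?b = "b(i := (\<lambda>x. b i x + (\<Sum>j\<in>J. s j * b j x)))"
  have step: "basis_op_equiv I Q ?b (?b(i := (\<lambda>x. ?b i x + s j * ?b j x)))"
    using insert.prems assms by (intro basis_op_equiv_shear) auto
  have eq: "?b(i := (\<lambda>x. ?b i x + s j * ?b j x)) = b(i := (\<lambda>x. b i x + (\<Sum>j\<in>insert j J. s j * b j x)))"
    using insert by (auto simp: fun_eq_iff)
  have "basis_op_equiv I Q b ?b" by (rule insert.IH) (use insert.prems in auto)
  then show ?case by (rule basis_op_equiv_trans[OF _ step[unfolded eq]])
qed

section \<open>Inner products on finite-dimensional function spaces\<close>

locale function_inner_product =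
  fixes V :: "('v \<Rightarrow> real) set" and B :: "('v \<Rightarrow> real) \<Rightarrow> ('v \<Rightarrow> real) \<Rightarrow> real"
  assumes lin_closed: "\<And>f g a b. f \<in> V \<Longrightarrow> g \<in> V \<Longrightarrow> (\<lambda>x. a * f x + b * g x) \<in> V"
    and zero_closed: "(\<lambda>x. 0) \<in> V"
    and B_lin: "\<And>f g h a b. f \<in> V \<Longrightarrow> g \<in> V \<Longrightarrow> h \<in> V \<Longrightarrow> B (\<lambda>x. a * f x + b * g x) h = a * B f h + b * B g h"
    and B_sym: "\<And>f g. B f g = B g f"
    and B_pos: "\<And>f. f \<in> V \<Longrightarrow> f \<noteq> (\<lambda>x. 0) \<Longrightarrow> B f f > 0"
begin

lemma B_zero: "h \<in> V \<Longrightarrow> B (\<lambda>x. 0) h = 0"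
  using B_lin[of h h h 0 0] by simp

lemma sum_closed:
  assumes "finite I" "\<And>i. i \<in> I \<Longrightarrow> b i \<in> V"
  shows "(\<lambda>x. \<Sum>i\<in>I. c i * b i x) \<in> V"
  using assms
proof (induction I)
  case (insert i I)
  then have "(\<lambda>x. c i * b i x + 1 * (\<Sum>i\<in>I. c i * b i x)) \<in> V" by (intro lin_closed) auto
  then show ?case using insert by simp
qed (simp add: zero_closed)

lemma B_sum:
  assumes "finite I" "\<And>i. i \<in> I \<Longrightarrow> b i \<in> V" "h \<in> V"
  shows "B (\<lambda>x. \<Sum>i\<in>I. c i * b i x) h = (\<Sum>i\<in>I. c i * B (b i) h)"
  using assms
proof (induction I)
  case empty
  then show ?case by (simp add: B_zero)
next
  case (insert i I)
  have "B (\<lambda>x. c i * b i x + 1 * (\<Sum>i\<in>I. c i * b i x)) h = c i * B (b i) h + 1 * B (\<lambda>x. \<Sum>i\<in>I. c i * b i x) h"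
    by (intro B_lin sum_closed) (use insert in auto)
  then show ?case using insert by simp
qed

definition orthonormal_on :: "'i set \<Rightarrow> ('i \<Rightarrow> 'v \<Rightarrow> real) \<Rightarrow> bool" where
  "orthonormal_on J b \<longleftrightarrow> (\<forall>i\<in>J. \<forall>j\<in>J. B (b i) (b j) = (if i = j then 1 else 0))"

lemma basis_closed:
  assumes "finite_basis V I b" "i \<in> I"
  shows "b i \<in> V"
proof -
  have "lincomb I b (\<lambda>j. if j = i then 1 else 0) = b i"
    using assms unfolding lincomb_def finite_basis_def by (auto simp: if_distrib if_distribR cong: if_cong)
  then show ?thesis using assms unfolding finite_basis_def by (metis rangeI)
qed

lemma basis_nonzero:
  assumes "finite_basis V I b" "i \<in> I"
  shows "b i \<noteq> (\<lambda>x. 0)"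
proof
  assume *: "b i = (\<lambda>x. 0)"
  have "lincomb I b (\<lambda>j. if j = i then 1 else 0) = b i"
    using assms unfolding lincomb_def finite_basis_def by (auto simp: if_distrib if_distribR cong: if_cong)
  then have "lincomb I b (\<lambda>j. if j = i then 1 else 0) = (\<lambda>x. 0)" using * by simp
  then have "\<forall>j\<in>I. (if j = i then 1 else 0) = (0::real)"
    by (rule assms(1)[unfolded finite_basis_def, THEN conjunct2, THEN conjunct2, rule_format, THEN ballI])
  then show False using assms(2) by auto
qed

lemma Q_measurable:
  assumes "finite_basis V I b"
  shows "(\<lambda>c. B (lincomb I b c) (lincomb I b c)) \<in> borel_measurable (\<Pi>\<^sub>M i\<in>I. lborel)"
proof -
  have fin: "finite I" using assms by (simp add: finite_basis_def)
  have V: "\<And>i. i \<in> I \<Longrightarrow> b i \<in> V" by (rule basis_closed[OF assms])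
  have "B (lincomb I b c) (lincomb I b c) = (\<Sum>i\<in>I. c i * (\<Sum>j\<in>I. c j * B (b j) (b i)))" for c
  proof -
    have LV: "lincomb I b c \<in> V" unfolding lincomb_def by (intro sum_closed fin V)
    have "B (lincomb I b c) (lincomb I b c) = (\<Sum>i\<in>I. c i * B (b i) (lincomb I b c))"
      using B_sum[OF fin V LV, where c = c] unfolding lincomb_def by simp
    also have "\<dots> = (\<Sum>i\<in>I. c i * B (lincomb I b c) (b i))" by (simp add: B_sym)
    also have "\<dots> = (\<Sum>i\<in>I. c i * (\<Sum>j\<in>I. c j * B (b j) (b i)))"
      unfolding lincomb_def by (intro sum.cong refl arg_cong2[where f = "(*)"] B_sum fin V)
    finally show ?thesis .
  qed
  then show ?thesis by simp
qed

text \<open>The induction runs over the part \<open>J\<close> already orthonormalised while the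
  whole family indexed by \<open>I\<close> stays a basis. Hence the next vector remains nonzero
  after its projections are subtracted and can be normalised, and the law is carried along by
  \<open>basis_op_equiv\<close>.\<close>

lemma orthonormal_basis_exists:
  assumes b: "finite_basis V I b"
  obtains e where "finite_basis V I e" "orthonormal_on I e"
    "boltzmann_law I e (\<lambda>f. B f f) = boltzmann_law I b (\<lambda>f. B f f)"
proof -
  have fin: "finite I" using b by (simp add: finite_basis_def)
  let ?eq = "basis_op_equiv I (\<lambda>f. B f f) b"
  have fb: "finite_basis V I e" if "?eq e" for e
    using b that[unfolded basis_op_equiv_def, THEN conjunct1]
      that[unfolded basis_op_equiv_def, THEN conjunct2, THEN conjunct1] fin
    unfolding finite_basis_def by simp
  have "\<exists>e. ?eq e \<and> orthonormal_on J e" if "finite J" "J \<subseteq> I" for J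
    using that
  proof (induction J)
    case empty
    then show ?case using basis_op_equiv_refl by (auto simp: orthonormal_on_def)
  next
    case (insert i J)
    then obtain e where e: "?eq e" and on: "orthonormal_on J e" by auto
    have eV: "e k \<in> V" if "k \<in> I" for k using basis_closed[OF fb[OF e] that] .
    \<comment> \<open>Minus the Fourier coefficients, so that \<open>g\<close> becomes orthogonal to
      the vectors with index in \<open>J\<close>.\<close>
    define s where "s j = - B (e i) (e j)" for j
    define g where "g = (\<lambda>x. e i x + (\<Sum>j\<in>J. s j * e j x))"
    define e1 where "e1 = e(i := g)"
    have e1: "?eq e1"
      unfolding e1_def g_def using insert fin
      by (intro basis_op_equiv_trans[OF e] basis_op_equiv_shear_sum) auto
    have gV: "g \<in> V" using basis_closed[OF fb[OF e1], of i] insert by (simp add: e1_def)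
    have g0: "g \<noteq> (\<lambda>x. 0)" using basis_nonzero[OF fb[OF e1], of i] insert by (simp add: e1_def)
    define d where "d = 1 / sqrt (B g g)"
    have Bg: "B g g > 0" by (rule B_pos[OF gV g0])
    then have d: "d \<noteq> 0" "d * d * B g g = 1" by (auto simp: d_def)
    define e2 where "e2 = e1(i := (\<lambda>x. d * e1 i x))"
    have e2: "?eq e2"
      unfolding e2_def using insert fin d by (intro basis_op_equiv_trans[OF e1] basis_op_equiv_scale) auto
    have e2i: "e2 i = (\<lambda>x. d * g x)" by (simp add: e2_def e1_def)
    have e2j: "e2 j = e j" if "j \<in> J" for j using that insert by (auto simp: e2_def e1_def)
    have sc: "B (\<lambda>x. d * g x) h = d * B g h" if "h \<in> V" for h
      using B_lin[of g g h d 0] gV that by simp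
    have gj: "B g (e j) = 0" if "j \<in> J" for j
    proof -
      have jI: "j \<in> I" using that insert by auto
      have "B (\<lambda>x. 1 * e i x + 1 * (\<Sum>j\<in>J. s j * e j x)) (e j) = 1 * B (e i) (e j) + 1 * B (\<lambda>x. \<Sum>j\<in>J. s j * e j x) (e j)"
        using insert jI by (intro B_lin sum_closed eV) auto
      also have "B (\<lambda>x. \<Sum>j\<in>J. s j * e j x) (e j) = (\<Sum>k\<in>J. s k * B (e k) (e j))"
        using insert jI by (intro B_sum eV) auto
      also have "\<dots> = (\<Sum>k\<in>J. if k = j then s k else 0)"
        using on that unfolding orthonormal_on_def by (intro sum.cong) auto
      also have "\<dots> = s j" using insert that by simp
      finally show ?thesis by (simp add: g_def s_def)
    qed
    have "orthonormal_on (insert i J) e2"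
      unfolding orthonormal_on_def
    proof (intro ballI)
      have dV: "(\<lambda>x. d * g x) \<in> V" using lin_closed[of g g d 0] gV by simp
      have ii: "B (e2 i) (e2 i) = 1"
      proof -
        have "B g (\<lambda>x. d * g x) = d * B g g" by (subst B_sym) (rule sc[OF gV])
        then show ?thesis unfolding e2i sc[OF dV] using d by simp
      qed
      have ij: "B (e2 i) (e2 j) = 0" if "j \<in> J" for j
        unfolding e2i e2j[OF that] using insert that gj[OF that] by (subst sc) (auto intro: eV)
      have ji: "B (e2 j) (e2 i) = 0" if "j \<in> J" for j
        by (subst B_sym) (rule ij[OF that])
      have jj: "B (e2 j) (e2 k) = (if j = k then 1 else 0)" if "j \<in> J" "k \<in> J" for j k
        using on that by (simp add: e2j orthonormal_on_def)
      fix k l assume "k \<in> insert i J" "l \<in> insert i J"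
      then show "B (e2 k) (e2 l) = (if k = l then 1 else 0)"
        using insert(2) by (auto simp: ii ij ji jj)
    qed
    with e2 show ?case by auto
  qed
  from this[OF fin order_refl] obtain e where e: "?eq e" "orthonormal_on I e" by auto
  have "boltzmann_law I e (\<lambda>f. B f f) = boltzmann_law I b (\<lambda>f. B f f)"
    using e(1)[unfolded basis_op_equiv_def, THEN conjunct2, THEN conjunct2, rule_format, OF Q_measurable[OF b]]
    by (rule conjunct2)
  then show ?thesis by (rule that[OF fb[OF e(1)] e(2)])
qed

lemma orthonormal_lincomb:
  assumes "finite_basis V I e" "orthonormal_on I e"
  shows "j \<in> I \<Longrightarrow> B (lincomb I e c) (e j) = c j"
    and "B (lincomb I e c) (lincomb I e c) = (\<Sum>i\<in>I. (c i)\<^sup>2)"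
proof -
  have fin: "finite I" using assms(1) by (simp add: finite_basis_def)
  have V: "\<And>i. i \<in> I \<Longrightarrow> e i \<in> V" by (rule basis_closed[OF assms(1)])
  have *: "B (lincomb I e c) (e j) = c j" if "j \<in> I" for j
  proof -
    have "B (lincomb I e c) (e j) = (\<Sum>k\<in>I. c k * B (e k) (e j))"
      unfolding lincomb_def using that by (intro B_sum fin V) auto
    also have "\<dots> = (\<Sum>k\<in>I. if k = j then c k else 0)"
      using assms(2) that unfolding orthonormal_on_def by (intro sum.cong) auto
    finally show ?thesis using fin that by simp
  qed
  then show "j \<in> I \<Longrightarrow> B (lincomb I e c) (e j) = c j" .
  have LV: "lincomb I e c \<in> V" unfolding lincomb_def by (intro sum_closed fin V)
  have "B (lincomb I e c) (lincomb I e c) = (\<Sum>i\<in>I. c i * B (e i) (lincomb I e c))"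
    using B_sum[OF fin V LV, where c = c] unfolding lincomb_def by simp
  also have "\<dots> = (\<Sum>i\<in>I. (c i)\<^sup>2)"
  proof (intro sum.cong refl)
    fix i assume "i \<in> I"
    then have "B (e i) (lincomb I e c) = c i" by (subst B_sym) (rule *)
    then show "c i * B (e i) (lincomb I e c) = (c i)\<^sup>2" by (simp add: power2_eq_square)
  qed
  finally show "B (lincomb I e c) (lincomb I e c) = (\<Sum>i\<in>I. (c i)\<^sup>2)" .
qed

text \<open>The energy is the sum of the squared coordinates, so the Boltzmann factor is a product
  of one-dimensional Gaussian weights and the partition function is \<open>sqrt (2 * pi)\<close> to
  the power \<open>card I\<close>.\<close>

lemma boltzmann_law_orthonormal:
  fixes I :: "'i set"
  assumes "finite_basis V I e" "orthonormal_on I e"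
  shows "boltzmann_law I e (\<lambda>f. B f f) = distr (\<Pi>\<^sub>M i\<in>I. std_normal_distribution) (\<Pi>\<^sub>M x\<in>UNIV. borel) (lincomb I e)"
proof -
  have fin: "finite I" using assms(1) by (simp add: finite_basis_def)
  interpret L: product_sigma_finite "\<lambda>_::'i. lborel :: real measure" by standard
  have psf: "prob_space std_normal_distribution" by (rule prob_space_normal_density) simp
  interpret N: product_prob_space "\<lambda>_::'i. std_normal_distribution"
    using psf by (simp add: product_prob_space_def product_prob_space_axioms_def product_sigma_finite_def prob_space_imp_sigma_finite)
  let ?\<mu> = "\<Pi>\<^sub>M i\<in>I. (lborel :: real measure)"
  define q where "q c = (\<Prod>i\<in>I. ennreal (std_normal_density (c i)))" for c
  have q[measurable]: "q \<in> borel_measurable ?\<mu>" unfolding q_def by measurable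
  have dens: "density ?\<mu> q = (\<Pi>\<^sub>M i\<in>I. std_normal_distribution)"
  proof (rule N.PiM_eqI[OF fin])
    show "sets (density ?\<mu> q) = sets (\<Pi>\<^sub>M i\<in>I. std_normal_distribution)"
      by (simp cong: sets_PiM_cong)
    fix A assume "\<And>i. i \<in> I \<Longrightarrow> A i \<in> sets std_normal_distribution"
    then have A[measurable]: "A i \<in> sets borel" if "i \<in> I" for i using that by simp
    have mE: "Pi\<^sub>E I A \<in> sets ?\<mu>" using A by (intro sets_PiM_I_finite fin) auto
    have "emeasure (density ?\<mu> q) (Pi\<^sub>E I A) = (\<integral>\<^sup>+ c. q c * indicator (Pi\<^sub>E I A) c \<partial>?\<mu>)"
      using mE by (intro emeasure_density) auto
    also have "\<dots> = (\<integral>\<^sup>+ c. (\<Prod>i\<in>I. ennreal (std_normal_density (c i)) * indicator (A i) (c i)) \<partial>?\<mu>)"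
    proof (rule nn_integral_cong)
      fix c assume "c \<in> space ?\<mu>"
      then have ext: "c \<in> extensional I" by (simp add: space_PiM PiE_def)
      have "indicator (Pi\<^sub>E I A) c = (\<Prod>i\<in>I. indicator (A i) (c i) :: ennreal)"
      proof (cases "c \<in> Pi\<^sub>E I A")
        case True then show ?thesis by (auto simp: PiE_iff)
      next
        case False
        then obtain i where "i \<in> I" "c i \<notin> A i" using ext by (auto simp: PiE_iff)
        then have "(\<Prod>i\<in>I. indicator (A i) (c i) :: ennreal) = 0" using fin by (intro prod_zero) (auto intro!: bexI[of _ i])
        with False show ?thesis by simp
      qed
      then show "q c * indicator (Pi\<^sub>E I A) c = (\<Prod>i\<in>I. ennreal (std_normal_density (c i)) * indicator (A i) (c i))"
        by (simp add: q_def prod.distrib)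
    qed
    also have "\<dots> = (\<Prod>i\<in>I. \<integral>\<^sup>+ x. ennreal (std_normal_density x) * indicator (A i) x \<partial>lborel)"
      by (rule L.product_nn_integral_prod[OF fin]) (use A in measurable)
    also have "\<dots> = (\<Prod>i\<in>I. emeasure std_normal_distribution (A i))"
      by (intro prod.cong refl) (simp add: emeasure_density A)
    finally show "emeasure (density ?\<mu> q) (Pi\<^sub>E I A) = (\<Prod>i\<in>I. emeasure std_normal_distribution (A i))" .
  qed
  define p where "p c = ennreal (exp (- B (lincomb I e c) (lincomb I e c) / 2))" for c
  define w where "w x = ennreal (exp (- x\<^sup>2 / 2))" for x :: real
  define z where "z = ennreal (sqrt (2 * pi))"
  have w: "w x = z * ennreal (std_normal_density x)" for x
    unfolding w_def z_def by (subst ennreal_mult[symmetric]) (auto simp: normal_density_def)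
  have p: "p c = (\<Prod>i\<in>I. w (c i))" for c
    unfolding p_def w_def orthonormal_lincomb(2)[OF assms]
    by (subst prod_ennreal) (auto simp: exp_sum[OF fin, symmetric] sum_negf sum_divide_distrib)
  have pq: "p c = z ^ card I * q c" for c
    unfolding p w q_def by (simp add: prod.distrib)
  have q1: "(\<integral>\<^sup>+ c. q c \<partial>?\<mu>) = 1"
  proof -
    have P: "emeasure (\<Pi>\<^sub>M i\<in>I. std_normal_distribution) (space (\<Pi>\<^sub>M i\<in>I. std_normal_distribution)) = 1"
      by (rule prob_space.emeasure_space_1[OF prob_space_PiM[OF psf]])
    have "emeasure (density ?\<mu> q) (space ?\<mu>) = (\<integral>\<^sup>+ c. q c * indicator (space ?\<mu>) c \<partial>?\<mu>)"
      unfolding q_def by (intro emeasure_density) measurable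
    also have "\<dots> = (\<integral>\<^sup>+ c. q c \<partial>?\<mu>)" by (intro nn_integral_cong) auto
    finally show ?thesis using P unfolding dens[symmetric] by simp
  qed
  have Z: "(\<integral>\<^sup>+ c. p c \<partial>?\<mu>) = z ^ card I"
    unfolding pq by (subst nn_integral_cmult) (simp_all add: q1 q)
  have z: "p c / z ^ card I = q c" for c
  proof -
    have "z \<noteq> 0" "z \<noteq> top" by (auto simp: z_def)
    then have "z ^ card I \<noteq> 0" "z ^ card I \<noteq> top" by (auto simp: power_eq_top_ennreal)
    then show ?thesis unfolding pq by (subst mult.commute) (rule mult_divide_eq_ennreal)
  qed
  have "boltzmann_law I e (\<lambda>f. B f f) =
      distr (density ?\<mu> (\<lambda>c. p c / (\<integral>\<^sup>+ c. p c \<partial>?\<mu>))) (\<Pi>\<^sub>M x\<in>UNIV. borel) (lincomb I e)"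
    unfolding boltzmann_law_def Let_def p_def ..
  also have "\<dots> = distr (density ?\<mu> q) (\<Pi>\<^sub>M x\<in>UNIV. borel) (lincomb I e)"
    by (simp only: Z z)
  finally show ?thesis unfolding dens .
qed

end

section \<open>Smooth approximation of the positive part\<close>

lemma Ck_SucI:
  assumes "\<And>x. (f has_derivative f' x) (at x)" "\<And>i. i \<in> Basis \<Longrightarrow> Ck k (\<lambda>x. f' x i)"
  shows "Ck (Suc k) f"
proof -
  have "frechet_derivative f (at x) = f' x" for x
    using frechet_derivative_at[OF assms(1)] by simp
  then show ?thesis using assms by (auto simp: differentiable_def)
qed

lemma Ck_SucD:
  assumes "Ck (Suc k) f"
  shows "(f has_derivative frechet_derivative f (at x)) (at x)"
    and "i \<in> Basis \<Longrightarrow> Ck k (\<lambda>x. frechet_derivative f (at x) i)"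
  using assms by (auto simp: frechet_derivative_works[symmetric])

lemma Ck_continuous: "Ck k f \<Longrightarrow> continuous_on UNIV f"
  by (cases k) (auto intro!: continuous_at_imp_continuous_on differentiable_imp_continuous_within)

lemma Ck_const: "Ck k (\<lambda>x. c)"
proof (induction k arbitrary: c)
  case (Suc k)
  show ?case by (rule Ck_SucI[where f' = "\<lambda>_ _. 0"]) (auto intro: Suc)
qed simp

lemma Ck_lincomb2:
  "Ck k f \<Longrightarrow> Ck k g \<Longrightarrow> Ck k (\<lambda>x. a * f x + b * g x)"
proof (induction k arbitrary: f g)
  case (Suc k)
  show ?case
  proof (rule Ck_SucI)
    fix x
    show "((\<lambda>x. a * f x + b * g x) has_derivative
        (\<lambda>h. a * frechet_derivative f (at x) h + b * frechet_derivative g (at x) h)) (at x)"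
      by (intro derivative_intros Ck_SucD(1)[OF Suc.prems(1)] Ck_SucD(1)[OF Suc.prems(2)])
  next
    fix i :: 'a assume "i \<in> Basis"
    then show "Ck k (\<lambda>x. a * frechet_derivative f (at x) i + b * frechet_derivative g (at x) i)"
      by (intro Suc.IH Ck_SucD(2)[OF Suc.prems(1)] Ck_SucD(2)[OF Suc.prems(2)])
  qed
qed (auto intro!: continuous_intros)

text \<open>The product and chain rules leave some factors undifferentiated beside the derivatives
  of others; those factors enter the induction one order lower.\<close>

lemma Ck_Suc_imp: "Ck (Suc k) f \<Longrightarrow> Ck k f"
proof (induction k arbitrary: f)
  case 0
  then show ?case using Ck_continuous[of "Suc 0" f] by simp
next
  case (Suc k)
  show ?case
    by (rule Ck_SucI[OF Ck_SucD(1)[OF Suc.prems]]) (rule Suc.IH, rule Ck_SucD(2)[OF Suc.prems])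
qed

lemma Ck_mult:
  "Ck k f \<Longrightarrow> Ck k g \<Longrightarrow> Ck k (\<lambda>x. f x * g x)"
proof (induction k arbitrary: f g)
  case (Suc k)
  show ?case
  proof (rule Ck_SucI)
    fix x
    show "((\<lambda>x. f x * g x) has_derivative
        (\<lambda>h. f x * frechet_derivative g (at x) h + frechet_derivative f (at x) h * g x)) (at x)"
      by (intro has_derivative_mult Ck_SucD(1)[OF Suc.prems(1)] Ck_SucD(1)[OF Suc.prems(2)])
  next
    fix i :: 'a assume i: "i \<in> Basis"
    have "Ck k (\<lambda>x. 1 * (f x * frechet_derivative g (at x) i) + 1 * (frechet_derivative f (at x) i * g x))"
      by (rule Ck_lincomb2[OF Suc.IH[OF Ck_Suc_imp[OF Suc.prems(1)] Ck_SucD(2)[OF Suc.prems(2) i]]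
            Suc.IH[OF Ck_SucD(2)[OF Suc.prems(1) i] Ck_Suc_imp[OF Suc.prems(2)]]])
    then show "Ck k (\<lambda>x. f x * frechet_derivative g (at x) i + frechet_derivative f (at x) i * g x)" by simp
  qed
qed (auto intro!: continuous_intros)

lemma Ck_inner: "Ck k (\<lambda>x. p \<bullet> (x - v))"
proof (cases k)
  case (Suc m)
  have "((\<lambda>x. p \<bullet> (x - v)) has_derivative (\<lambda>h. p \<bullet> h)) (at x)" for x
    by (auto intro!: derivative_eq_intros)
  then show ?thesis unfolding Suc by (rule Ck_SucI) (rule Ck_const)
qed (auto intro!: continuous_intros)

lemma smooth_lincomb2: "smooth f \<Longrightarrow> smooth g \<Longrightarrow> smooth (\<lambda>x. a * f x + b * g x)"
  by (simp add: smooth_def Ck_lincomb2)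

lemma smooth_const: "smooth (\<lambda>x. c)"
  by (simp add: smooth_def Ck_const)

lemma smooth_inner: "smooth (\<lambda>x. p \<bullet> (x - v))"
  by (simp add: smooth_def Ck_inner)

lemma smooth_sum:
  assumes "\<And>i. i \<in> I \<Longrightarrow> smooth (f i)"
  shows "smooth (\<lambda>x. \<Sum>i\<in>I. c i * f i x)"
  using assms
proof (induction I rule: infinite_finite_induct)
  case (insert i I)
  then have "smooth (\<lambda>x. c i * f i x + 1 * (\<Sum>i\<in>I. c i * f i x))" by (intro smooth_lincomb2) auto
  then show ?case using insert by simp
qed (auto simp: smooth_const)

lemma Hs_lincomb2: "f \<in> Hs D \<Longrightarrow> g \<in> Hs D \<Longrightarrow> (\<lambda>x. a * f x + b * g x) \<in> Hs D"
proof -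
  assume f: "f \<in> Hs D" and g: "g \<in> Hs D"
  then obtain K L where "compact K" "K \<subseteq> D" "\<forall>x. x \<notin> K \<longrightarrow> f x = 0" "compact L" "L \<subseteq> D" "\<forall>x. x \<notin> L \<longrightarrow> g x = 0"
    by (auto simp: Hs_def compactly_supported_in_def)
  then have "compactly_supported_in (\<lambda>x. a * f x + b * g x) D"
    unfolding compactly_supported_in_def by (intro exI[of _ "K \<union> L"]) auto
  with f g show ?thesis by (auto simp: Hs_def intro: smooth_lincomb2)
qed

section \<open>Gradients of differentiable functions\<close>

lemma gderiv_grad: "GDERIV f x :> v \<Longrightarrow> grad f x = v"
proof -
  assume v: "GDERIV f x :> v"
  have "w = v" if "GDERIV f x :> w" for w
  proof -
    have "(\<lambda>h. h \<bullet> w) = (\<lambda>h. h \<bullet> v)"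
      by (rule has_derivative_unique[OF that[unfolded gderiv_def] v[unfolded gderiv_def]])
    then have "(w - v) \<bullet> (w - v) = 0" using fun_cong[of _ _ "w - v"] by (fastforce simp: inner_diff_right)
    then show ?thesis by simp
  qed
  with v show ?thesis unfolding grad_def by (rule the_equality)
qed

lemma gderiv_iff_differentiable: "(\<exists>v. GDERIV f x :> v) \<longleftrightarrow> f differentiable (at x)"
  for f :: "'a::euclidean_space \<Rightarrow> real"
proof
  assume "f differentiable (at x)"
  then obtain f' where f': "(f has_derivative f') (at x)" by (auto simp: differentiable_def)
  then interpret bounded_linear f' by (rule has_derivative_bounded_linear)
  have "f' = (\<lambda>h. h \<bullet> (\<Sum>i\<in>Basis. f' i *\<^sub>R i))"
  proof
    fix h
    have "f' h = f' (\<Sum>i\<in>Basis. (h \<bullet> i) *\<^sub>R i)" by (simp add: euclidean_representation)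
    also have "\<dots> = (\<Sum>i\<in>Basis. (h \<bullet> i) * f' i)" by (simp add: sum scale)
    finally show "f' h = h \<bullet> (\<Sum>i\<in>Basis. f' i *\<^sub>R i)" by (simp add: inner_sum_right mult.commute)
  qed
  then show "\<exists>v. GDERIV f x :> v" using f' unfolding gderiv_def by metis
qed (auto simp: gderiv_def differentiable_def)

lemma smooth_gderiv: "smooth f \<Longrightarrow> GDERIV f x :> grad f x"
proof -
  assume "smooth f"
  then have "Ck (Suc 0) f" by (auto simp: smooth_def)
  then have "f differentiable (at x)" by simp
  then show ?thesis using gderiv_iff_differentiable gderiv_grad by metis
qed

text \<open>Continuity bounds the gradient on compact sets, which is how smooth functions enter the
  class of bounded fields.\<close>

lemma smooth_grad_continuous:
  fixes f :: "'a::euclidean_space \<Rightarrow> real"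
  assumes "smooth f"
  shows "continuous_on UNIV (grad f)"
proof -
  have C: "Ck (Suc 0) f" using assms by (auto simp: smooth_def)
  have "grad f x = (\<Sum>i\<in>Basis. frechet_derivative f (at x) i *\<^sub>R i)" for x
  proof -
    have d: "(f has_derivative (\<lambda>h. h \<bullet> grad f x)) (at x)" using smooth_gderiv[OF assms] unfolding gderiv_def .
    have "frechet_derivative f (at x) = (\<lambda>h. h \<bullet> grad f x)" using frechet_derivative_at[OF d] by simp
    then have "(\<Sum>i\<in>Basis. frechet_derivative f (at x) i *\<^sub>R i) = (\<Sum>i\<in>Basis. (grad f x \<bullet> i) *\<^sub>R i)"
      by (simp add: inner_commute)
    then show ?thesis by (simp add: euclidean_representation)
  qed
  moreover have "continuous_on UNIV (\<lambda>x. \<Sum>i\<in>Basis. frechet_derivative f (at x) i *\<^sub>R i)"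
    using C by (intro continuous_intros) auto
  ultimately show ?thesis by (metis (no_types, lifting) continuous_on_cong)
qed

text \<open>For \<open>\<epsilon> > 0\<close> this is smooth, vanishes for \<open>y \<le> 0\<close>, and its derivative lies in \<open>[0, 1]\<close>;
  for \<open>\<epsilon> = 0\<close> it is the positive part itself.\<close>

definition pos_part :: "real \<Rightarrow> real \<Rightarrow> real" where
  "pos_part \<epsilon> y = (if y > 0 then y * exp (- \<epsilon> / y) else 0)"

definition pos_part' :: "real \<Rightarrow> real \<Rightarrow> real" where
  "pos_part' \<epsilon> y = (if y > 0 then exp (- \<epsilon> / y) * (1 + \<epsilon> / y) else 0)"

lemma pos_part_0: "pos_part 0 y = max 0 y"
  by (auto simp: pos_part_def)

text \<open>Every derivative of exp (-\<epsilon> / y), extended by 0, is a linear combination of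
  these functions. The exponent \<open>m\<close> records the negative powers of y that
  differentiation produces, so a single derivative formula yields all orders.\<close>

definition flat_exp :: "real \<Rightarrow> nat \<Rightarrow> real \<Rightarrow> real" where
  "flat_exp \<epsilon> m y = (if y > 0 then exp (- \<epsilon> / y) / y ^ m else 0)"

lemma flat_exp_deriv:
  assumes "\<epsilon> > 0"
  shows "(flat_exp \<epsilon> m has_real_derivative (\<epsilon> * flat_exp \<epsilon> (m + 2) y - m * flat_exp \<epsilon> (m + 1) y)) (at y)"
proof -
  consider "y > 0" | "y < 0" | "y = 0" by linarith
  then show ?thesis
  proof cases
    case 1
    have "((\<lambda>y. exp (- \<epsilon> / y) / y ^ m) has_real_derivative
        (exp (- \<epsilon> / y) * (\<epsilon> / y\<^sup>2) * y ^ m - exp (- \<epsilon> / y) * (m * y ^ (m - 1))) / (y ^ m * y ^ m)) (at y)"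
      using 1 by (auto intro!: derivative_eq_intros simp: power2_eq_square)
    also have "(exp (- \<epsilon> / y) * (\<epsilon> / y\<^sup>2) * y ^ m - exp (- \<epsilon> / y) * (m * y ^ (m - 1))) / (y ^ m * y ^ m)
        = \<epsilon> * flat_exp \<epsilon> (m + 2) y - m * flat_exp \<epsilon> (m + 1) y"
      using 1 by (cases m) (auto simp: flat_exp_def field_simps power2_eq_square)
    finally show ?thesis
      by (rule has_field_derivative_transform_within_open[where S = "{0<..}"]) (use 1 in \<open>auto simp: flat_exp_def\<close>)
  next
    case 2
    have "((\<lambda>y. 0) has_real_derivative 0) (at y)" by simp
    then have "(flat_exp \<epsilon> m has_real_derivative 0) (at y)"
      by (rule has_field_derivative_transform_within_open[where S = "{..<0}"]) (use 2 in \<open>auto simp: flat_exp_def\<close>)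
    then show ?thesis using 2 by (simp add: flat_exp_def)
  next
    case 3
    \<comment> \<open>The claimed derivative at the origin is 0: from the left the function
      vanishes, and from the right exp (-\<epsilon> / h) beats every power of h.\<close>
    have "((\<lambda>h. flat_exp \<epsilon> m h / h) \<longlongrightarrow> 0) (at 0)"
    proof (rule filterlim_split_at)
      have "((\<lambda>h::real. 0) \<longlongrightarrow> 0) (at_left (0::real))" by simp
      then show "((\<lambda>h. flat_exp \<epsilon> m h / h) \<longlongrightarrow> 0) (at_left 0)"
        by (rule Lim_transform_eventually) (auto simp: flat_exp_def eventually_at_filter)
      have "((\<lambda>h::real. exp (- \<epsilon> / h) / h ^ m / h) \<longlongrightarrow> 0) (at_right 0)"
        using assms by real_asymp
      then show "((\<lambda>h. flat_exp \<epsilon> m h / h) \<longlongrightarrow> 0) (at_right 0)"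
        by (rule Lim_transform_eventually) (auto simp: flat_exp_def eventually_at_filter)
    qed
    then show ?thesis using 3 by (simp add: DERIV_def flat_exp_def)
  qed
qed

lemma smooth_pos_part_compose:
  assumes "\<epsilon> > 0" "smooth f"
  shows "smooth (\<lambda>x. pos_part \<epsilon> (f x))"
proof -
  \<comment> \<open>For all \<open>m\<close> at once, since differentiation raises \<open>m\<close>
    by 1 and by 2.\<close>
  have fe: "Ck k g \<Longrightarrow> Ck k (\<lambda>x. flat_exp \<epsilon> m (g x))" for k m and g :: "'a \<Rightarrow> real"
  proof (induction k arbitrary: g m)
    case 0
    have "continuous_on UNIV (flat_exp \<epsilon> m)"
      by (intro continuous_at_imp_continuous_on ballI) (rule DERIV_isCont[OF flat_exp_deriv[OF assms(1)]])
    with 0 show ?case using continuous_on_compose2[of UNIV "flat_exp \<epsilon> m" UNIV g] by auto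
  next
    case (Suc k)
    show ?case
    proof (rule Ck_SucI)
      fix x
      have rd: "(flat_exp \<epsilon> m has_derivative (\<lambda>h. h * (\<epsilon> * flat_exp \<epsilon> (m + 2) (g x) - m * flat_exp \<epsilon> (m + 1) (g x)))) (at (g x))"
        using flat_exp_deriv[OF assms(1), of m "g x"] by (simp add: has_field_derivative_def mult_commute_abs)
      show "((\<lambda>x. flat_exp \<epsilon> m (g x)) has_derivative (\<lambda>h. frechet_derivative g (at x) h *
          (\<epsilon> * flat_exp \<epsilon> (m + 2) (g x) - m * flat_exp \<epsilon> (m + 1) (g x)))) (at x)"
        by (rule has_derivative_compose[OF Ck_SucD(1)[OF Suc.prems(1)] rd])
    next
      fix i :: 'a assume i: "i \<in> Basis"
      have "Ck k (\<lambda>x. frechet_derivative g (at x) i * (\<epsilon> * flat_exp \<epsilon> (m + 2) (g x) + (- real m) * flat_exp \<epsilon> (m + 1) (g x)))"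
        by (rule Ck_mult[OF Ck_SucD(2)[OF Suc.prems(1) i]
              Ck_lincomb2[OF Suc.IH[OF Ck_Suc_imp[OF Suc.prems(1)]] Suc.IH[OF Ck_Suc_imp[OF Suc.prems(1)]]]])
      then show "Ck k (\<lambda>x. frechet_derivative g (at x) i * (\<epsilon> * flat_exp \<epsilon> (m + 2) (g x) - m * flat_exp \<epsilon> (m + 1) (g x)))"
        by simp
    qed
  qed
  have "pos_part \<epsilon> (f x) = f x * flat_exp \<epsilon> 0 (f x)" for x by (simp add: pos_part_def flat_exp_def)
  then show ?thesis using assms(2) fe by (simp add: smooth_def Ck_mult)
qed

text \<open>Including \<epsilon> = 0 away from the kink lets the tents and the smoothed tents share
  one gradient formula.\<close>

lemma pos_part_deriv:
  assumes "\<epsilon> > 0 \<or> (\<epsilon> = 0 \<and> y \<noteq> 0)"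
  shows "(pos_part \<epsilon> has_real_derivative pos_part' \<epsilon> y) (at y)"
proof (cases "\<epsilon> > 0")
  case True
  have "pos_part \<epsilon> = (\<lambda>y. y * flat_exp \<epsilon> 0 y)" by (auto simp: pos_part_def flat_exp_def fun_eq_iff)
  moreover have "((\<lambda>y. y * flat_exp \<epsilon> 0 y) has_real_derivative (flat_exp \<epsilon> 0 y + y * (\<epsilon> * flat_exp \<epsilon> 2 y))) (at y)"
    by (rule derivative_eq_intros flat_exp_deriv[OF True] refl)+ (simp add: numeral_2_eq_2)
  moreover have "flat_exp \<epsilon> 0 y + y * (\<epsilon> * flat_exp \<epsilon> 2 y) = pos_part' \<epsilon> y"
    by (auto simp: flat_exp_def pos_part'_def field_simps power2_eq_square)
  ultimately show ?thesis by simp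
next
  case False
  then have y: "y > 0 \<or> y < 0" and e: "\<epsilon> = 0" using assms by auto
  from y show ?thesis
  proof
    assume y: "y > 0"
    have "((\<lambda>y. y) has_real_derivative 1) (at y)" by simp
    then have "(pos_part \<epsilon> has_real_derivative 1) (at y)"
      by (rule has_field_derivative_transform_within_open[where S = "{0<..}"]) (use y e in \<open>auto simp: pos_part_def\<close>)
    then show ?thesis using y e by (simp add: pos_part'_def)
  next
    assume y: "y < 0"
    have "((\<lambda>y. 0) has_real_derivative 0) (at y)" by simp
    then have "(pos_part \<epsilon> has_real_derivative 0) (at y)"
      by (rule has_field_derivative_transform_within_open[where S = "{..<0}"]) (use y e in \<open>auto simp: pos_part_def\<close>)
    then show ?thesis using y e by (simp add: pos_part'_def)
  qed
qed

text \<open>The inequality 1 + x \<le> exp x at x = \<epsilon> / y. The bound is uniform in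
  \<epsilon>, as dominated convergence of the gradients requires.\<close>

lemma pos_part'_bounds:
  assumes "\<epsilon> \<ge> 0"
  shows "\<bar>pos_part' \<epsilon> y\<bar> \<le> 1"
proof (cases "y > 0")
  case True
  have "1 + \<epsilon> / y \<le> exp (\<epsilon> / y)" by (rule exp_ge_add_one_self)
  then have "exp (- \<epsilon> / y) * (1 + \<epsilon> / y) \<le> exp (- \<epsilon> / y) * exp (\<epsilon> / y)" by (intro mult_left_mono) auto
  also have "\<dots> = 1" by (simp add: exp_add[symmetric])
  finally show ?thesis using True assms by (simp add: pos_part'_def)
qed (simp add: pos_part'_def)

text \<open>Again 1 + x \<le> exp x, now at x = -\<epsilon> / y: smoothing lowers the positive part
  by at most \<epsilon>, the amount that \<open>abs_part\<close> adds back.\<close>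

lemma pos_part_lower:
  assumes "\<epsilon> \<ge> 0"
  shows "max 0 y \<le> \<epsilon> + pos_part \<epsilon> y"
proof (cases "y > 0")
  case True
  have "1 - \<epsilon> / y \<le> exp (- \<epsilon> / y)" using exp_ge_add_one_self[of "- \<epsilon> / y"] by simp
  then have "y * (1 - \<epsilon> / y) \<le> y * exp (- \<epsilon> / y)" using True by (intro mult_left_mono) auto
  moreover have "y * (1 - \<epsilon> / y) = y - \<epsilon>" using True by (simp add: field_simps)
  ultimately show ?thesis using True by (simp add: pos_part_def)
qed (use assms in \<open>simp add: pos_part_def\<close>)

text \<open>The point y = 0 is excluded because the limiting derivative jumps there; elsewhere
  \<open>f k\<close> eventually has the sign of y.\<close>

lemma pos_part_tendsto:
  assumes "e \<longlonglongrightarrow> 0" "f \<longlonglongrightarrow> y" "y \<noteq> 0"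
  shows "(\<lambda>k. pos_part (e k) (f k)) \<longlonglongrightarrow> pos_part 0 y"
    and "(\<lambda>k. pos_part' (e k) (f k)) \<longlonglongrightarrow> pos_part' 0 y"
proof -
  have 1: "(\<lambda>k. pos_part (e k) (f k)) \<longlonglongrightarrow> pos_part 0 y \<and> (\<lambda>k. pos_part' (e k) (f k)) \<longlonglongrightarrow> pos_part' 0 y"
  proof (cases "y > 0")
    case True
    have ev: "eventually (\<lambda>k. f k > 0) sequentially" using order_tendstoD(1)[OF assms(2) True] .
    have "(\<lambda>k. e k / f k) \<longlonglongrightarrow> 0 / y" by (intro tendsto_divide assms)
    then have "(\<lambda>k. f k * exp (- (e k / f k))) \<longlonglongrightarrow> y * exp (- (0 / y))"
      "(\<lambda>k. exp (- (e k / f k)) * (1 + e k / f k)) \<longlonglongrightarrow> exp (- (0 / y)) * (1 + 0 / y)"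
      by (intro tendsto_mult tendsto_exp tendsto_minus tendsto_add tendsto_const assms(2); assumption)+
    then show ?thesis
      using True ev by (auto simp: pos_part_def pos_part'_def elim!: Lim_transform_eventually eventually_mono)
  next
    case False
    then have y: "y < 0" using assms by simp
    have ev: "eventually (\<lambda>k. f k < 0) sequentially" using order_tendstoD(2)[OF assms(2) y] .
    then have "eventually (\<lambda>k. pos_part (e k) (f k) = 0) sequentially"
      "eventually (\<lambda>k. pos_part' (e k) (f k) = 0) sequentially"
      by (auto simp: pos_part_def pos_part'_def elim!: eventually_mono)
    then show ?thesis
      using y by (auto simp: pos_part_def[of 0] pos_part'_def[of 0] intro!: tendsto_eventually)
  qed
  then show "(\<lambda>k. pos_part (e k) (f k)) \<longlonglongrightarrow> pos_part 0 y"
    "(\<lambda>k. pos_part' (e k) (f k)) \<longlonglongrightarrow> pos_part' 0 y" by auto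
qed

section \<open>Geometry of the triangular mesh\<close>

text \<open>Real coordinates make this a linear parametrisation of the whole plane, with the mesh
  vertices at the integer points.\<close>

definition lat :: "nat \<Rightarrow> real \<Rightarrow> real \<Rightarrow> real^2" where
  "lat n a b = (1 / real n) *\<^sub>R (a *\<^sub>R vector [1, 0] + b *\<^sub>R vector [1/2, sqrt 3 / 2])"

text \<open>The vectors \<open>xi1\<close> and \<open>xi2\<close> are dual to the lattice basis: the inner products with
  them are the lattice coordinates.\<close>

definition xi1 :: "nat \<Rightarrow> real^2" where
  "xi1 n = vector [n, - (n / sqrt 3)]"

definition xi2 :: "nat \<Rightarrow> real^2" where
  "xi2 n = vector [0, 2 * n / sqrt 3]"

text \<open>The mesh lines form three families: those on which the inner product with
  \<open>xi1 n\<close>, with \<open>xi2 n\<close> or with \<open>xi3 n\<close> is a fixed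
  integer.\<close>

definition xi3 :: "nat \<Rightarrow> real^2" where
  "xi3 n = xi1 n + xi2 n"

lemma xi3_inner: "xi3 n \<bullet> x = xi1 n \<bullet> x + xi2 n \<bullet> x"
  by (simp add: xi3_def inner_add_left)

lemma inner_2: "x \<bullet> y = x $ 1 * y $ 1 + x $ 2 * y $ 2" for x y :: "real^2"
  by (simp add: inner_vec_def sum_2)

lemma vec_eq_2: "x = y \<longleftrightarrow> x $ 1 = y $ 1 \<and> x $ 2 = y $ 2" for x y :: "'a^2"
  by (simp add: vec_eq_iff forall_2)

lemma lat_add: "lat n a b + lat n c d = lat n (a + c) (b + d)"
  by (simp add: lat_def algebra_simps)

lemma lat_diff: "lat n a b - lat n c d = lat n (a - c) (b - d)"
  by (simp add: lat_def algebra_simps)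

lemma lat_scale: "c *\<^sub>R lat n a b = lat n (c * a) (c * b)"
  by (simp add: lat_def algebra_simps)

lemma lat_minus: "- lat n a b = lat n (- a) (- b)"
  using lat_scale[of "-1" n a b] by simp

lemma mesh_vertices_eq: "mesh_vertices n = {lat n (of_int a) (of_int b) | a b. True}"
  unfolding mesh_vertices_def triangular_lattice_def lat_def by auto

section \<open>Lattice coordinates, neighbours and the hexagonal norm\<close>

locale mesh =
  fixes n :: nat
  assumes n: "n \<ge> 1"
begin

lemma n0: "real n > 0" using n by simp

lemma xi_lat [simp]:
  "xi1 n \<bullet> lat n a b = a" "xi2 n \<bullet> lat n a b = b" "xi3 n \<bullet> lat n a b = a + b"
proof -
  show *: "xi1 n \<bullet> lat n a b = a" "xi2 n \<bullet> lat n a b = b"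
    using n0 by (auto simp: xi1_def xi2_def lat_def inner_2 field_simps)
  show "xi3 n \<bullet> lat n a b = a + b" by (simp add: xi3_inner *)
qed

lemma lat_xi: "lat n (xi1 n \<bullet> x) (xi2 n \<bullet> x) = x"
  using n0 by (auto simp: xi1_def xi2_def lat_def inner_2 vec_eq_2 field_simps)

lemma eq_if_xi: "xi1 n \<bullet> x = xi1 n \<bullet> y \<Longrightarrow> xi2 n \<bullet> x = xi2 n \<bullet> y \<Longrightarrow> x = y"
  by (metis lat_xi)

lemma mesh_vertices_iff: "x \<in> mesh_vertices n \<longleftrightarrow> xi1 n \<bullet> x \<in> \<int> \<and> xi2 n \<bullet> x \<in> \<int>"
proof
  assume "xi1 n \<bullet> x \<in> \<int> \<and> xi2 n \<bullet> x \<in> \<int>"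
  then show "x \<in> mesh_vertices n" unfolding mesh_vertices_eq using lat_xi[of x] by (auto elim!: Ints_cases) metis
qed (auto simp: mesh_vertices_eq)

lemma xi3_Ints: "x \<in> mesh_vertices n \<Longrightarrow> xi3 n \<bullet> x \<in> \<int>"
  by (simp add: mesh_vertices_iff xi3_inner)

lemma mesh_vertices_add: "x \<in> mesh_vertices n \<Longrightarrow> y \<in> mesh_vertices n \<Longrightarrow> x + y \<in> mesh_vertices n"
  by (simp add: mesh_vertices_iff inner_add_right)

lemma mesh_vertices_diff: "x \<in> mesh_vertices n \<Longrightarrow> y \<in> mesh_vertices n \<Longrightarrow> x - y \<in> mesh_vertices n"
  by (simp add: mesh_vertices_iff inner_diff_right)

text \<open>The two lattice vectors have length 1 / n and inner product 1 / (2 n^2), so n^2 times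
  the squared norm is the norm form of the Eisenstein integers.\<close>

lemma norm_xi: "(real n)\<^sup>2 * (norm x)\<^sup>2 =
    (xi1 n \<bullet> x)\<^sup>2 + (xi1 n \<bullet> x) * (xi2 n \<bullet> x) + (xi2 n \<bullet> x)\<^sup>2"
proof -
  have "(norm (lat n a b))\<^sup>2 * (real n)\<^sup>2 = a\<^sup>2 + a * b + b\<^sup>2" for a b
  proof -
    have "(norm (lat n a b))\<^sup>2 = ((a + b / 2)\<^sup>2 + (b * (sqrt 3 / 2))\<^sup>2) / (real n)\<^sup>2"
      using n0 unfolding power2_norm_eq_inner by (simp add: lat_def inner_2 power2_eq_square field_simps)
    also have "(b * (sqrt 3 / 2))\<^sup>2 = b\<^sup>2 * (3 / 4)" by (simp add: power_mult_distrib power_divide)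
    finally show ?thesis using n0 by (simp add: power2_eq_square field_simps)
  qed
  from this[of "xi1 n \<bullet> x" "xi2 n \<bullet> x"] show ?thesis by (simp add: lat_xi mult.commute)
qed

lemma dist_iff: "dist x y = 1 / real n \<longleftrightarrow>
    (xi1 n \<bullet> (x - y))\<^sup>2 + (xi1 n \<bullet> (x - y)) * (xi2 n \<bullet> (x - y)) + (xi2 n \<bullet> (x - y))\<^sup>2 = 1"
proof -
  have "real n * norm (x - y) \<ge> 0" by simp
  then have "real n * norm (x - y) = 1 \<longleftrightarrow> (real n * norm (x - y))\<^sup>2 = 1"
    by (subst power2_eq_1_iff) linarith
  moreover have "dist x y = 1 / real n \<longleftrightarrow> norm (x - y) * real n = 1"
    using n0 by (simp add: dist_norm eq_divide_eq)
  ultimately have "dist x y = 1 / real n \<longleftrightarrow> (real n * norm (x - y))\<^sup>2 = 1"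
    by (simp only: mult.commute)
  also have "\<dots> \<longleftrightarrow> (real n)\<^sup>2 * (norm (x - y))\<^sup>2 = 1" by (simp only: power_mult_distrib)
  finally show ?thesis unfolding norm_xi .
qed

text \<open>The units of the Eisenstein integers in lattice coordinates, listed around the
  hexagon.\<close>

definition neighbours :: "(int \<times> int) set" where
  "neighbours = {(1, 0), (0, 1), (-1, 1), (-1, 0), (0, -1), (1, -1)}"

lemma unit_form_iff: "a\<^sup>2 + a * b + b\<^sup>2 = 1 \<longleftrightarrow> (a, b) \<in> neighbours" for a b :: int
proof
  assume *: "a\<^sup>2 + a * b + b\<^sup>2 = 1"
  \<comment> \<open>Completing the square in either variable bounds both integers by 1 in absolute
    value; nine cases remain.\<close>
  have "4 * (a\<^sup>2 + a * b + b\<^sup>2) = (2 * b + a)\<^sup>2 + 3 * a\<^sup>2" "4 * (a\<^sup>2 + a * b + b\<^sup>2) = (2 * a + b)\<^sup>2 + 3 * b\<^sup>2"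
    by (auto simp: power2_eq_square algebra_simps)
  then have "3 * a\<^sup>2 \<le> 4" "3 * b\<^sup>2 \<le> 4" using * by (smt (verit) zero_le_power2)+
  then have "a\<^sup>2 < 2\<^sup>2" "b\<^sup>2 < 2\<^sup>2" by auto
  then have "\<bar>a\<bar> < 2" "\<bar>b\<bar> < 2" by (metis abs_square_less_1 abs_numeral power2_less_imp_less abs_ge_zero power2_abs zero_le_numeral)+
  then have "a \<in> {-1, 0, 1}" "b \<in> {-1, 0, 1}" by auto
  with * show "(a, b) \<in> neighbours" by (auto simp: neighbours_def)
qed (auto simp: neighbours_def)

lemma neighbour_iff:
  assumes "x \<in> mesh_vertices n" "y \<in> mesh_vertices n"
  shows "dist x y = 1 / real n \<longleftrightarrow> (\<exists>(a, b)\<in>neighbours. y = x + lat n (of_int a) (of_int b))"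
proof -
  obtain a b where y: "y - x = lat n (of_int a) (of_int b)"
    using mesh_vertices_diff[OF assms(2,1)] by (auto simp: mesh_vertices_eq)
  have "dist x y = 1 / real n \<longleftrightarrow> (of_int (a\<^sup>2 + a * b + b\<^sup>2) :: real) = of_int 1"
    unfolding dist_commute[of x] dist_iff y by simp
  also have "\<dots> \<longleftrightarrow> (a, b) \<in> neighbours" unfolding of_int_eq_iff unit_form_iff ..
  also have "\<dots> \<longleftrightarrow> (\<exists>(c, d)\<in>neighbours. y = x + lat n (of_int c) (of_int d))"
  proof safe
    fix c d assume "(c, d) \<in> neighbours" "y = x + lat n (of_int c) (of_int d)"
    then have "lat n (of_int a) (of_int b) = lat n (of_int c) (of_int d)" using y by simp
    then have "(of_int a :: real) = of_int c" "(of_int b :: real) = of_int d" by (metis xi_lat)+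
    then show "(a, b) \<in> neighbours" using \<open>(c, d) \<in> neighbours\<close> by simp
  next
    assume "(a, b) \<in> neighbours"
    moreover have "y = x + lat n (of_int a) (of_int b)" using y by (simp add: algebra_simps)
    ultimately show "\<exists>(c, d)\<in>neighbours. y = x + lat n (of_int c) (of_int d)" by blast
  qed
  finally show ?thesis .
qed

text \<open>Half the sum of the three absolute values equals their maximum, because one of the three
  numbers is the sum of the other two.\<close>

definition hexnorm :: "real^2 \<Rightarrow> real" where
  "hexnorm x = (\<bar>xi1 n \<bullet> x\<bar> + \<bar>xi2 n \<bullet> x\<bar> + \<bar>xi3 n \<bullet> x\<bar>) / 2"

lemma hexnorm_triangle: "hexnorm x \<le> hexnorm y + hexnorm (x - y)"
proof -
  have "\<bar>p \<bullet> x\<bar> \<le> \<bar>p \<bullet> y\<bar> + \<bar>p \<bullet> (x - y)\<bar>" for p by (simp add: inner_diff_right)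
  from this[of "xi1 n"] this[of "xi2 n"] this[of "xi3 n"] show ?thesis unfolding hexnorm_def by argo
qed

text \<open>Parity: |a| + |b| + |a + b| is congruent to 2 (a + b) modulo 2. Integrality makes a tent
  vanish at every vertex but its own and keeps its outer kink on mesh lines.\<close>

lemma hexnorm_Ints:
  assumes "x \<in> mesh_vertices n" shows "hexnorm x \<in> \<int>"
proof -
  obtain a b where x: "x = lat n (of_int a) (of_int b)" using assms by (auto simp: mesh_vertices_eq)
  have "even (\<bar>a\<bar> + \<bar>b\<bar> + \<bar>a + b\<bar>)" by (auto simp: abs_if)
  then obtain k where "\<bar>a\<bar> + \<bar>b\<bar> + \<bar>a + b\<bar> = 2 * k" by (rule evenE)
  then have "real_of_int (\<bar>a\<bar> + \<bar>b\<bar> + \<bar>a + b\<bar>) = real_of_int (2 * k)" by (rule arg_cong)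
  then have "hexnorm x = of_int k" unfolding hexnorm_def x by simp
  then show ?thesis by simp
qed

lemma hexnorm_0: "hexnorm x = 0 \<longleftrightarrow> x = 0"
proof
  assume "hexnorm x = 0"
  then have "xi1 n \<bullet> x = 0" "xi2 n \<bullet> x = 0" by (auto simp: hexnorm_def)
  then show "x = 0" by (metis eq_if_xi inner_zero_right)
qed (simp add: hexnorm_def)

text \<open>Along an edge the three coordinates and the hexagonal norm change by at most 1; together
  with integral vertex values this rules out sign changes inside a triangle.\<close>

lemma unit_bounds:
  assumes "x \<in> mesh_vertices n" "y \<in> mesh_vertices n" "dist x y = 1 / real n"
  shows "\<bar>xi1 n \<bullet> (x - y)\<bar> \<le> 1" "\<bar>xi2 n \<bullet> (x - y)\<bar> \<le> 1" "\<bar>xi3 n \<bullet> (x - y)\<bar> \<le> 1" "hexnorm (x - y) \<le> 1"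
proof -
  obtain a b where ab: "(a, b) \<in> neighbours" "y = x + lat n (of_int a) (of_int b)"
    using assms neighbour_iff by auto
  then have "x - y = lat n (- of_int a) (- of_int b)" by (simp add: lat_minus)
  then show "\<bar>xi1 n \<bullet> (x - y)\<bar> \<le> 1" "\<bar>xi2 n \<bullet> (x - y)\<bar> \<le> 1" "\<bar>xi3 n \<bullet> (x - y)\<bar> \<le> 1" "hexnorm (x - y) \<le> 1"
    using ab(1) by (auto simp: neighbours_def hexnorm_def)
qed

end

section \<open>Affine functions on convex hulls\<close>

definition affine_fun_on :: "(real^2) set \<Rightarrow> (real^2 \<Rightarrow> real) \<Rightarrow> bool" where
  "affine_fun_on T f \<longleftrightarrow> (\<exists>a c. \<forall>x\<in>T. f x = a \<bullet> x + c)"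

lemma affine_fun_on_const: "affine_fun_on T (\<lambda>x. c)"
  unfolding affine_fun_on_def by (intro exI[of _ 0] exI[of _ c]) simp

lemma affine_fun_on_inner: "affine_fun_on T (\<lambda>x. p \<bullet> (x - v))"
  unfolding affine_fun_on_def by (intro exI[of _ p] exI[of _ "- (p \<bullet> v)"]) (simp add: inner_diff_right)

lemma affine_fun_on_lincomb2:
  assumes "affine_fun_on T f" "affine_fun_on T g"
  shows "affine_fun_on T (\<lambda>x. s * f x + t * g x)"
proof -
  obtain a c b d where "\<forall>x\<in>T. f x = a \<bullet> x + c" "\<forall>x\<in>T. g x = b \<bullet> x + d"
    using assms unfolding affine_fun_on_def by blast
  then show ?thesis unfolding affine_fun_on_def
    by (intro exI[of _ "s *\<^sub>R a + t *\<^sub>R b"] exI[of _ "s * c + t * d"]) (simp add: inner_add_left algebra_simps)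
qed

lemma affine_fun_on_sum:
  assumes "\<And>i. i \<in> I \<Longrightarrow> affine_fun_on T (f i)"
  shows "affine_fun_on T (\<lambda>x. \<Sum>i\<in>I. c i * f i x)"
  using assms
proof (induction I rule: infinite_finite_induct)
  case (insert i I)
  then have "affine_fun_on T (\<lambda>x. c i * f i x + 1 * (\<Sum>i\<in>I. c i * f i x))" by (intro affine_fun_on_lincomb2) auto
  then show ?case using insert by simp
qed (auto simp: affine_fun_on_const)

text \<open>The half-space on which the affine expression is nonnegative is convex and contains
  \<open>S\<close>.\<close>

lemma affine_fun_on_hull_nonneg:
  assumes "affine_fun_on (convex hull S) g" "\<And>x. x \<in> S \<Longrightarrow> g x \<ge> 0" "x \<in> convex hull S"
  shows "g x \<ge> 0"
proof -
  obtain a c where g: "\<forall>x\<in>convex hull S. g x = a \<bullet> x + c" using assms(1) unfolding affine_fun_on_def by blast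
  have "convex {x. a \<bullet> x \<ge> - c}" by (rule convex_halfspace_ge)
  moreover have "S \<subseteq> {x. a \<bullet> x \<ge> - c}"
  proof
    fix x assume "x \<in> S"
    then show "x \<in> {x. a \<bullet> x \<ge> - c}" using assms(2)[of x] g hull_inc[of x S convex] by auto
  qed
  ultimately have "convex hull S \<subseteq> {x. a \<bullet> x \<ge> - c}" by (rule hull_minimal[rotated])
  then show ?thesis using assms(3) g by auto
qed

lemma affine_fun_on_hull_eq:
  assumes "affine_fun_on (convex hull S) f" "affine_fun_on (convex hull S) g"
    and "\<And>x. x \<in> S \<Longrightarrow> f x = g x" "x \<in> convex hull S"
  shows "f x = g x"
  using affine_fun_on_hull_nonneg[OF affine_fun_on_lincomb2[OF assms(1,2), of 1 "-1"], of x]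
    affine_fun_on_hull_nonneg[OF affine_fun_on_lincomb2[OF assms(1,2), of "-1" 1], of x] assms(3,4)
  by force

text \<open>Integral vertex values that differ by at most 1 cannot have both signs: a positive value
  is at least 1 and forces the others to be nonnegative. So on the whole hull the positive part is
  either the function itself or 0.\<close>

lemma affine_fun_on_max0:
  assumes g: "affine_fun_on (convex hull S) g" and int: "\<And>x. x \<in> S \<Longrightarrow> g x \<in> \<int>"
    and diff: "\<And>x y. x \<in> S \<Longrightarrow> y \<in> S \<Longrightarrow> g x - g y \<le> 1"
  shows "affine_fun_on (convex hull S) (\<lambda>x. max 0 (g x))"
proof (cases "\<exists>x\<in>S. g x > 0")
  case True
  then obtain x where x: "x \<in> S" "g x > 0" by auto
  then have "g x \<ge> 1" using int[of x] by (auto elim!: Ints_cases)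
  then have "g y \<ge> 0" if "y \<in> S" for y using diff[OF x(1) that] by simp
  then have "g y \<ge> 0" if "y \<in> convex hull S" for y using affine_fun_on_hull_nonneg[OF g _ that] by blast
  then show ?thesis using g unfolding affine_fun_on_def by (simp add: max_def)
next
  case False
  then have "(- 1) * g y + 0 * g y \<ge> 0" if "y \<in> convex hull S" for y
    by (intro affine_fun_on_hull_nonneg[OF affine_fun_on_lincomb2[OF g g] _ that]) (auto simp: not_less)
  then have "max 0 (g y) = 0" if "y \<in> convex hull S" for y using that by fastforce
  then show ?thesis unfolding affine_fun_on_def by (intro exI[of _ 0]) auto
qed

lemma affine_fun_on_abs:
  assumes g: "affine_fun_on (convex hull S) g" and int: "\<And>x. x \<in> S \<Longrightarrow> g x \<in> \<int>"
    and diff: "\<And>x y. x \<in> S \<Longrightarrow> y \<in> S \<Longrightarrow> g x - g y \<le> 1"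
  shows "affine_fun_on (convex hull S) (\<lambda>x. \<bar>g x\<bar>)"
proof -
  have g': "affine_fun_on (convex hull S) (\<lambda>x. (-1) * g x + 0 * g x)" by (rule affine_fun_on_lincomb2[OF g g])
  have "affine_fun_on (convex hull S) (\<lambda>x. 1 * max 0 (g x) + 1 * max 0 ((-1) * g x + 0 * g x))"
    by (rule affine_fun_on_lincomb2[OF affine_fun_on_max0[OF g] affine_fun_on_max0[OF g']])
      (use int diff in \<open>auto simp: algebra_simps\<close>)
  moreover have "1 * max 0 (g x) + 1 * max 0 ((-1) * g x + 0 * g x) = \<bar>g x\<bar>" for x by auto
  ultimately show ?thesis by simp
qed

section \<open>Tent functions and mesh triangles\<close>

context mesh
begin

lemma mesh_trianglesE:
  assumes "T \<in> mesh_triangles n"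
  obtains S where "T = convex hull S" "S \<subseteq> mesh_vertices n" "finite S" "S \<noteq> {}"
    "\<And>x y. x \<in> S \<Longrightarrow> y \<in> S \<Longrightarrow> x = y \<or> dist x y = 1 / real n"
proof -
  obtain x y z where *: "T = convex hull {x, y, z}" "{x, y, z} \<subseteq> mesh_vertices n"
     "dist x y = 1 / real n" "dist y z = 1 / real n" "dist z x = 1 / real n"
    using assms unfolding mesh_triangles_def by blast
  show ?thesis by (rule that[OF *(1,2)]) (use * in \<open>auto simp: dist_commute\<close>)
qed

definition tent :: "real^2 \<Rightarrow> real^2 \<Rightarrow> real" where
  "tent v x = max 0 (1 - hexnorm (x - v))"

text \<open>The mesh lines through \<open>v\<close> do not cross the interior of a triangle, so each
  absolute value in \<open>hexnorm\<close> is affine on \<open>T\<close>. The same integrality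
  argument then handles the outer positive part, whose argument has integral vertex values by
  parity.\<close>

lemma tent_affine:
  assumes "T \<in> mesh_triangles n" "v \<in> mesh_vertices n"
  shows "affine_fun_on T (tent v)"
proof -
  obtain S where T: "T = convex hull S" and S: "S \<subseteq> mesh_vertices n"
    and d: "\<And>x y. x \<in> S \<Longrightarrow> y \<in> S \<Longrightarrow> x = y \<or> dist x y = 1 / real n"
    using mesh_trianglesE[OF assms(1)] by metis
  have Sv: "x - v \<in> mesh_vertices n" if "x \<in> S" for x using that S assms(2) mesh_vertices_diff by auto
  have abs: "affine_fun_on T (\<lambda>x. \<bar>p \<bullet> (x - v)\<bar>)" if p: "p \<in> {xi1 n, xi2 n, xi3 n}" for p
    unfolding T
  proof (rule affine_fun_on_abs[OF affine_fun_on_inner])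
    fix x y assume xy: "x \<in> S" "y \<in> S"
    show "p \<bullet> (x - v) \<in> \<int>" using Sv[OF xy(1)] p mesh_vertices_iff xi3_Ints by auto
    have "p \<bullet> (x - v) - p \<bullet> (y - v) = p \<bullet> (x - y)" by (simp add: inner_diff_right)
    also have "\<dots> \<le> 1"
    proof (cases "x = y")
      case False
      then have "\<bar>p \<bullet> (x - y)\<bar> \<le> 1" using d[OF xy] S xy p unit_bounds(1-3)[of x y] by blast
      then show ?thesis by simp
    qed simp
    finally show "p \<bullet> (x - v) - p \<bullet> (y - v) \<le> 1" .
  qed
  have "affine_fun_on T (\<lambda>x. 1 * 1 + (-1/2) * (1 * (1 * \<bar>xi1 n \<bullet> (x - v)\<bar> + 1 * \<bar>xi2 n \<bullet> (x - v)\<bar>) + 1 * \<bar>xi3 n \<bullet> (x - v)\<bar>))"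
    by (intro affine_fun_on_lincomb2 affine_fun_on_const abs) auto
  moreover have "1 * 1 + (-1/2) * (1 * (1 * \<bar>xi1 n \<bullet> (x - v)\<bar> + 1 * \<bar>xi2 n \<bullet> (x - v)\<bar>) + 1 * \<bar>xi3 n \<bullet> (x - v)\<bar>)
      = 1 - hexnorm (x - v)" for x by (simp add: hexnorm_def field_simps)
  ultimately have h: "affine_fun_on T (\<lambda>x. 1 - hexnorm (x - v))" by simp
  show ?thesis unfolding tent_def[abs_def] T
  proof (rule affine_fun_on_max0[OF h[unfolded T]])
    fix x y assume xy: "x \<in> S" "y \<in> S"
    show "1 - hexnorm (x - v) \<in> \<int>" using hexnorm_Ints[OF Sv[OF xy(1)]] by auto
    have "hexnorm (y - x) \<le> 1"
    proof (cases "y = x")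
      case False
      then show ?thesis using d[OF xy(2,1)] S xy by (intro unit_bounds(4)) auto
    qed (simp add: hexnorm_def)
    then show "1 - hexnorm (x - v) - (1 - hexnorm (y - v)) \<le> 1"
      using hexnorm_triangle[of "y - v" "x - v"] by simp
  qed
qed

lemma tent_vertex:
  assumes "v \<in> mesh_vertices n" "w \<in> mesh_vertices n"
  shows "tent v w = (if w = v then 1 else 0)"
proof (cases "w = v")
  case True
  then show ?thesis by (simp add: tent_def hexnorm_0[THEN iffD2])
next
  case False
  then have "hexnorm (w - v) \<noteq> 0" by (simp add: hexnorm_0)
  moreover have "hexnorm (w - v) \<ge> 0" by (simp add: hexnorm_def)
  ultimately have "hexnorm (w - v) \<ge> 1"
    using hexnorm_Ints[OF mesh_vertices_diff[OF assms(2,1)]] by (auto elim!: Ints_cases)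
  with False show ?thesis by (simp add: tent_def)
qed

text \<open>Two neighbours of \<open>v\<close> whose difference is again a neighbour direction are
  consecutive on the hexagon and span a mesh triangle with \<open>v\<close>; \<alpha> and \<beta>
  are barycentric weights.\<close>

lemma sector_triangle:
  assumes v: "v \<in> mesh_vertices n" and ab: "(a, b) \<in> neighbours" "(c, d) \<in> neighbours" "(a - c, b - d) \<in> neighbours"
    and "\<alpha> \<ge> 0" "\<beta> \<ge> 0" "\<alpha> + \<beta> \<le> 1"
    and x: "x - v = lat n (\<alpha> * of_int a + \<beta> * of_int c) (\<alpha> * of_int b + \<beta> * of_int d)"
  shows "\<exists>T\<in>mesh_triangles n. v \<in> T \<and> x \<in> T"
proof -
  define y z where "y = v + lat n (of_int a) (of_int b)" and "z = v + lat n (of_int c) (of_int d)"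
  have L: "lat n (of_int a) (of_int b) \<in> mesh_vertices n" for a b by (auto simp: mesh_vertices_eq)
  have yz: "y \<in> mesh_vertices n" "z \<in> mesh_vertices n" by (auto simp: y_def z_def intro!: mesh_vertices_add v L)
  have "y = z + lat n (of_int (a - c)) (of_int (b - d))"
    unfolding of_int_diff lat_diff[symmetric] by (simp add: y_def z_def)
  then have "dist z y = 1 / n" using neighbour_iff[OF yz(2,1)] ab(3) by blast
  moreover have "dist v y = 1 / n" using neighbour_iff[OF v yz(1)] ab(1) y_def by blast
  moreover have "dist v z = 1 / n" using neighbour_iff[OF v yz(2)] ab(2) z_def by blast
  ultimately have "convex hull {v, y, z} \<in> mesh_triangles n"
    unfolding mesh_triangles_def mem_Collect_eq using v yz
    by (intro exI[of _ v] exI[of _ y] exI[of _ z]) (simp add: dist_commute)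
  moreover have "v \<in> convex hull {v, y, z}" by (simp add: hull_inc)
  moreover have "x \<in> convex hull {v, y, z}"
  proof -
    have "x = v + \<alpha> *\<^sub>R (y - v) + \<beta> *\<^sub>R (z - v)"
      using x by (simp add: y_def z_def lat_scale lat_add algebra_simps)
    then show ?thesis unfolding convex_hull_3_alt using assms(5-7) by blast
  qed
  ultimately show ?thesis by blast
qed

lemma hexagon_triangle:
  assumes v: "v \<in> mesh_vertices n" and N: "hexnorm (x - v) \<le> 1"
  shows "\<exists>T\<in>mesh_triangles n. v \<in> T \<and> x \<in> T"
proof -
  define s t where "s = xi1 n \<bullet> (x - v)" and "t = xi2 n \<bullet> (x - v)"
  have x: "x - v = lat n s t" by (simp add: s_def t_def lat_xi)
  have N': "\<bar>s\<bar> + \<bar>t\<bar> + \<bar>s + t\<bar> \<le> 2" using N unfolding hexnorm_def x by simp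
  \<comment> \<open>The signs of s, t and s + t single out one of the six triangles at
    \<open>v\<close>. In each sector \<open>N'\<close> says that the two barycentric weights have
    sum at most 1.\<close>
  consider "s \<ge> 0" "t \<ge> 0" | "s \<le> 0" "t \<le> 0" | "s \<ge> 0" "t \<le> 0" "s + t \<ge> 0" | "s \<ge> 0" "t \<le> 0" "s + t \<le> 0"
    | "s \<le> 0" "t \<ge> 0" "s + t \<ge> 0" | "s \<le> 0" "t \<ge> 0" "s + t \<le> 0" by linarith
  then show ?thesis
  proof cases
    case 1
    then show ?thesis using N' x by (intro sector_triangle[OF v, of 1 0 0 1 s t]) (auto simp: neighbours_def)
  next
    case 2
    then show ?thesis using N' x by (intro sector_triangle[OF v, of "-1" 0 0 "-1" "-s" "-t"]) (auto simp: neighbours_def)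
  next
    case 3
    then show ?thesis using N' x by (intro sector_triangle[OF v, of 1 0 1 "-1" "s + t" "-t"]) (auto simp: neighbours_def)
  next
    case 4
    then show ?thesis using N' x by (intro sector_triangle[OF v, of 1 "-1" 0 "-1" s "-(s + t)"]) (auto simp: neighbours_def)
  next
    case 5
    then show ?thesis using N' x by (intro sector_triangle[OF v, of "-1" 1 0 1 "-s" "s + t"]) (auto simp: neighbours_def)
  next
    case 6
    then show ?thesis using N' x by (intro sector_triangle[OF v, of "-1" 0 "-1" 1 "-(s + t)" t]) (auto simp: neighbours_def)
  qed
qed

lemma mesh_triangles_cover: "\<exists>T\<in>mesh_triangles n. x \<in> T"
proof -
  define s t where "s = xi1 n \<bullet> x" and "t = xi2 n \<bullet> x"
  have x: "x = lat n s t" by (simp add: s_def t_def lat_xi)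
  \<comment> \<open>The line \<open>frac s + frac t = 1\<close> cuts the lattice parallelogram of x
    into two mesh triangles. Depending on the side of x, the vertex \<open>v\<close> is the corner
    with the smallest or with the largest coordinates.\<close>
  define k where "k = (if frac s + frac t \<le> 1 then 0 else 1 :: int)"
  define v where "v = lat n (of_int (\<lfloor>s\<rfloor> + k)) (of_int (\<lfloor>t\<rfloor> + k))"
  have v: "v \<in> mesh_vertices n" unfolding v_def mesh_vertices_eq by blast
  have xv: "x - v = lat n (frac s - of_int k) (frac t - of_int k)"
    by (simp add: x v_def lat_diff frac_def algebra_simps)
  have "hexnorm (x - v) \<le> 1"
    unfolding hexnorm_def xv k_def using frac_ge_0[of s] frac_ge_0[of t] frac_lt_1[of s] frac_lt_1[of t] by auto
  then show ?thesis using hexagon_triangle[OF v] by blast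
qed

lemma finite_mesh_vertices_bounded:
  assumes "bounded D" shows "finite (mesh_vertices n \<inter> D)"
proof -
  obtain R where R: "\<And>x. x \<in> D \<Longrightarrow> norm x \<le> R" using assms unfolding bounded_iff by blast
  define K where "K = \<lceil>max (norm (xi1 n) * R) (norm (xi2 n) * R)\<rceil>"
  have "mesh_vertices n \<inter> D \<subseteq> (\<lambda>(a, b). lat n (of_int a) (of_int b)) ` ({-K..K} \<times> {-K..K})"
  proof
    fix x assume x: "x \<in> mesh_vertices n \<inter> D"
    then obtain a b where ab: "x = lat n (of_int a) (of_int b)" by (auto simp: mesh_vertices_eq)
    have "\<bar>xi1 n \<bullet> x\<bar> \<le> norm (xi1 n) * R" "\<bar>xi2 n \<bullet> x\<bar> \<le> norm (xi2 n) * R"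
      using x by (auto intro!: order_trans[OF Cauchy_Schwarz_ineq2] mult_left_mono R)
    then have "\<bar>real_of_int a\<bar> \<le> of_int K" "\<bar>real_of_int b\<bar> \<le> of_int K"
      unfolding ab xi_lat K_def by (meson le_of_int_ceiling max.cobounded1 max.cobounded2 order_trans)+
    then have "\<bar>a\<bar> \<le> K" "\<bar>b\<bar> \<le> K" by linarith+
    then show "x \<in> (\<lambda>(a, b). lat n (of_int a) (of_int b)) ` ({-K..K} \<times> {-K..K})"
      using ab by (intro image_eqI[of _ _ "(a, b)"]) (auto simp: abs_le_iff)
  qed
  then show ?thesis by (rule finite_subset) simp
qed

end

section \<open>Interior vertices and the nodal basis\<close>

locale mesh_domain = mesh +
  fixes D :: "(real^2) set"
  assumes D_open: "open D" and D_bounded: "bounded D"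
begin

definition interior_vertices :: "(real^2) set" where
  "interior_vertices = mesh_graph_vertices D n - mesh_graph_boundary D n"

lemma finite_vertices: "finite (mesh_graph_vertices D n)"
  unfolding mesh_graph_vertices_def by (rule finite_mesh_vertices_bounded[OF D_bounded])

lemma finite_interior: "finite interior_vertices"
  unfolding interior_vertices_def using finite_vertices by simp

lemma interior_iff: "v \<in> interior_vertices \<longleftrightarrow>
    v \<in> mesh_vertices n \<and> v \<in> D \<and> (\<forall>T\<in>mesh_triangles n. v \<in> T \<longrightarrow> T \<subseteq> D)"
  by (auto simp: interior_vertices_def mesh_graph_vertices_def mesh_graph_boundary_def)

lemma interior_vertex: "v \<in> interior_vertices \<Longrightarrow> v \<in> mesh_vertices n"
  by (simp add: interior_iff)

text \<open>The triangles at \<open>v\<close> cover the hexagon and lie in \<open>D\<close> when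
  \<open>v\<close> is interior. The hexagon contains the supports of the tent at \<open>v\<close>
  and of all its smoothings.\<close>

lemma hexagon_subset:
  assumes "v \<in> interior_vertices" shows "{x. hexnorm (x - v) \<le> 1} \<subseteq> D"
  using hexagon_triangle[of v] assms unfolding interior_iff by blast

lemma hexagon_compact: "compact {x. hexnorm (x - v) \<le> 1}"
proof -
  have "closed {x. hexnorm (x - v) \<le> 1}"
    unfolding hexnorm_def by (intro closed_Collect_le continuous_intros) auto
  moreover have "bounded {x. hexnorm (x - v) \<le> 1}"
  proof (rule boundedI)
    fix x assume "x \<in> {x. hexnorm (x - v) \<le> 1}"
    then have N: "\<bar>xi1 n \<bullet> (x - v)\<bar> + \<bar>xi2 n \<bullet> (x - v)\<bar> \<le> 2" by (simp add: hexnorm_def)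
    let ?s = "xi1 n \<bullet> (x - v)" and ?t = "xi2 n \<bullet> (x - v)"
    have "x - v = ?s *\<^sub>R lat n 1 0 + ?t *\<^sub>R lat n 0 1" by (simp add: lat_scale lat_add lat_xi)
    then have "norm (x - v) \<le> \<bar>?s\<bar> * norm (lat n 1 0) + \<bar>?t\<bar> * norm (lat n 0 1)"
      by (metis norm_scaleR norm_triangle_ineq)
    also have "\<dots> \<le> 2 * norm (lat n 1 0) + 2 * norm (lat n 0 1)"
      using N by (intro add_mono mult_right_mono) auto
    finally show "norm x \<le> norm v + (2 * norm (lat n 1 0) + 2 * norm (lat n 0 1))"
      using norm_triangle_ineq[of v "x - v"] by simp
  qed
  ultimately show ?thesis by (simp add: compact_eq_bounded_closed)
qed

lemma Hn_iff: "f \<in> Hn D n \<longleftrightarrow> continuous_on UNIV f \<and>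
     (\<forall>T\<in>mesh_triangles n. affine_fun_on T f) \<and> compactly_supported_in f D"
  by (simp add: Hn_def affine_fun_on_def)

lemma Hn_lincomb2:
  assumes "f \<in> Hn D n" "g \<in> Hn D n"
  shows "(\<lambda>x. a * f x + b * g x) \<in> Hn D n"
proof -
  obtain K L where "compact K" "K \<subseteq> D" "\<forall>x. x \<notin> K \<longrightarrow> f x = 0" "compact L" "L \<subseteq> D" "\<forall>x. x \<notin> L \<longrightarrow> g x = 0"
    using assms unfolding Hn_iff compactly_supported_in_def by blast
  then have "compactly_supported_in (\<lambda>x. a * f x + b * g x) D"
    unfolding compactly_supported_in_def by (intro exI[of _ "K \<union> L"]) auto
  with assms show ?thesis unfolding Hn_iff by (auto intro!: continuous_intros affine_fun_on_lincomb2)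
qed

lemma Hn_zero: "(\<lambda>x. 0) \<in> Hn D n"
  unfolding Hn_iff compactly_supported_in_def by (auto intro!: affine_fun_on_const exI[of _ "{}"])

lemma tent_in_Hn:
  assumes "v \<in> interior_vertices"
  shows "tent v \<in> Hn D n"
  unfolding Hn_iff
proof (intro conjI ballI)
  show "continuous_on UNIV (tent v)" unfolding tent_def hexnorm_def by (intro continuous_intros) auto
  show "affine_fun_on T (tent v)" if "T \<in> mesh_triangles n" for T
    by (rule tent_affine[OF that interior_vertex[OF assms]])
  show "compactly_supported_in (tent v) D"
    unfolding compactly_supported_in_def
    by (intro exI[of _ "{x. hexnorm (x - v) \<le> 1}"] conjI hexagon_compact hexagon_subset assms) (auto simp: tent_def)
qed

text \<open>Around a point x of \<open>T\<close> outside \<open>D\<close> the function vanishes on a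
  neighbourhood, because the complement of a compact subset of \<open>D\<close> is open. On
  \<open>T\<close> the function is then 0 at x and at a second point towards y, so its slope along y
  - x is 0.\<close>

lemma Hn_vanishes:
  assumes f: "f \<in> Hn D n" and T: "T \<in> mesh_triangles n" "\<not> T \<subseteq> D" and y: "y \<in> T"
  shows "f y = 0"
proof -
  obtain K where K: "compact K" "K \<subseteq> D" "\<And>x. x \<notin> K \<Longrightarrow> f x = 0"
    using f unfolding Hn_iff compactly_supported_in_def by blast
  obtain x where x: "x \<in> T" "x \<notin> D" using T by auto
  obtain a c where ac: "\<And>x. x \<in> T \<Longrightarrow> f x = a \<bullet> x + c" using f T(1) unfolding Hn_iff affine_fun_on_def by blast
  have "convex T" using T(1) unfolding mesh_triangles_def by (auto simp: convex_convex_hull)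
  have "open (- K)" using K(1) by (simp add: compact_imp_closed open_Compl)
  moreover have "x \<in> - K" using x K by auto
  ultimately obtain e where e: "e > 0" "ball x e \<subseteq> - K" by (meson open_contains_ball)
  \<comment> \<open>Small enough to keep \<open>z\<close> in the ball around x; the summand 1 covers
    y = x, and the minimum with 1 keeps \<open>z\<close> on the segment.\<close>
  define \<delta> where "\<delta> = min 1 (e / (2 * (norm (y - x) + 1)))"
  have \<delta>: "\<delta> > 0" "\<delta> \<le> 1" using e by (auto simp: \<delta>_def add_nonneg_pos)
  define z where "z = x + \<delta> *\<^sub>R (y - x)"
  have "z \<in> T"
  proof -
    have "z = (1 - \<delta>) *\<^sub>R x + \<delta> *\<^sub>R y" by (simp add: z_def algebra_simps)
    then show ?thesis using \<open>convex T\<close> x(1) y \<delta> by (auto simp: convex_def)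
  qed
  have "dist x z = \<delta> * norm (y - x)" using \<delta> by (simp add: z_def dist_norm)
  also have "\<dots> \<le> e / (2 * (norm (y - x) + 1)) * norm (y - x)" by (intro mult_right_mono) (auto simp: \<delta>_def)
  also have "\<dots> < e"
  proof -
    have "e * norm (y - x) < e * (2 * (norm (y - x) + 1))" using e by (intro mult_strict_left_mono) (auto simp: add_nonneg_pos)
    moreover have "2 * (norm (y - x) + 1) > 0" by (simp add: add_nonneg_pos)
    ultimately show ?thesis by (simp add: pos_divide_less_eq)
  qed
  finally have "z \<in> - K" using e by auto
  then have "f z = 0" using K by auto
  moreover have "f x = 0" using K x by auto
  ultimately have "a \<bullet> x + c = 0" "a \<bullet> z + c = 0" using ac[OF \<open>z \<in> T\<close>] ac[OF x(1)] by auto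
  moreover have "a \<bullet> z = a \<bullet> x + \<delta> * (a \<bullet> (y - x))" by (simp add: z_def inner_add_right)
  ultimately have "\<delta> * (a \<bullet> (y - x)) = 0" by linarith
  then have "a \<bullet> y = a \<bullet> x" using \<delta> by (simp add: inner_diff_right)
  then show ?thesis using ac[OF y] ac[OF x(1)] \<open>f x = 0\<close> by simp
qed

lemma Hn_vertex_zero:
  assumes f: "f \<in> Hn D n" and "w \<in> mesh_vertices n" "w \<notin> interior_vertices"
  shows "f w = 0"
proof (cases "w \<in> D")
  case True
  then obtain T where "T \<in> mesh_triangles n" "w \<in> T" "\<not> T \<subseteq> D" using assms unfolding interior_iff by blast
  then show ?thesis using Hn_vanishes[OF f] by blast
next
  case False
  then show ?thesis using f unfolding Hn_iff compactly_supported_in_def by blast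
qed

lemma tent_sum_vertex:
  assumes "w \<in> mesh_vertices n"
  shows "(\<Sum>v\<in>interior_vertices. c v * tent v w) = (if w \<in> interior_vertices then c w else 0)"
proof -
  have "(\<Sum>v\<in>interior_vertices. c v * tent v w) = (\<Sum>v\<in>interior_vertices. if v = w then c w else 0)"
    by (intro sum.cong refl) (auto simp: tent_vertex[OF interior_vertex assms])
  then show ?thesis using finite_interior by simp
qed

text \<open>Both sides are affine on the triangle of x and agree at its vertices: at interior ones
  by the nodal property of the tents, at the others because mesh functions vanish there.\<close>

lemma Hn_expansion:
  assumes f: "f \<in> Hn D n"
  shows "f x = (\<Sum>v\<in>interior_vertices. f v * tent v x)"
proof -
  obtain T where T: "T \<in> mesh_triangles n" "x \<in> T" using mesh_triangles_cover by blast
  obtain S where S: "T = convex hull S" "S \<subseteq> mesh_vertices n" using mesh_trianglesE[OF T(1)] by metis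
  show ?thesis
  proof (rule affine_fun_on_hull_eq[of S])
    show "affine_fun_on (convex hull S) f" using f T(1) unfolding Hn_iff S by blast
    show "affine_fun_on (convex hull S) (\<lambda>x. \<Sum>v\<in>interior_vertices. f v * tent v x)"
      by (intro affine_fun_on_sum) (use T(1) S(1) tent_affine interior_vertex in auto)
    show "f w = (\<Sum>v\<in>interior_vertices. f v * tent v w)" if "w \<in> S" for w
      using that S(2) tent_sum_vertex[of w f] Hn_vertex_zero[OF f, of w] by auto
    show "x \<in> convex hull S" using T S by simp
  qed
qed

lemma Hn_sum:
  assumes "finite I" "\<And>i. i \<in> I \<Longrightarrow> b i \<in> Hn D n"
  shows "(\<lambda>x. \<Sum>i\<in>I. c i * b i x) \<in> Hn D n"
  using assms
proof (induction I)
  case (insert i I)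
  then have "(\<lambda>x. c i * b i x + 1 * (\<Sum>i\<in>I. c i * b i x)) \<in> Hn D n" by (intro Hn_lincomb2) auto
  then show ?case using insert by simp
qed (simp add: Hn_zero)

lemma tent_basis: "finite_basis (Hn D n) interior_vertices tent"
  unfolding finite_basis_def
proof (intro conjI finite_interior allI impI ballI set_eqI iffI)
  fix f assume "f \<in> Hn D n"
  then have "lincomb interior_vertices tent f = f" unfolding lincomb_def using Hn_expansion by auto
  then show "f \<in> range (lincomb interior_vertices tent)"
    using rangeI[of "lincomb interior_vertices tent" f] by simp
next
  fix f assume "f \<in> range (lincomb interior_vertices tent)"
  then show "f \<in> Hn D n" unfolding lincomb_def using Hn_sum[OF finite_interior tent_in_Hn] by auto
next
  fix c v assume c: "lincomb interior_vertices tent c = (\<lambda>x. 0)" and v: "v \<in> interior_vertices"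
  from fun_cong[OF c, of v] show "c v = 0"
    unfolding lincomb_def tent_sum_vertex[OF interior_vertex[OF v]] using v by simp
qed

end

section \<open>Smoothed tent functions and their gradients\<close>

text \<open>The summand \<open>\<epsilon>\<close> makes this an upper bound of \<open>\<bar>y\<bar>\<close>, which keeps the supports of the
  smoothed tent functions inside the hexagon.\<close>

definition abs_part :: "real \<Rightarrow> real \<Rightarrow> real" where
  "abs_part \<epsilon> y = \<epsilon> + pos_part \<epsilon> y + pos_part \<epsilon> (- y)"

definition abs_part' :: "real \<Rightarrow> real \<Rightarrow> real" where
  "abs_part' \<epsilon> y = pos_part' \<epsilon> y - pos_part' \<epsilon> (- y)"

lemma abs_part_0: "abs_part 0 y = \<bar>y\<bar>"
  by (simp add: abs_part_def pos_part_0)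

lemma abs_part'_0: "abs_part' 0 y = sgn y"
  by (simp add: abs_part'_def pos_part'_def sgn_if)

lemma abs_part_ge:
  assumes "\<epsilon> \<ge> 0" shows "\<bar>y\<bar> \<le> abs_part \<epsilon> y"
proof -
  have "pos_part \<epsilon> z \<ge> 0" for z by (simp add: pos_part_def)
  from this[of y] this[of "- y"] show ?thesis
    using pos_part_lower[OF assms, of y] pos_part_lower[OF assms, of "- y"] by (auto simp: abs_part_def abs_le_iff)
qed

lemma abs_part'_bound: "\<epsilon> \<ge> 0 \<Longrightarrow> \<bar>abs_part' \<epsilon> y\<bar> \<le> 2"
  using pos_part'_bounds[of \<epsilon> y] pos_part'_bounds[of \<epsilon> "- y"] by (simp add: abs_part'_def)

lemma abs_part_deriv:
  assumes "\<epsilon> > 0 \<or> (\<epsilon> = 0 \<and> y \<noteq> 0)"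
  shows "(abs_part \<epsilon> has_real_derivative abs_part' \<epsilon> y) (at y)"
proof -
  have "((\<lambda>y. pos_part \<epsilon> (- y)) has_real_derivative (pos_part' \<epsilon> (- y) * (- 1))) (at y)"
    by (rule DERIV_chain2[OF pos_part_deriv]) (use assms in \<open>auto intro!: derivative_eq_intros\<close>)
  then have "((\<lambda>y. \<epsilon> + pos_part \<epsilon> y + pos_part \<epsilon> (- y)) has_real_derivative (0 + pos_part' \<epsilon> y + pos_part' \<epsilon> (- y) * (- 1))) (at y)"
    by (intro DERIV_add DERIV_const pos_part_deriv assms)
  then show ?thesis by (simp add: abs_part_def[abs_def] abs_part'_def)
qed

lemma abs_part_tendsto:
  assumes "e \<longlonglongrightarrow> 0" "y \<noteq> 0"
  shows "(\<lambda>k. abs_part (e k) y) \<longlonglongrightarrow> abs_part 0 y"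
    and "(\<lambda>k. abs_part' (e k) y) \<longlonglongrightarrow> abs_part' 0 y"
  unfolding abs_part_def abs_part'_def using assms
  by (intro tendsto_add tendsto_diff pos_part_tendsto tendsto_const; simp)+

lemma pos_part'_measurable [measurable]: "pos_part' \<epsilon> \<in> borel_measurable borel"
  unfolding pos_part'_def by measurable

lemma pos_part_measurable [measurable]: "pos_part \<epsilon> \<in> borel_measurable borel"
  unfolding pos_part_def by measurable

lemma gderiv_compose:
  assumes "(r has_real_derivative r') (at (f x))" "GDERIV f x :> v"
  shows "GDERIV (\<lambda>x. r (f x)) x :> r' *\<^sub>R v"
  using GDERIV_DERIV_compose[OF assms(2,1)] .

lemma gderiv_inner: "GDERIV (\<lambda>x. p \<bullet> (x - v)) x :> p"
  unfolding gderiv_def by (auto intro!: derivative_eq_intros simp: inner_commute)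

lemma gderiv_sum:
  assumes "\<And>i. i \<in> I \<Longrightarrow> GDERIV (f i) x :> g i"
  shows "GDERIV (\<lambda>x. \<Sum>i\<in>I. c i * f i x) x :> (\<Sum>i\<in>I. c i *\<^sub>R g i)"
proof -
  have "((\<lambda>x. \<Sum>i\<in>I. c i * f i x) has_derivative (\<lambda>h. \<Sum>i\<in>I. c i * (h \<bullet> g i))) (at x)"
    using assms unfolding gderiv_def by (intro derivative_intros) auto
  then show ?thesis unfolding gderiv_def by (simp add: inner_sum_right)
qed

text \<open>\<open>grad\<close> is unspecified where a function has kinks, so for a mesh function it
  is known only to agree almost everywhere with a Borel function. Completeness of the measure turns
  this into measurability.\<close>

lemma borel_measurable_lebesgue_AE:
  fixes f g :: "'a::euclidean_space \<Rightarrow> 'b::topological_space"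
  assumes g: "g \<in> borel_measurable borel" and ae: "AE x in lebesgue. f x = g x"
  shows "f \<in> borel_measurable lebesgue"
proof (rule measurableI)
  fix A :: "'b set" assume A: "A \<in> sets borel"
  have g': "g \<in> borel_measurable lebesgue" using g by (simp add: measurable_completion)
  have "f -` A \<in> sets lebesgue"
  proof (rule completion.in_sets_AE)
    show "AE x in lebesgue. x \<in> g -` A \<longleftrightarrow> x \<in> f -` A" using ae by eventually_elim auto
    show "g -` A \<in> sets lebesgue" using measurable_sets[OF g' A] by simp
  qed auto
  then show "f -` A \<inter> space lebesgue \<in> sets lebesgue" by simp
qed simp

section \<open>Smoothed tents, directional derivatives and mesh cells\<close>

context mesh
begin

text \<open>Smooths the inner kinks of the tent, those of the three absolute values; the outer one
  is left to \<open>pos_part\<close> in \<open>soft_tent\<close>.\<close>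

definition soft_gap :: "real \<Rightarrow> real^2 \<Rightarrow> real^2 \<Rightarrow> real" where
  "soft_gap \<epsilon> v x = 1 - (abs_part \<epsilon> (xi1 n \<bullet> (x - v)) + abs_part \<epsilon> (xi2 n \<bullet> (x - v)) + abs_part \<epsilon> (xi3 n \<bullet> (x - v))) / 2"

definition soft_tent :: "real \<Rightarrow> real^2 \<Rightarrow> real^2 \<Rightarrow> real" where
  "soft_tent \<epsilon> v x = pos_part \<epsilon> (soft_gap \<epsilon> v x)"

definition soft_grad :: "real \<Rightarrow> real^2 \<Rightarrow> real^2 \<Rightarrow> real^2" where
  "soft_grad \<epsilon> v x = (pos_part' \<epsilon> (soft_gap \<epsilon> v x) * (-1/2)) *\<^sub>R
     (abs_part' \<epsilon> (xi1 n \<bullet> (x - v)) *\<^sub>R xi1 n + abs_part' \<epsilon> (xi2 n \<bullet> (x - v)) *\<^sub>R xi2 n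
      + abs_part' \<epsilon> (xi3 n \<bullet> (x - v)) *\<^sub>R xi3 n)"

lemma soft_gap_0: "soft_gap 0 v x = 1 - hexnorm (x - v)"
  by (simp add: soft_gap_def abs_part_0 hexnorm_def)

lemma soft_tent_0: "soft_tent 0 v x = tent v x"
  by (simp add: soft_tent_def soft_gap_0 pos_part_0 tent_def)

text \<open>The complement of all mesh lines. Integrality of the coordinates is invariant under
  shifts by mesh vertices, so one set serves the tents at all vertices.\<close>

definition generic :: "(real^2) set" where
  "generic = {x. xi1 n \<bullet> x \<notin> \<int> \<and> xi2 n \<bullet> x \<notin> \<int> \<and> xi3 n \<bullet> x \<notin> \<int>}"

lemma xi_nonzero: "xi1 n \<noteq> 0" "xi2 n \<noteq> 0" "xi3 n \<noteq> 0"
  using xi_lat(1)[of 1 0] xi_lat(2)[of 0 1] xi_lat(3)[of 0 1] by (auto simp del: xi_lat)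

lemma AE_generic: "AE x in lebesgue. x \<in> generic"
proof -
  have *: "AE x in lebesgue. p \<bullet> x \<notin> \<int>" if "p \<noteq> 0" for p :: "real^2"
  proof -
    have "AE x in lebesgue. p \<bullet> x \<noteq> of_int k" for k :: int
    proof -
      have "negligible {x. p \<bullet> x = of_int k}" using that by (intro negligible_hyperplane) auto
      then have "{x. p \<bullet> x = of_int k} \<in> null_sets lebesgue" by (simp add: negligible_iff_null_sets)
      from AE_not_in[OF this] show ?thesis by simp
    qed
    then have "AE x in lebesgue. \<forall>k::int. p \<bullet> x \<noteq> of_int k" by (simp add: AE_all_countable)
    then show ?thesis by eventually_elim (auto elim!: Ints_cases)
  qed
  from *[OF xi_nonzero(1)] *[OF xi_nonzero(2)] *[OF xi_nonzero(3)] show ?thesis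
    by eventually_elim (simp add: generic_def)
qed

lemma generic_shift:
  assumes "v \<in> mesh_vertices n" "x \<in> generic"
  shows "xi1 n \<bullet> (x - v) \<notin> \<int>" "xi2 n \<bullet> (x - v) \<notin> \<int>" "xi3 n \<bullet> (x - v) \<notin> \<int>"
  using assms xi3_Ints[OF assms(1)] unfolding generic_def mesh_vertices_iff inner_diff_right
  by (metis (no_types, lifting) Ints_add diff_add_cancel mem_Collect_eq)+

lemma generic_nonzero:
  assumes "v \<in> mesh_vertices n" "x \<in> generic"
  shows "xi1 n \<bullet> (x - v) \<noteq> 0" "xi2 n \<bullet> (x - v) \<noteq> 0" "xi3 n \<bullet> (x - v) \<noteq> 0" "soft_gap 0 v x \<noteq> 0"
proof -
  note g = generic_shift[OF assms]
  have I: "y \<noteq> 0" "y \<noteq> 1" "y \<noteq> -1" if "y \<notin> \<int>" for y :: real using that by auto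
  show "xi1 n \<bullet> (x - v) \<noteq> 0" "xi2 n \<bullet> (x - v) \<noteq> 0" "xi3 n \<bullet> (x - v) \<noteq> 0" using g I(1) by auto
  \<comment> \<open>Half the sum is the maximum of the three absolute values, so the sum equals 2
    only if one of the numbers is 1 or -1: the boundary of the hexagon lies on mesh lines.\<close>
  have "\<bar>s\<bar> + \<bar>t\<bar> + \<bar>s + t\<bar> \<noteq> 2" if "s \<noteq> 1" "s \<noteq> -1" "t \<noteq> 1" "t \<noteq> -1" "s + t \<noteq> 1" "s + t \<noteq> -1" for s t :: real
    using that by (auto simp: abs_if)
  from this[of "xi1 n \<bullet> (x - v)" "xi2 n \<bullet> (x - v)"] show "soft_gap 0 v x \<noteq> 0"
    using I[OF g(1)] I[OF g(2)] I[OF g(3)] unfolding soft_gap_0 hexnorm_def xi3_inner by simp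
qed

lemma soft_tent_gderiv:
  assumes "\<epsilon> > 0 \<or> (\<epsilon> = 0 \<and> x \<in> generic)" "v \<in> mesh_vertices n"
  shows "GDERIV (soft_tent \<epsilon> v) x :> soft_grad \<epsilon> v x"
proof -
  have p: "GDERIV (\<lambda>x. abs_part \<epsilon> (p \<bullet> (x - v))) x :> abs_part' \<epsilon> (p \<bullet> (x - v)) *\<^sub>R p"
    if "p \<in> {xi1 n, xi2 n, xi3 n}" for p
    by (rule gderiv_compose[OF abs_part_deriv gderiv_inner]) (use assms that generic_nonzero[of v x] in auto)
  let ?g = "abs_part' \<epsilon> (xi1 n \<bullet> (x - v)) *\<^sub>R xi1 n + abs_part' \<epsilon> (xi2 n \<bullet> (x - v)) *\<^sub>R xi2 n
      + abs_part' \<epsilon> (xi3 n \<bullet> (x - v)) *\<^sub>R xi3 n"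
  have "((\<lambda>x. soft_gap \<epsilon> v x) has_derivative (\<lambda>h. 0 - (h \<bullet> (abs_part' \<epsilon> (xi1 n \<bullet> (x - v)) *\<^sub>R xi1 n) + h \<bullet> (abs_part' \<epsilon> (xi2 n \<bullet> (x - v)) *\<^sub>R xi2 n)
      + h \<bullet> (abs_part' \<epsilon> (xi3 n \<bullet> (x - v)) *\<^sub>R xi3 n)) * inverse 2)) (at x)"
    unfolding soft_gap_def divide_inverse
    by (intro has_derivative_diff has_derivative_const has_derivative_mult_left has_derivative_add p[unfolded gderiv_def]) auto
  moreover have "0 - (h \<bullet> (abs_part' \<epsilon> (xi1 n \<bullet> (x - v)) *\<^sub>R xi1 n) + h \<bullet> (abs_part' \<epsilon> (xi2 n \<bullet> (x - v)) *\<^sub>R xi2 n)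
      + h \<bullet> (abs_part' \<epsilon> (xi3 n \<bullet> (x - v)) *\<^sub>R xi3 n)) * inverse 2 = h \<bullet> ((-1/2) *\<^sub>R ?g)" for h
    by (simp add: inner_add_right)
  ultimately have gap: "GDERIV (soft_gap \<epsilon> v) x :> (-1/2) *\<^sub>R ?g" unfolding gderiv_def by (simp only:)
  have "\<epsilon> > 0 \<or> (\<epsilon> = 0 \<and> soft_gap \<epsilon> v x \<noteq> 0)" using assms generic_nonzero[of v x] by auto
  from gderiv_compose[where f = "soft_gap \<epsilon> v", OF pos_part_deriv[OF this] gap]
  have "GDERIV (\<lambda>x. pos_part \<epsilon> (soft_gap \<epsilon> v x)) x :> pos_part' \<epsilon> (soft_gap \<epsilon> v x) *\<^sub>R ((-1/2) *\<^sub>R ?g)" .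
  then show ?thesis by (simp add: soft_tent_def[abs_def] soft_grad_def)
qed

lemma soft_tent_smooth:
  assumes "\<epsilon> > 0" shows "smooth (soft_tent \<epsilon> v)"
proof -
  have p: "smooth (\<lambda>x. abs_part \<epsilon> (p \<bullet> (x - v)))" for p :: "real^2"
  proof -
    have m: "- (p \<bullet> (x - v)) = (- p) \<bullet> (x - v)" for x by simp
    have "smooth (\<lambda>x. 1 * (1 * \<epsilon> + 1 * pos_part \<epsilon> (p \<bullet> (x - v))) + 1 * pos_part \<epsilon> ((- p) \<bullet> (x - v)))"
      by (intro smooth_lincomb2 smooth_const smooth_pos_part_compose[OF assms] smooth_inner)
    then show ?thesis unfolding abs_part_def m by simp
  qed
  have "smooth (\<lambda>x. 1 * 1 + (-1/2) * (1 * (1 * abs_part \<epsilon> (xi1 n \<bullet> (x - v)) + 1 * abs_part \<epsilon> (xi2 n \<bullet> (x - v))) + 1 * abs_part \<epsilon> (xi3 n \<bullet> (x - v))))"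
    by (intro smooth_lincomb2 smooth_const p)
  moreover have "1 * 1 + (-1/2) * (1 * (1 * abs_part \<epsilon> (xi1 n \<bullet> (x - v)) + 1 * abs_part \<epsilon> (xi2 n \<bullet> (x - v))) + 1 * abs_part \<epsilon> (xi3 n \<bullet> (x - v)))
     = soft_gap \<epsilon> v x" for x by (simp add: soft_gap_def field_simps)
  ultimately have "smooth (soft_gap \<epsilon> v)" by simp
  then show ?thesis unfolding soft_tent_def[abs_def] by (rule smooth_pos_part_compose[OF assms])
qed

lemma soft_tent_support:
  assumes "\<epsilon> \<ge> 0" "hexnorm (x - v) > 1" shows "soft_tent \<epsilon> v x = 0"
proof -
  have "soft_gap \<epsilon> v x \<le> soft_gap 0 v x"
    using abs_part_ge[OF assms(1)] unfolding soft_gap_def abs_part_0 by (simp add: add_mono divide_right_mono)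
  then have "soft_gap \<epsilon> v x \<le> 0" using assms(2) unfolding soft_gap_0 by simp
  then show ?thesis by (simp add: soft_tent_def pos_part_def)
qed

text \<open>Uniform in \<epsilon> and x: the majorant for dominated convergence.\<close>

lemma soft_grad_bound:
  assumes "\<epsilon> \<ge> 0" shows "norm (soft_grad \<epsilon> v x) \<le> norm (xi1 n) + norm (xi2 n) + norm (xi3 n)"
proof -
  have b: "norm (abs_part' \<epsilon> y *\<^sub>R p) \<le> 2 * norm p" for y and p :: "real^2"
    using abs_part'_bound[OF assms, of y] by (simp add: mult_right_mono)
  have "norm (abs_part' \<epsilon> (xi1 n \<bullet> (x - v)) *\<^sub>R xi1 n + abs_part' \<epsilon> (xi2 n \<bullet> (x - v)) *\<^sub>R xi2 n + abs_part' \<epsilon> (xi3 n \<bullet> (x - v)) *\<^sub>R xi3 n)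
     \<le> 2 * norm (xi1 n) + 2 * norm (xi2 n) + 2 * norm (xi3 n)"
    by (intro norm_triangle_mono b)
  moreover have "\<bar>pos_part' \<epsilon> (soft_gap \<epsilon> v x) * (-1/2)\<bar> \<le> 1/2" using pos_part'_bounds[OF assms] by (simp add: abs_mult)
  ultimately have "norm (soft_grad \<epsilon> v x) \<le> 1/2 * (2 * norm (xi1 n) + 2 * norm (xi2 n) + 2 * norm (xi3 n))"
    unfolding soft_grad_def norm_scaleR by (intro mult_mono) auto
  then show ?thesis by simp
qed

lemma soft_grad_measurable [measurable]: "soft_grad \<epsilon> v \<in> borel_measurable borel"
  unfolding soft_grad_def[abs_def] soft_gap_def abs_part_def abs_part'_def by measurable

lemma soft_grad_tendsto:
  assumes "v \<in> mesh_vertices n" "x \<in> generic" "e \<longlonglongrightarrow> 0"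
  shows "(\<lambda>k. soft_grad (e k) v x) \<longlonglongrightarrow> soft_grad 0 v x"
proof -
  note g = generic_nonzero[OF assms(1,2)]
  have gap: "(\<lambda>k. soft_gap (e k) v x) \<longlonglongrightarrow> soft_gap 0 v x"
    unfolding soft_gap_def by (intro tendsto_intros abs_part_tendsto assms g) auto
  show ?thesis unfolding soft_grad_def
    by (intro tendsto_scaleR tendsto_mult tendsto_add tendsto_const pos_part_tendsto(2)[OF assms(3) gap g(4)] abs_part_tendsto assms g)
qed

lemma soft_grad_0_support:
  assumes "hexnorm (x - v) \<ge> 1" shows "soft_grad 0 v x = 0"
  using assms by (simp add: soft_grad_def soft_gap_0 pos_part'_def)

text \<open>The parallelogram formed by the two triangles that share an edge at the origin.\<close>

definition cell :: "real^2 \<Rightarrow> real^2 \<Rightarrow> (real^2) set" where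
  "cell p q = {y. 0 < p \<bullet> y \<and> p \<bullet> y < 1 \<and> 0 < q \<bullet> y \<and> q \<bullet> y < 1}"

lemma cell_borel [measurable]: "cell p q \<in> sets borel"
proof -
  have "open (cell p q)" unfolding cell_def
    by (intro open_Collect_conj open_Collect_less continuous_intros)
  then show ?thesis by simp
qed

text \<open>The tent rises along the edge from v - d to v and falls along the edge from v to v + d.
  The two triangles on such an edge form a translated cell, cut out by the two coordinates that
  equal 1 on d; the third one vanishes on d.\<close>

lemma soft_grad_0_directional:
  assumes "v \<in> mesh_vertices n" "x \<in> generic"
  shows "lat n 1 0 \<bullet> soft_grad 0 v x = indicator (cell (xi1 n) (xi3 n)) (x - (v - lat n 1 0)) - indicator (cell (xi1 n) (xi3 n)) (x - v)" (is ?A)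
    and "lat n 0 1 \<bullet> soft_grad 0 v x = indicator (cell (xi2 n) (xi3 n)) (x - (v - lat n 0 1)) - indicator (cell (xi2 n) (xi3 n)) (x - v)" (is ?B)
    and "lat n (-1) 1 \<bullet> soft_grad 0 v x = indicator (cell (- xi1 n) (xi2 n)) (x - (v - lat n (-1) 1)) - indicator (cell (- xi1 n) (xi2 n)) (x - v)" (is ?C)
proof -
  define s t where "s = xi1 n \<bullet> (x - v)" and "t = xi2 n \<bullet> (x - v)"
  note g = generic_nonzero[OF assms]
  have st: "s \<noteq> 0" "t \<noteq> 0" "s + t \<noteq> 0" using g(1-3) by (auto simp: s_def t_def xi3_inner)
  have sh: "p \<bullet> (x - (v - d)) = p \<bullet> (x - v) + p \<bullet> d" for p d by (simp add: inner_diff_right)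
  have grad: "lat n a b \<bullet> soft_grad 0 v x = (if \<bar>s\<bar> + \<bar>t\<bar> + \<bar>s + t\<bar> < 2 then - (sgn s * a + sgn t * b + sgn (s + t) * (a + b)) / 2 else 0)" for a b
    unfolding soft_grad_def soft_gap_0 hexnorm_def pos_part'_def abs_part'_0 xi3_inner s_def[symmetric] t_def[symmetric]
    by (simp add: inner_add_right inner_commute[of "lat n a b"] add_divide_distrib)
  show ?A ?B ?C
    unfolding grad indicator_def cell_def mem_Collect_eq sh inner_minus_left xi_lat xi3_inner s_def[symmetric] t_def[symmetric]
    using st by (auto simp: sgn_if abs_if split: if_splits)
qed

text \<open>Three unit vectors u at angles of 60 degrees form a tight frame: the squares of u . g
  add up to 3/2 times the squared norm of g. The edge vectors have length 1 / n, which accounts for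
  n^2.\<close>

lemma inner_self_directional:
  "g \<bullet> g = (2/3) * (real n)\<^sup>2 * ((lat n 1 0 \<bullet> g)\<^sup>2 + (lat n 0 1 \<bullet> g)\<^sup>2 + (lat n (-1) 1 \<bullet> g)\<^sup>2)"
proof -
  have 1: "real n * (lat n a b \<bullet> g) = (a + b / 2) * g $ 1 + (b * (sqrt 3 / 2)) * g $ 2" for a b
    using n0 by (simp add: lat_def inner_2 field_simps)
  have 2: "(real n)\<^sup>2 * (lat n a b \<bullet> g)\<^sup>2 = ((a + b / 2) * g $ 1 + (b * (sqrt 3 / 2)) * g $ 2)\<^sup>2" for a b
    using 1[of a b] by (metis power_mult_distrib)
  have "(real n)\<^sup>2 * ((lat n 1 0 \<bullet> g)\<^sup>2 + (lat n 0 1 \<bullet> g)\<^sup>2 + (lat n (-1) 1 \<bullet> g)\<^sup>2) =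
     (g $ 1)\<^sup>2 + (g $ 1 / 2 + sqrt 3 / 2 * g $ 2)\<^sup>2 + (- (g $ 1 / 2) + sqrt 3 / 2 * g $ 2)\<^sup>2"
    unfolding distrib_left 2 by simp
  also have "\<dots> = (g $ 1)\<^sup>2 + (g $ 1)\<^sup>2 / 2 + 2 * (sqrt 3 / 2 * g $ 2)\<^sup>2"
    by (simp add: power2_eq_square algebra_simps)
  also have "(sqrt 3 / 2 * g $ 2)\<^sup>2 = 3 / 4 * (g $ 2)\<^sup>2" by (simp add: power_mult_distrib power_divide)
  finally have "(real n)\<^sup>2 * ((lat n 1 0 \<bullet> g)\<^sup>2 + (lat n 0 1 \<bullet> g)\<^sup>2 + (lat n (-1) 1 \<bullet> g)\<^sup>2) = 3/2 * (g \<bullet> g)"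
    by (simp add: inner_2 power2_eq_square algebra_simps)
  then show ?thesis by simp
qed

text \<open>The cell is the image of the unit square under the basis dual to \<open>p\<close> and
  \<open>q\<close>. This basis has determinant 1 or -1 in lattice coordinates, so the area is that
  of the lattice parallelogram.\<close>

lemma cell_measure:
  assumes "p \<bullet> lat n a b = 1" "p \<bullet> lat n c d = 0" "q \<bullet> lat n a b = 0" "q \<bullet> lat n c d = 1"
    and ab: "\<bar>a * d - b * c\<bar> = 1"
  shows "cell p q \<in> lmeasurable" "measure lebesgue (cell p q) = sqrt 3 / (2 * (real n)\<^sup>2)"
proof -
  define f where "f y = y $ 1 *\<^sub>R lat n a b + y $ 2 *\<^sub>R lat n c d" for y :: "real^2"
  have lin: "linear f" unfolding f_def by (intro linearI) (auto simp: algebra_simps)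
  have pf: "p \<bullet> f y = y $ 1" "q \<bullet> f y = y $ 2" for y
    using assms(1-4) by (auto simp: f_def inner_add_right)
  \<comment> \<open>Cramer's rule for the coordinates of y in the dual basis.\<close>
  have "f (vector [(xi1 n \<bullet> y * d - xi2 n \<bullet> y * c) / (a * d - b * c), (xi2 n \<bullet> y * a - xi1 n \<bullet> y * b) / (a * d - b * c)]) = y" for y
    unfolding f_def
    by (rule eq_if_xi) (use ab in \<open>auto simp: inner_add_right divide_simps\<close>, (simp add: algebra_simps)+)
  then have surj: "\<exists>z. y = f z" for y using sym[of "f _" y] by blast
  have B: "z \<in> box 0 1 \<longleftrightarrow> 0 < z $ 1 \<and> z $ 1 < 1 \<and> 0 < z $ 2 \<and> z $ 2 < 1" for z :: "real^2"
    by (auto simp: mem_box_cart forall_2)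
  have eq: "cell p q = f ` box 0 1"
  proof safe
    fix y assume y: "y \<in> cell p q"
    obtain z where z: "y = f z" using surj by blast
    show "y \<in> f ` box 0 1" using y unfolding z by (intro imageI) (simp add: B cell_def pf)
  next
    fix z :: "real^2" assume "z \<in> box 0 1"
    then show "f z \<in> cell p q" by (simp add: B cell_def pf)
  qed
  have unit: "measure lebesgue (box 0 (1::real^2)) = 1"
  proof -
    have "prod ((\<bullet>) (1::real^2)) Basis = 1" by (rule prod.neutral) (auto simp: Basis_vec_def inner_axis)
    then show ?thesis by (simp add: measure_lborel_box_eq inner_axis Basis_vec_def)
  qed
  have det: "det (matrix f) = (a * d - b * c) * (sqrt 3 / (2 * (real n)\<^sup>2))"
    using n0 by (simp add: det_2 matrix_def f_def axis_def lat_def power2_eq_square field_simps)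
  have absdet: "\<bar>det (matrix f)\<bar> = sqrt 3 / (2 * (real n)\<^sup>2)"
    unfolding det abs_mult ab by simp
  show "cell p q \<in> lmeasurable" unfolding eq by (rule measurable_linear_image[OF lin]) simp
  show "measure lebesgue (cell p q) = sqrt 3 / (2 * (real n)\<^sup>2)"
    unfolding eq by (subst measure_linear_image[OF lin]) (simp_all add: absdet unit)
qed

text \<open>Translates of the cell by distinct mesh vertices are disjoint, so the square has no
  cross terms: on a common point both coordinates of the shift would be integers of absolute value
  below 1.\<close>

lemma integral_cell_sum_square:
  assumes pq: "\<And>x. x \<in> mesh_vertices n \<Longrightarrow> p \<bullet> x \<in> \<int> \<and> q \<bullet> x \<in> \<int>" "\<And>x. p \<bullet> x = 0 \<Longrightarrow> q \<bullet> x = 0 \<Longrightarrow> x = 0"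
    and m: "cell p q \<in> lmeasurable" and W: "finite W" "W \<subseteq> mesh_vertices n"
  shows "integrable lebesgue (\<lambda>x. (\<Sum>w\<in>W. a w * indicator (cell p q) (x - w))\<^sup>2)"
    and "(LINT x|lebesgue. (\<Sum>w\<in>W. a w * indicator (cell p q) (x - w))\<^sup>2) = measure lebesgue (cell p q) * (\<Sum>w\<in>W. (a w)\<^sup>2)"
proof -
  have sq: "(\<Sum>w\<in>W. a w * indicator (cell p q) (x - w))\<^sup>2 = (\<Sum>w\<in>W. (a w)\<^sup>2 * indicator ((+) w ` cell p q) x)" for x
  proof -
    have im: "x \<in> (+) w ` cell p q \<longleftrightarrow> x - w \<in> cell p q" for w
      by (auto intro!: image_eqI[of _ _ "x - w"])
    show ?thesis
    proof (cases "\<exists>w\<in>W. x - w \<in> cell p q")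
      case False
      then show ?thesis by (simp add: im indicator_def)
    next
      case True
      then obtain w where w: "w \<in> W" "x - w \<in> cell p q" by blast
      have uniq: "w' = w" if w': "w' \<in> W" "x - w' \<in> cell p q" for w'
      proof -
        have mv: "w' - w \<in> mesh_vertices n" using w w' W mesh_vertices_diff by blast
        have "r \<bullet> (w' - w) = 0" if "r \<in> {p, q}" for r
        proof -
          have "r \<bullet> (w' - w) = r \<bullet> (x - w) - r \<bullet> (x - w')" by (simp add: inner_diff_right)
          then have "\<bar>r \<bullet> (w' - w)\<bar> < 1" using that w w' by (auto simp: cell_def)
          moreover have "r \<bullet> (w' - w) \<in> \<int>" using that pq(1)[OF mv] by auto
          ultimately show ?thesis by (auto elim!: Ints_cases)
        qed
        then have "w' - w = 0" using pq(2) by blast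
        then show ?thesis by simp
      qed
      have ind: "indicator (cell p q) (x - w') = (if w' = w then 1 else 0 :: real)"
          "indicator ((+) w' ` cell p q) x = (if w' = w then 1 else 0 :: real)" if w': "w' \<in> W" for w'
      proof -
        have "x - w' \<in> cell p q \<longleftrightarrow> w' = w"
          using uniq[OF w'] w(2) by blast
        then show "indicator (cell p q) (x - w') = (if w' = w then 1 else 0 :: real)"
          "indicator ((+) w' ` cell p q) x = (if w' = w then 1 else 0 :: real)" by (simp_all add: indicator_def im)
      qed
      have "(\<Sum>w\<in>W. a w * indicator (cell p q) (x - w)) = (\<Sum>w'\<in>W. if w' = w then a w else 0)"
        by (intro sum.cong refl) (simp add: ind(1))
      moreover have "(\<Sum>w\<in>W. (a w)\<^sup>2 * indicator ((+) w ` cell p q) x) = (\<Sum>w'\<in>W. if w' = w then (a w)\<^sup>2 else 0)"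
        by (intro sum.cong refl) (simp add: ind(2))
      ultimately show ?thesis using w W by simp
    qed
  qed
  have mw: "(+) w ` cell p q \<in> lmeasurable" for w by (rule measurable_translation[OF m])
  have i: "integrable lebesgue (indicator ((+) w ` cell p q) :: _ \<Rightarrow> real)" for w
    using mw[of w] by (intro integrable_real_indicator) (auto simp: fmeasurable_def)
  show "integrable lebesgue (\<lambda>x. (\<Sum>w\<in>W. a w * indicator (cell p q) (x - w))\<^sup>2)"
    unfolding sq using i by (intro Bochner_Integration.integrable_sum integrable_mult_right) auto
  have "(LINT x|lebesgue. (\<Sum>w\<in>W. (a w)\<^sup>2 * indicator ((+) w ` cell p q) x)) = (\<Sum>w\<in>W. (a w)\<^sup>2 * measure lebesgue ((+) w ` cell p q))"
    using i by (subst Bochner_Integration.integral_sum) auto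
  then show "(LINT x|lebesgue. (\<Sum>w\<in>W. a w * indicator (cell p q) (x - w))\<^sup>2) = measure lebesgue (cell p q) * (\<Sum>w\<in>W. (a w)\<^sup>2)"
    unfolding sq by (simp add: measure_translation sum_distrib_left mult.commute)
qed

end

section \<open>Mesh functions as elements of the completion\<close>

context mesh_domain
begin

text \<open>Explicit Borel representatives take the place of \<open>grad\<close>. Since
  \<open>D\<close> has finite measure, boundedness on \<open>D\<close> yields the integrability of
  all pairings.\<close>

definition bounded_field :: "(real^2 \<Rightarrow> real^2) \<Rightarrow> bool" where
  "bounded_field u \<longleftrightarrow> u \<in> borel_measurable borel \<and> (\<exists>C. \<forall>x\<in>D. norm (u x) \<le> C)"

definition field_ip :: "(real^2 \<Rightarrow> real^2) \<Rightarrow> (real^2 \<Rightarrow> real^2) \<Rightarrow> real" where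
  "field_ip u v = (LINT x:D|lebesgue. u x \<bullet> v x)"

lemma D_sets [measurable]: "D \<in> sets borel" "D \<in> sets lebesgue"
  using D_open by auto

lemma bounded_set_integrable:
  fixes g :: "real^2 \<Rightarrow> real"
  assumes "g \<in> borel_measurable borel" "\<And>x. x \<in> D \<Longrightarrow> \<bar>g x\<bar> \<le> C"
  shows "set_integrable lebesgue D g"
proof -
  have "D \<in> lmeasurable" using D_bounded D_sets(2) by (intro bounded_set_imp_lmeasurable)
  then have "integrable lebesgue (\<lambda>x. indicator D x * \<bar>C\<bar>)"
    by (intro integrable_mult_left integrable_real_indicator) (auto simp: fmeasurable_def)
  then show ?thesis unfolding set_integrable_def
    by (rule Bochner_Integration.integrable_bound)
      (use assms in \<open>auto simp: indicator_def measurable_completion intro!: AE_I2 order_trans[OF assms(2)]\<close>)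
qed

lemma bounded_field_measurable: "bounded_field u \<Longrightarrow> u \<in> borel_measurable borel"
  by (simp add: bounded_field_def)

lemma bounded_field_lincomb2:
  assumes "bounded_field u" "bounded_field v"
  shows "bounded_field (\<lambda>x. a *\<^sub>R u x + b *\<^sub>R v x)"
proof -
  obtain C E where C: "\<And>x. x \<in> D \<Longrightarrow> norm (u x) \<le> C" "\<And>x. x \<in> D \<Longrightarrow> norm (v x) \<le> E"
    using assms unfolding bounded_field_def by blast
  have "norm (a *\<^sub>R u x + b *\<^sub>R v x) \<le> \<bar>a\<bar> * C + \<bar>b\<bar> * E" if "x \<in> D" for x
    using C[OF that] by (intro norm_triangle_mono) (auto intro!: mult_left_mono)
  moreover have "(\<lambda>x. a *\<^sub>R u x + b *\<^sub>R v x) \<in> borel_measurable borel"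
    using assms[THEN bounded_field_measurable] by measurable
  ultimately show ?thesis unfolding bounded_field_def by blast
qed

lemma bounded_field_diff:
  "bounded_field u \<Longrightarrow> bounded_field v \<Longrightarrow> bounded_field (\<lambda>x. u x - v x)"
  using bounded_field_lincomb2[of u v 1 "-1"] by simp

lemma field_ip_integrable:
  assumes "bounded_field u" "bounded_field v"
  shows "set_integrable lebesgue D (\<lambda>x. u x \<bullet> v x)"
proof -
  obtain C E where C: "\<And>x. x \<in> D \<Longrightarrow> norm (u x) \<le> C" "\<And>x. x \<in> D \<Longrightarrow> norm (v x) \<le> E"
    using assms unfolding bounded_field_def by blast
  have "\<bar>u x \<bullet> v x\<bar> \<le> \<bar>C\<bar> * \<bar>E\<bar>" if "x \<in> D" for x
  proof -
    have "\<bar>u x \<bullet> v x\<bar> \<le> norm (u x) * norm (v x)" by (rule Cauchy_Schwarz_ineq2)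
    also have "\<dots> \<le> \<bar>C\<bar> * \<bar>E\<bar>" using C[OF that] by (intro mult_mono) auto
    finally show ?thesis .
  qed
  moreover have "(\<lambda>x. u x \<bullet> v x) \<in> borel_measurable borel"
    using assms[THEN bounded_field_measurable] by measurable
  ultimately show ?thesis by (intro bounded_set_integrable)
qed

lemma field_ip_lincomb2:
  assumes "bounded_field u" "bounded_field v" "bounded_field w"
  shows "field_ip (\<lambda>x. a *\<^sub>R u x + b *\<^sub>R v x) w = a * field_ip u w + b * field_ip v w"
  using field_ip_integrable[OF assms(1,3)] field_ip_integrable[OF assms(2,3)]
  unfolding field_ip_def by (simp add: inner_add_left set_integral_add(2))

text \<open>A triangle inequality for squared distances; pointwise the right side exceeds the left
  by the squared norm of a + b - 2 c.\<close>

lemma field_ip_diff_le: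
  assumes "bounded_field u" "bounded_field v" "bounded_field w"
  shows "field_ip (\<lambda>x. u x - v x) (\<lambda>x. u x - v x) \<le>
    2 * field_ip (\<lambda>x. u x - w x) (\<lambda>x. u x - w x) + 2 * field_ip (\<lambda>x. v x - w x) (\<lambda>x. v x - w x)"
proof -
  note i = field_ip_integrable[OF bounded_field_diff bounded_field_diff]
  have "(a - b) \<bullet> (a - b) \<le> 2 * ((a - c) \<bullet> (a - c)) + 2 * ((b - c) \<bullet> (b - c))" for a b c :: "real^2"
  proof -
    have "2 * ((a - c) \<bullet> (a - c)) + 2 * ((b - c) \<bullet> (b - c)) - (a - b) \<bullet> (a - b) = (a + b - 2 *\<^sub>R c) \<bullet> (a + b - 2 *\<^sub>R c)"
      by (simp add: inner_diff_left inner_diff_right inner_add_left inner_add_right inner_commute)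
    then show ?thesis using inner_ge_zero[of "a + b - 2 *\<^sub>R c"] by linarith
  qed
  then have "field_ip (\<lambda>x. u x - v x) (\<lambda>x. u x - v x) \<le> (LINT x:D|lebesgue. 2 * ((u x - w x) \<bullet> (u x - w x)) + 2 * ((v x - w x) \<bullet> (v x - w x)))"
    unfolding field_ip_def using assms by (intro set_integral_mono set_integral_add set_integrable_mult_right i) auto
  also have "\<dots> = 2 * field_ip (\<lambda>x. u x - w x) (\<lambda>x. u x - w x) + 2 * field_ip (\<lambda>x. v x - w x) (\<lambda>x. v x - w x)"
    unfolding field_ip_def using i assms by (subst set_integral_add(2)) auto
  finally show ?thesis .
qed

text \<open>The mesh lines are a null set, so gradients prescribed at generic points determine the
  integral.\<close>

lemma dirichlet_eq_field_ip:
  assumes "\<And>x. x \<in> generic \<Longrightarrow> GDERIV f x :> u x" "\<And>x. x \<in> generic \<Longrightarrow> GDERIV g x :> v x"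
    and "bounded_field u" "bounded_field v"
  shows "dirichlet D f g = field_ip u v"
    and "set_integrable lebesgue D (\<lambda>x. grad f x \<bullet> grad g x)"
proof -
  have ae: "AE x in lebesgue. grad f x \<bullet> grad g x = u x \<bullet> v x"
    using AE_generic by eventually_elim (simp add: gderiv_grad[OF assms(1)] gderiv_grad[OF assms(2)])
  have m: "(\<lambda>x. u x \<bullet> v x) \<in> borel_measurable borel"
    using assms(3,4)[THEN bounded_field_measurable] by measurable
  have m': "(\<lambda>x. grad f x \<bullet> grad g x) \<in> borel_measurable lebesgue"
    by (rule borel_measurable_lebesgue_AE[OF m ae])
  show "dirichlet D f g = field_ip u v"
    unfolding dirichlet_def field_ip_def
    by (rule set_lebesgue_integral_cong_AE) (use m m' ae in \<open>auto simp: measurable_completion\<close>)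
  have "integrable lebesgue (\<lambda>x. indicator D x *\<^sub>R (u x \<bullet> v x))"
    using field_ip_integrable[OF assms(3,4)] by (simp add: set_integrable_def)
  then show "set_integrable lebesgue D (\<lambda>x. grad f x \<bullet> grad g x)"
    unfolding set_integrable_def
    by (rule integrable_cong_AE_imp) (use m' ae in auto)
qed

text \<open>The coefficients are a function on the plane, so that a mesh function can be inserted
  directly and contributes its vertex values.\<close>

definition soft_fun :: "real \<Rightarrow> (real^2 \<Rightarrow> real) \<Rightarrow> real^2 \<Rightarrow> real" where
  "soft_fun \<epsilon> c x = (\<Sum>v\<in>interior_vertices. c v * soft_tent \<epsilon> v x)"

definition soft_field :: "real \<Rightarrow> (real^2 \<Rightarrow> real) \<Rightarrow> real^2 \<Rightarrow> real^2" where
  "soft_field \<epsilon> c x = (\<Sum>v\<in>interior_vertices. c v *\<^sub>R soft_grad \<epsilon> v x)"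

lemma soft_fun_gderiv:
  assumes "\<epsilon> > 0 \<or> (\<epsilon> = 0 \<and> x \<in> generic)"
  shows "GDERIV (soft_fun \<epsilon> c) x :> soft_field \<epsilon> c x"
  unfolding soft_fun_def[abs_def] soft_field_def
  by (intro gderiv_sum soft_tent_gderiv assms interior_vertex)

lemma Hn_soft_fun: "f \<in> Hn D n \<Longrightarrow> f = soft_fun 0 f"
  using Hn_expansion by (auto simp: soft_fun_def soft_tent_0)

lemma Hn_gderiv: "f \<in> Hn D n \<Longrightarrow> x \<in> generic \<Longrightarrow> GDERIV f x :> soft_field 0 f x"
  using soft_fun_gderiv[of 0 x f] Hn_soft_fun[of f] by simp

lemma soft_fun_Hs:
  assumes "\<epsilon> > 0" shows "soft_fun \<epsilon> c \<in> Hs D"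
proof -
  have "compactly_supported_in (soft_fun \<epsilon> c) D"
    unfolding compactly_supported_in_def
  proof (intro exI conjI allI impI)
    show "compact (\<Union>v\<in>interior_vertices. {x. hexnorm (x - v) \<le> 1})"
      by (intro compact_UN finite_interior hexagon_compact)
    show "(\<Union>v\<in>interior_vertices. {x. hexnorm (x - v) \<le> 1}) \<subseteq> D" using hexagon_subset by blast
    fix x assume "x \<notin> (\<Union>v\<in>interior_vertices. {x. hexnorm (x - v) \<le> 1})"
    then show "soft_fun \<epsilon> c x = 0"
      unfolding soft_fun_def using assms by (intro sum.neutral ballI) (auto simp: soft_tent_support)
  qed
  then show ?thesis
    unfolding Hs_def soft_fun_def[abs_def] by (auto intro: smooth_sum soft_tent_smooth[OF assms])
qed

lemma soft_field_bound:
  assumes "\<epsilon> \<ge> 0"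
  shows "norm (soft_field \<epsilon> c x) \<le> (\<Sum>v\<in>interior_vertices. \<bar>c v\<bar> * (norm (xi1 n) + norm (xi2 n) + norm (xi3 n)))"
  unfolding soft_field_def
  by (rule sum_norm_le) (auto intro!: mult_left_mono soft_grad_bound[OF assms])

lemma soft_field_measurable [measurable]: "soft_field \<epsilon> c \<in> borel_measurable borel"
  unfolding soft_field_def[abs_def] by measurable

lemma soft_field_bounded_field: "\<epsilon> \<ge> 0 \<Longrightarrow> bounded_field (soft_field \<epsilon> c)"
  unfolding bounded_field_def using soft_field_bound soft_field_measurable by blast

lemma soft_field_tendsto:
  assumes "x \<in> generic" "e \<longlonglongrightarrow> 0"
  shows "(\<lambda>k. soft_field (e k) c x) \<longlonglongrightarrow> soft_field 0 c x"
  unfolding soft_field_def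
  by (intro tendsto_sum tendsto_scaleR tendsto_const soft_grad_tendsto assms interior_vertex)

text \<open>Dominated convergence with the constant C^2 on the bounded set \<open>D\<close>; the
  pointwise limits are taken off the mesh lines.\<close>

lemma field_ip_dominated:
  assumes "\<And>k. bounded_field (u k)" "bounded_field w" "\<And>k x. x \<in> D \<Longrightarrow> norm (u k x) \<le> C"
    and "\<And>k. bounded_field (v k)" "bounded_field z" "\<And>k x. x \<in> D \<Longrightarrow> norm (v k x) \<le> C"
    and "\<And>x. x \<in> generic \<Longrightarrow> (\<lambda>k. u k x) \<longlonglongrightarrow> w x" "\<And>x. x \<in> generic \<Longrightarrow> (\<lambda>k. v k x) \<longlonglongrightarrow> z x"
  shows "(\<lambda>k. field_ip (u k) (v k)) \<longlonglongrightarrow> field_ip w z"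
  unfolding field_ip_def set_lebesgue_integral_def
proof (rule integral_dominated_convergence)
  have "set_integrable lebesgue D (\<lambda>x. C * C)" by (rule bounded_set_integrable[of _ "\<bar>C * C\<bar>"]) auto
  then show "integrable lebesgue (\<lambda>x. indicator D x *\<^sub>R (C * C))" by (simp add: set_integrable_def)
  have mm: "(\<lambda>x. indicator D x *\<^sub>R (a x \<bullet> b x)) \<in> borel_measurable lebesgue" if "bounded_field a" "bounded_field b" for a b
  proof -
    have [measurable]: "a \<in> borel_measurable borel" "b \<in> borel_measurable borel" using that bounded_field_measurable by auto
    have "(\<lambda>x. indicator D x *\<^sub>R (a x \<bullet> b x)) \<in> borel_measurable borel" by measurable
    then show ?thesis by (simp add: measurable_completion)
  qed
  show "(\<lambda>x. indicator D x *\<^sub>R (w x \<bullet> z x)) \<in> borel_measurable lebesgue" by (rule mm[OF assms(2,5)])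
  fix k
  show "(\<lambda>x. indicator D x *\<^sub>R (u k x \<bullet> v k x)) \<in> borel_measurable lebesgue" by (rule mm[OF assms(1,4)])
  have "\<bar>u k x \<bullet> v k x\<bar> \<le> C * C" if "x \<in> D" for x
  proof -
    have "\<bar>u k x \<bullet> v k x\<bar> \<le> norm (u k x) * norm (v k x)" by (rule Cauchy_Schwarz_ineq2)
    also have "\<dots> \<le> C * C" using assms(3,6)[OF that, of k] by (intro mult_mono) (auto intro: order_trans[OF norm_ge_zero])
    finally show ?thesis .
  qed
  then show "AE x in lebesgue. norm (indicator D x *\<^sub>R (u k x \<bullet> v k x)) \<le> indicator D x *\<^sub>R (C * C)"
    by (auto simp: indicator_def)
next
  show "AE x in lebesgue. (\<lambda>k. indicator D x *\<^sub>R (u k x \<bullet> v k x)) \<longlonglongrightarrow> indicator D x *\<^sub>R (w x \<bullet> z x)"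
    using AE_generic by eventually_elim (intro tendsto_scaleR tendsto_const tendsto_inner assms)
qed

section \<open>Dirichlet integrals of smooth and mesh functions\<close>

lemma Hs_bounded_field:
  assumes "f \<in> Hs D" shows "bounded_field (grad f)"
proof -
  have s: "smooth f" using assms by (simp add: Hs_def)
  have c: "continuous_on UNIV (grad f)" by (rule smooth_grad_continuous[OF s])
  have "compact (closure D)" using D_bounded by simp
  then have "bounded (grad f ` closure D)" by (intro compact_imp_bounded compact_continuous_image continuous_on_subset[OF c]) auto
  then obtain C where "\<And>x. x \<in> closure D \<Longrightarrow> norm (grad f x) \<le> C" unfolding bounded_iff by blast
  then have "\<forall>x\<in>D. norm (grad f x) \<le> C" using closure_subset by blast
  moreover have "grad f \<in> borel_measurable borel" using c by (rule borel_measurable_continuous_onI)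
  ultimately show ?thesis unfolding bounded_field_def by blast
qed

lemma Hs_gderiv: "f \<in> Hs D \<Longrightarrow> GDERIV f x :> grad f x"
  by (simp add: Hs_def smooth_gderiv)

lemma Hn_bounded_field: "bounded_field (soft_field 0 f)"
  by (rule soft_field_bounded_field) simp

lemma dirichlet_Hn:
  assumes "f \<in> Hn D n" "g \<in> Hn D n"
  shows "dirichlet D f g = field_ip (soft_field 0 f) (soft_field 0 g)"
  by (rule dirichlet_eq_field_ip(1)) (use assms Hn_gderiv Hn_bounded_field in auto)

lemma dirichlet_Hs:
  assumes "f \<in> Hs D" "g \<in> Hs D"
  shows "dirichlet D f g = field_ip (grad f) (grad g)"
  by (rule dirichlet_eq_field_ip(1)) (use assms Hs_gderiv Hs_bounded_field in auto)

lemma dirichlet_Hs_diff_Hs: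
  assumes "f \<in> Hs D" "g \<in> Hs D"
  shows "dirichlet D (\<lambda>x. f x - g x) (\<lambda>x. f x - g x) = field_ip (\<lambda>x. grad f x - grad g x) (\<lambda>x. grad f x - grad g x)"
  by (rule dirichlet_eq_field_ip(1)) (use assms in \<open>auto intro!: bounded_field_diff Hs_bounded_field GDERIV_diff Hs_gderiv\<close>)

lemma dirichlet_Hs_diff_Hn:
  assumes "f \<in> Hs D" "g \<in> Hn D n"
  shows "dirichlet D (\<lambda>x. f x - g x) (\<lambda>x. f x - g x) =
      field_ip (\<lambda>x. grad f x - soft_field 0 g x) (\<lambda>x. grad f x - soft_field 0 g x)"
    and "set_integrable lebesgue D (\<lambda>x. (norm (grad (\<lambda>x. f x - g x) x))\<^sup>2)"
proof -
  note * = dirichlet_eq_field_ip[of "\<lambda>x. f x - g x" "\<lambda>x. grad f x - soft_field 0 g x" "\<lambda>x. f x - g x" "\<lambda>x. grad f x - soft_field 0 g x"]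
  have g: "GDERIV (\<lambda>x. f x - g x) x :> grad f x - soft_field 0 g x" if "x \<in> generic" for x
    by (rule GDERIV_diff[OF Hs_gderiv[OF assms(1)] Hn_gderiv[OF assms(2) that]])
  have b: "bounded_field (\<lambda>x. grad f x - soft_field 0 g x)"
    by (rule bounded_field_diff[OF Hs_bounded_field[OF assms(1)] Hn_bounded_field])
  show "dirichlet D (\<lambda>x. f x - g x) (\<lambda>x. f x - g x) =
      field_ip (\<lambda>x. grad f x - soft_field 0 g x) (\<lambda>x. grad f x - soft_field 0 g x)"
    by (rule *(1)[OF g g b b])
  show "set_integrable lebesgue D (\<lambda>x. (norm (grad (\<lambda>x. f x - g x) x))\<^sup>2)"
    using *(2)[OF g g b b] by (simp add: power2_norm_eq_inner)
qed

section \<open>Mesh functions in the completion\<close>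

lemma completion_norm:
  assumes "dirichlet_completion D \<iota>" "f \<in> Hs D" "g \<in> Hs D"
  shows "(norm (\<iota> f - \<iota> g))\<^sup>2 = dirichlet D (\<lambda>x. f x - g x) (\<lambda>x. f x - g x)"
proof -
  have d: "(\<lambda>x. 1 * f x + (-1) * g x) \<in> Hs D" by (rule Hs_lincomb2[OF assms(2,3)])
  have "\<iota> (\<lambda>x. 1 * f x + (-1) * g x) = 1 *\<^sub>R \<iota> f + (-1) *\<^sub>R \<iota> g"
    using assms unfolding dirichlet_completion_def by blast
  then have "\<iota> (\<lambda>x. f x - g x) = \<iota> f - \<iota> g" by simp
  moreover have "\<iota> (\<lambda>x. f x - g x) \<bullet> \<iota> (\<lambda>x. f x - g x) = dirichlet D (\<lambda>x. f x - g x) (\<lambda>x. f x - g x)"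
    using assms(1) d unfolding dirichlet_completion_def by simp
  ultimately show ?thesis by (simp add: power2_norm_eq_inner)
qed

text \<open>A mesh function need not lie in the domain where \<iota> is meaningful, so the
  comparison through it takes place in the Dirichlet integral. The estimate yields the Cauchy
  property of smooth approximations as well as the uniqueness of their limit.\<close>

lemma completion_norm_le:
  assumes "dirichlet_completion D \<iota>" "f \<in> Hs D" "g \<in> Hs D" "h \<in> Hn D n"
  shows "(norm (\<iota> f - \<iota> g))\<^sup>2 \<le> 2 * dirichlet D (\<lambda>x. f x - h x) (\<lambda>x. f x - h x) + 2 * dirichlet D (\<lambda>x. g x - h x) (\<lambda>x. g x - h x)"
  unfolding completion_norm[OF assms(1-3)] dirichlet_Hs_diff_Hs[OF assms(2,3)]
    dirichlet_Hs_diff_Hn(1)[OF assms(2,4)] dirichlet_Hs_diff_Hn(1)[OF assms(3,4)]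
  by (intro field_ip_diff_le Hs_bounded_field Hn_bounded_field assms)

text \<open>\<open>gff_mesh_projection\<close> asks for some representing element; uniqueness allows
  it to be exchanged for a fixed one.\<close>

lemma represents_unique:
  assumes c: "dirichlet_completion D \<iota>" and f: "f \<in> Hn D n"
    and "represents D \<iota> f u" "represents D \<iota> f u'"
  shows "u = u'"
proof -
  obtain F F' where F: "\<And>k. F k \<in> Hs D" "(\<lambda>k. dirichlet D (\<lambda>y. F k y - f y) (\<lambda>y. F k y - f y)) \<longlonglongrightarrow> 0" "(\<lambda>k. \<iota> (F k)) \<longlonglongrightarrow> u"
    and F': "\<And>k. F' k \<in> Hs D" "(\<lambda>k. dirichlet D (\<lambda>y. F' k y - f y) (\<lambda>y. F' k y - f y)) \<longlonglongrightarrow> 0" "(\<lambda>k. \<iota> (F' k)) \<longlonglongrightarrow> u'"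
    using assms(3,4) unfolding represents_def by blast
  have "(\<lambda>k. (norm (\<iota> (F k) - \<iota> (F' k)))\<^sup>2) \<longlonglongrightarrow> (norm (u - u'))\<^sup>2"
    by (intro tendsto_intros F F')
  moreover have "(\<lambda>k. (norm (\<iota> (F k) - \<iota> (F' k)))\<^sup>2) \<longlonglongrightarrow> 0"
  proof (rule tendsto_sandwich[OF _ _ tendsto_const])
    show "(\<lambda>k. 2 * dirichlet D (\<lambda>y. F k y - f y) (\<lambda>y. F k y - f y) + 2 * dirichlet D (\<lambda>y. F' k y - f y) (\<lambda>y. F' k y - f y)) \<longlonglongrightarrow> 0"
      using tendsto_add[OF tendsto_mult[OF tendsto_const F(2), of 2] tendsto_mult[OF tendsto_const F'(2), of 2]] by simp
    show "\<forall>\<^sub>F k in sequentially. (norm (\<iota> (F k) - \<iota> (F' k)))\<^sup>2 \<le> 2 * dirichlet D (\<lambda>y. F k y - f y) (\<lambda>y. F k y - f y) + 2 * dirichlet D (\<lambda>y. F' k y - f y) (\<lambda>y. F' k y - f y)"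
      by (intro always_eventually allI completion_norm_le c f F F')
  qed auto
  ultimately have "(norm (u - u'))\<^sup>2 = 0" by (rule LIMSEQ_unique)
  then show ?thesis by simp
qed

text \<open>Smoothing all mesh functions with the same parameters makes the inner products of the
  approximations converge to Dirichlet integrals, so the limits define a single isometric map
  \<open>U\<close>.\<close>

lemma represents_exists:
  fixes \<iota> :: "(real^2 \<Rightarrow> real) \<Rightarrow> 'h::{real_inner,complete_space}"
  assumes c: "dirichlet_completion D \<iota>"
  obtains U where "\<And>f. f \<in> Hn D n \<Longrightarrow> represents D \<iota> f (U f)"
    "\<And>f g. f \<in> Hn D n \<Longrightarrow> g \<in> Hn D n \<Longrightarrow> U f \<bullet> U g = dirichlet D f g"
proof -
  define e where "e k = 1 / real (Suc k)" for k
  have e: "e k > 0" "e \<longlonglongrightarrow> 0" for k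
    using LIMSEQ_inverse_real_of_nat by (simp_all add: e_def[abs_def] inverse_eq_divide)
  define F where "F f k = soft_fun (e k) f" for f k
  have F: "F f k \<in> Hs D" for f k unfolding F_def by (rule soft_fun_Hs[OF e(1)])
  have grad: "grad (F f k) = soft_field (e k) f" for f k
    unfolding F_def using gderiv_grad[OF soft_fun_gderiv] e(1) by blast
  have ip: "(\<lambda>k. field_ip (soft_field (e k) f) (soft_field (e k) g)) \<longlonglongrightarrow> field_ip (soft_field 0 f) (soft_field 0 g)" for f g
  proof (rule field_ip_dominated)
    let ?C = "\<lambda>c. \<Sum>v\<in>interior_vertices. \<bar>c v\<bar> * (norm (xi1 n) + norm (xi2 n) + norm (xi3 n))"
    show "norm (soft_field (e k) f x) \<le> max (?C f) (?C g)" "norm (soft_field (e k) g x) \<le> max (?C f) (?C g)" for k x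
      using soft_field_bound[of "e k"] e(1)[of k] by (auto intro: max.coboundedI1 max.coboundedI2 less_imp_le)
  qed (use e in \<open>auto intro!: soft_field_bounded_field soft_field_tendsto less_imp_le\<close>)
  have dF: "(\<lambda>k. dirichlet D (\<lambda>y. F f k y - f y) (\<lambda>y. F f k y - f y)) \<longlonglongrightarrow> 0" if f: "f \<in> Hn D n" for f
  proof -
    let ?C = "\<Sum>v\<in>interior_vertices. \<bar>f v\<bar> * (norm (xi1 n) + norm (xi2 n) + norm (xi3 n))"
    let ?u = "\<lambda>k x. soft_field (e k) f x - soft_field 0 f x"
    have b: "norm (?u k x) \<le> 2 * ?C" for k x
    proof -
      have "norm (?u k x) \<le> norm (soft_field (e k) f x) + norm (soft_field 0 f x)" by (rule norm_triangle_ineq4)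
      also have "\<dots> \<le> ?C + ?C" using e(1)[of k] by (intro add_mono soft_field_bound) auto
      finally show ?thesis by simp
    qed
    have t: "(\<lambda>k. ?u k x) \<longlonglongrightarrow> 0" if "x \<in> generic" for x
      using tendsto_diff[OF soft_field_tendsto[OF that e(2)] tendsto_const, of f "soft_field 0 f x"] by simp
    have "(\<lambda>k. field_ip (?u k) (?u k)) \<longlonglongrightarrow> field_ip (\<lambda>x. 0) (\<lambda>x. 0)"
      by (rule field_ip_dominated[where C = "2 * ?C"])
        (use e in \<open>auto intro!: b t bounded_field_diff soft_field_bounded_field less_imp_le simp: bounded_field_def\<close>)
    moreover have "field_ip (\<lambda>x. 0) (\<lambda>x. 0) = 0" by (simp add: field_ip_def set_lebesgue_integral_def)
    ultimately show ?thesis unfolding dirichlet_Hs_diff_Hn(1)[OF F f] grad by simp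
  qed
  have conv: "convergent (\<lambda>k. \<iota> (F f k))" if f: "f \<in> Hn D n" for f
  proof (rule Cauchy_convergent, rule CauchyI)
    fix \<delta> :: real assume \<delta>: "\<delta> > 0"
    \<comment> \<open>The quarter offsets the two factors 2 in
      \<open>completion_norm_le\<close>.\<close>
    have "eventually (\<lambda>k. dirichlet D (\<lambda>y. F f k y - f y) (\<lambda>y. F f k y - f y) < \<delta>\<^sup>2 / 4) sequentially"
      by (rule order_tendstoD(2)[OF dF[OF f]]) (use \<delta> in simp)
    then obtain K where K: "\<And>k. k \<ge> K \<Longrightarrow> dirichlet D (\<lambda>y. F f k y - f y) (\<lambda>y. F f k y - f y) < \<delta>\<^sup>2 / 4"
      by (auto simp: eventually_sequentially)
    have "norm (\<iota> (F f k) - \<iota> (F f l)) < \<delta>" if "k \<ge> K" "l \<ge> K" for k l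
    proof -
      have "(norm (\<iota> (F f k) - \<iota> (F f l)))\<^sup>2 < \<delta>\<^sup>2"
        using completion_norm_le[OF c F[of f k] F[of f l] f] K[OF that(1)] K[OF that(2)] by linarith
      then show ?thesis by (rule power2_less_imp_less) (use \<delta> in simp)
    qed
    then show "\<exists>M. \<forall>m\<ge>M. \<forall>n\<ge>M. norm (\<iota> (F f m) - \<iota> (F f n)) < \<delta>"
      by (intro exI[of _ K] allI impI)
  qed
  define U where "U f = lim (\<lambda>k. \<iota> (F f k))" for f
  have U: "(\<lambda>k. \<iota> (F f k)) \<longlonglongrightarrow> U f" if "f \<in> Hn D n" for f
    using conv[OF that] unfolding U_def by (simp add: convergent_LIMSEQ_iff)
  show ?thesis
  proof (rule that)
    fix f assume f: "f \<in> Hn D n"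
    show "represents D \<iota> f (U f)"
      unfolding represents_def
      by (intro exI[of _ "F f"] conjI allI F dirichlet_Hs_diff_Hn(2)[OF F f] dF[OF f] U[OF f])
  next
    fix f g assume f: "f \<in> Hn D n" and g: "g \<in> Hn D n"
    have "(\<lambda>k. \<iota> (F f k) \<bullet> \<iota> (F g k)) \<longlonglongrightarrow> U f \<bullet> U g" by (intro tendsto_inner U f g)
    moreover have "\<iota> (F f k) \<bullet> \<iota> (F g k) = field_ip (soft_field (e k) f) (soft_field (e k) g)" for k
      using c F[of f k] F[of g k] dirichlet_Hs[OF F[of f k] F[of g k]]
      unfolding dirichlet_completion_def grad by simp
    ultimately have "(\<lambda>k. field_ip (soft_field (e k) f) (soft_field (e k) g)) \<longlonglongrightarrow> U f \<bullet> U g" by simp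
    then have "U f \<bullet> U g = field_ip (soft_field 0 f) (soft_field 0 g)" using ip by (rule LIMSEQ_unique)
    then show "U f \<bullet> U g = dirichlet D f g" using dirichlet_Hn[OF f g] by simp
  qed
qed

end

section \<open>The Dirichlet energy of a mesh function\<close>

context mesh_domain
begin

text \<open>The starting points of the edges in direction \<open>d\<close> with at least one interior end point.\<close>

definition edge_sources :: "real^2 \<Rightarrow> (real^2) set" where
  "edge_sources d = interior_vertices \<union> (\<lambda>v. v - d) ` interior_vertices"

lemma finite_edge_sources: "finite (edge_sources d)"
  by (simp add: edge_sources_def finite_interior)

lemma edge_sources_vertices: "d \<in> mesh_vertices n \<Longrightarrow> edge_sources d \<subseteq> mesh_vertices n"
  using interior_vertex mesh_vertices_diff by (auto simp: edge_sources_def)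

text \<open>Summation by parts: the cell of an edge occurs with a plus sign for the tent at its end
  point and with a minus sign for the tent at its starting point, which leaves the difference of the
  two vertex values.\<close>

lemma soft_field_0_directional:
  assumes f: "f \<in> Hn D n" and x: "x \<in> generic" and d: "d \<in> mesh_vertices n"
    and dir: "\<And>v. v \<in> mesh_vertices n \<Longrightarrow> d \<bullet> soft_grad 0 v x = indicator C (x - (v - d)) - indicator C (x - v)"
  shows "d \<bullet> soft_field 0 f x = (\<Sum>w\<in>edge_sources d. (f (w + d) - f w) * indicator C (x - w))"
proof -
  \<comment> \<open>Enlarging both index sets to the common set \<open>edge_sources d\<close> adds
    only terms whose vertex value is 0.\<close>
  have z: "f w = 0" if "w \<in> edge_sources d" "w \<notin> interior_vertices" for w
    using that edge_sources_vertices[OF d] by (intro Hn_vertex_zero[OF f]) auto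
  have z': "f (w + d) = 0" if "w \<in> edge_sources d" "w \<notin> (\<lambda>v. v - d) ` interior_vertices" for w
  proof (rule Hn_vertex_zero[OF f])
    show "w + d \<in> mesh_vertices n" using that edge_sources_vertices[OF d] d mesh_vertices_add by auto
    show "w + d \<notin> interior_vertices"
    proof
      assume "w + d \<in> interior_vertices"
      then have "(w + d) - d \<in> (\<lambda>v. v - d) ` interior_vertices" by (rule imageI)
      then show False using that(2) by simp
    qed
  qed
  have "(\<Sum>v\<in>interior_vertices. f v * indicator C (x - (v - d))) = (\<Sum>w\<in>(\<lambda>v. v - d) ` interior_vertices. f (w + d) * indicator C (x - w))"
    by (subst sum.reindex) (auto simp: inj_on_def)
  also have "\<dots> = (\<Sum>w\<in>edge_sources d. f (w + d) * indicator C (x - w))"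
    by (rule sum.mono_neutral_left) (use finite_edge_sources z' in \<open>auto simp: edge_sources_def\<close>)
  finally have 1: "(\<Sum>v\<in>interior_vertices. f v * indicator C (x - (v - d))) = (\<Sum>w\<in>edge_sources d. f (w + d) * indicator C (x - w))" .
  have 2: "(\<Sum>v\<in>interior_vertices. f v * indicator C (x - v)) = (\<Sum>w\<in>edge_sources d. f w * indicator C (x - w))"
    by (rule sum.mono_neutral_left) (use finite_edge_sources z in \<open>auto simp: edge_sources_def\<close>)
  have "d \<bullet> soft_field 0 f x = (\<Sum>v\<in>interior_vertices. f v * (d \<bullet> soft_grad 0 v x))"
    by (simp add: soft_field_def inner_sum_right)
  also have "\<dots> = (\<Sum>v\<in>interior_vertices. f v * indicator C (x - (v - d)) - f v * indicator C (x - v))"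
    by (intro sum.cong refl) (simp add: dir[OF interior_vertex] right_diff_distrib)
  also have "\<dots> = (\<Sum>w\<in>edge_sources d. (f (w + d) - f w) * indicator C (x - w))"
    unfolding sum_subtractf 1 2 by (simp add: left_diff_distrib sum_subtractf)
  finally show ?thesis .
qed

definition edge_energy :: "real^2 \<Rightarrow> (real^2 \<Rightarrow> real) \<Rightarrow> real" where
  "edge_energy d f = (\<Sum>w\<in>edge_sources d. (f (w + d) - f w)\<^sup>2)"

text \<open>Turns the integral over \<open>D\<close> into one over the plane, so that each
  translated cell contributes its full area.\<close>

lemma soft_field_0_support:
  assumes "x \<notin> D" shows "soft_field 0 f x = 0"
  unfolding soft_field_def
proof (intro sum.neutral ballI)
  fix v assume "v \<in> interior_vertices"
  then have "\<not> hexnorm (x - v) \<le> 1" using hexagon_subset assms by blast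
  then show "f v *\<^sub>R soft_grad 0 v x = 0" by (simp add: soft_grad_0_support)
qed

lemma lat_vertex: "lat n (of_int a) (of_int b) \<in> mesh_vertices n"
  unfolding mesh_vertices_eq by blast

lemma dirichlet_edge_energy:
  assumes f: "f \<in> Hn D n"
  shows "dirichlet D f f = (edge_energy (lat n 1 0) f + edge_energy (lat n 0 1) f + edge_energy (lat n (-1) 1) f) / sqrt 3"
proof -
  define h where "h C d x = (\<Sum>w\<in>edge_sources d. (f (w + d) - f w) * indicator C (x - w))" for C :: "(real^2) set" and d x
  define C1 C2 C3 where "C1 = cell (xi1 n) (xi3 n)" and "C2 = cell (xi2 n) (xi3 n)" and "C3 = cell (- xi1 n) (xi2 n)"
  have V: "lat n 1 0 \<in> mesh_vertices n" "lat n 0 1 \<in> mesh_vertices n" "lat n (-1) 1 \<in> mesh_vertices n"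
    using lat_vertex[of 1 0] lat_vertex[of 0 1] lat_vertex[of "-1" 1] by auto
  have c: "integrable lebesgue (\<lambda>x. (h (cell p q) d x)\<^sup>2) \<and>
      (LINT x|lebesgue. (h (cell p q) d x)\<^sup>2) = sqrt 3 / (2 * (real n)\<^sup>2) * edge_energy d f"
    if pq: "\<And>x. x \<in> mesh_vertices n \<Longrightarrow> p \<bullet> x \<in> \<int> \<and> q \<bullet> x \<in> \<int>" "\<And>x. p \<bullet> x = 0 \<Longrightarrow> q \<bullet> x = 0 \<Longrightarrow> x = 0"
      and d: "d \<in> mesh_vertices n"
      and m: "p \<bullet> lat n a b = 1" "p \<bullet> lat n a' b' = 0" "q \<bullet> lat n a b = 0" "q \<bullet> lat n a' b' = 1" "\<bar>a * b' - b * a'\<bar> = 1"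
    for p q d a b a' b'
  proof
    note I = integral_cell_sum_square[OF pq cell_measure(1)[OF m] finite_edge_sources edge_sources_vertices[OF d]]
    show "integrable lebesgue (\<lambda>x. (h (cell p q) d x)\<^sup>2)" unfolding h_def by (rule I(1))
    show "(LINT x|lebesgue. (h (cell p q) d x)\<^sup>2) = sqrt 3 / (2 * (real n)\<^sup>2) * edge_energy d f"
      unfolding h_def edge_energy_def cell_measure(2)[OF m, symmetric] by (rule I(2))
  qed
  have z: "x = 0" if "xi1 n \<bullet> x = 0" "xi2 n \<bullet> x = 0" for x
    using that eq_if_xi[of x 0] by simp
  have c1: "integrable lebesgue (\<lambda>x. (h C1 (lat n 1 0) x)\<^sup>2) \<and>
      (LINT x|lebesgue. (h C1 (lat n 1 0) x)\<^sup>2) = sqrt 3 / (2 * (real n)\<^sup>2) * edge_energy (lat n 1 0) f"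
    unfolding C1_def
    \<comment> \<open>The lattice vectors with coordinates (1, -1) and (0, 1) form the basis dual to
      \<open>xi1 n\<close> and \<open>xi3 n\<close>; the witnesses for the other two directions
      arise in the same way.\<close>
    by (rule c[where a = 1 and b = "-1" and a' = 0 and b' = 1])
      (use V xi3_Ints in \<open>auto simp: mesh_vertices_iff xi3_inner intro: z\<close>)
  have c2: "integrable lebesgue (\<lambda>x. (h C2 (lat n 0 1) x)\<^sup>2) \<and>
      (LINT x|lebesgue. (h C2 (lat n 0 1) x)\<^sup>2) = sqrt 3 / (2 * (real n)\<^sup>2) * edge_energy (lat n 0 1) f"
    unfolding C2_def
    by (rule c[where a = "-1" and b = 1 and a' = 1 and b' = 0])
      (use V xi3_Ints in \<open>auto simp: mesh_vertices_iff xi3_inner intro: z\<close>)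
  have c3: "integrable lebesgue (\<lambda>x. (h C3 (lat n (-1) 1) x)\<^sup>2) \<and>
      (LINT x|lebesgue. (h C3 (lat n (-1) 1) x)\<^sup>2) = sqrt 3 / (2 * (real n)\<^sup>2) * edge_energy (lat n (-1) 1) f"
    unfolding C3_def
    by (rule c[where a = "-1" and b = 0 and a' = 0 and b' = 1])
      (use V xi3_Ints in \<open>auto simp: mesh_vertices_iff xi3_inner intro: z\<close>)
  have sq: "indicator D x *\<^sub>R (soft_field 0 f x \<bullet> soft_field 0 f x) =
     (2/3) * (real n)\<^sup>2 * ((h C1 (lat n 1 0) x)\<^sup>2 + (h C2 (lat n 0 1) x)\<^sup>2 + (h C3 (lat n (-1) 1) x)\<^sup>2)"
    if x: "x \<in> generic" for x
  proof -
    have "indicator D x *\<^sub>R (soft_field 0 f x \<bullet> soft_field 0 f x) = soft_field 0 f x \<bullet> soft_field 0 f x"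
      using soft_field_0_support[of x f] by (cases "x \<in> D") auto
    also have "\<dots> = (2/3) * (real n)\<^sup>2 * ((lat n 1 0 \<bullet> soft_field 0 f x)\<^sup>2 + (lat n 0 1 \<bullet> soft_field 0 f x)\<^sup>2 + (lat n (-1) 1 \<bullet> soft_field 0 f x)\<^sup>2)"
      by (rule inner_self_directional)
    also have "lat n 1 0 \<bullet> soft_field 0 f x = h C1 (lat n 1 0) x"
      unfolding h_def C1_def by (rule soft_field_0_directional[OF f x V(1) soft_grad_0_directional(1)[OF _ x]])
    also have "lat n 0 1 \<bullet> soft_field 0 f x = h C2 (lat n 0 1) x"
      unfolding h_def C2_def by (rule soft_field_0_directional[OF f x V(2) soft_grad_0_directional(2)[OF _ x]])
    also have "lat n (-1) 1 \<bullet> soft_field 0 f x = h C3 (lat n (-1) 1) x"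
      unfolding h_def C3_def by (rule soft_field_0_directional[OF f x V(3) soft_grad_0_directional(3)[OF _ x]])
    finally show ?thesis .
  qed
  have int: "integrable lebesgue (\<lambda>x. (2/3) * (real n)\<^sup>2 * ((h C1 (lat n 1 0) x)\<^sup>2 + (h C2 (lat n 0 1) x)\<^sup>2 + (h C3 (lat n (-1) 1) x)\<^sup>2))"
    using c1 c2 c3 by (intro integrable_mult_right Bochner_Integration.integrable_add) auto
  have "dirichlet D f f = (LINT x|lebesgue. indicator D x *\<^sub>R (soft_field 0 f x \<bullet> soft_field 0 f x))"
    unfolding dirichlet_Hn[OF f f] field_ip_def set_lebesgue_integral_def ..
  also have "\<dots> = (LINT x|lebesgue. (2/3) * (real n)\<^sup>2 * ((h C1 (lat n 1 0) x)\<^sup>2 + (h C2 (lat n 0 1) x)\<^sup>2 + (h C3 (lat n (-1) 1) x)\<^sup>2))"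
  proof (rule integral_cong_AE)
    show "AE x in lebesgue. indicator D x *\<^sub>R (soft_field 0 f x \<bullet> soft_field 0 f x) =
     (2/3) * (real n)\<^sup>2 * ((h C1 (lat n 1 0) x)\<^sup>2 + (h C2 (lat n 0 1) x)\<^sup>2 + (h C3 (lat n (-1) 1) x)\<^sup>2)"
      using AE_generic by eventually_elim (rule sq)
    show "(\<lambda>x. indicator D x *\<^sub>R (soft_field 0 f x \<bullet> soft_field 0 f x)) \<in> borel_measurable lebesgue"
      using field_ip_integrable[OF Hn_bounded_field Hn_bounded_field, of f f] unfolding set_integrable_def by simp
  qed (use int in auto)
  \<comment> \<open>The frame constant (2/3) n^2 times the cell area sqrt 3 / (2 n^2) is sqrt 3 / 3.
    The mesh size cancels, as the Dirichlet integral in the plane is scale invariant.\<close>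
  also have "\<dots> = (2/3) * (real n)\<^sup>2 * (sqrt 3 / (2 * (real n)\<^sup>2) * edge_energy (lat n 1 0) f + sqrt 3 / (2 * (real n)\<^sup>2) * edge_energy (lat n 0 1) f
      + sqrt 3 / (2 * (real n)\<^sup>2) * edge_energy (lat n (-1) 1) f)"
    using c1 c2 c3 by simp
  also have "\<dots> = sqrt 3 / 3 * (edge_energy (lat n 1 0) f + edge_energy (lat n 0 1) f + edge_energy (lat n (-1) 1) f)"
    using n0 by (simp add: field_simps)
  also have "sqrt 3 / 3 = 1 / sqrt 3" by (subst frac_eq_eq) simp_all
  finally show ?thesis by simp
qed

section \<open>Comparison with the graph\<close>

lemma interior_neighbour:
  assumes "v \<in> interior_vertices" "(a, b) \<in> neighbours"
  shows "v + lat n (of_int a) (of_int b) \<in> mesh_graph_vertices D n"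
proof -
  have "hexnorm (lat n (of_int a) (of_int b)) \<le> 1"
    using assms(2) by (auto simp: neighbours_def hexnorm_def)
  then have "v + lat n (of_int a) (of_int b) \<in> D" using hexagon_subset[OF assms(1)] by auto
  then show ?thesis
    using mesh_vertices_add[OF interior_vertex[OF assms(1)] lat_vertex] by (simp add: mesh_graph_vertices_def)
qed

lemma neighbours_minus: "(a, b) \<in> neighbours \<Longrightarrow> (- a, - b) \<in> neighbours"
  by (auto simp: neighbours_def)

text \<open>Graph edges without an interior end contribute 0, and edges with one belong to the graph
  because the hexagon around an interior vertex lies in \<open>D\<close>.\<close>

lemma edge_energy_alt:
  assumes f: "f \<in> Hn D n" and ab: "(a, b) \<in> neighbours"
  defines "d \<equiv> lat n (of_int a) (of_int b)"
  shows "edge_energy d f = (\<Sum>x | x \<in> mesh_graph_vertices D n \<and> x + d \<in> mesh_graph_vertices D n. (f (x + d) - f x)\<^sup>2)"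
  unfolding edge_energy_def
proof (rule sum.mono_neutral_left)
  let ?S = "{x. x \<in> mesh_graph_vertices D n \<and> x + d \<in> mesh_graph_vertices D n}"
  show "finite ?S" by (rule finite_subset[OF _ finite_vertices]) auto
  have m: "- d = lat n (of_int (- a)) (of_int (- b))" by (simp add: d_def lat_minus)
  have int: "v \<in> mesh_graph_vertices D n" if "v \<in> interior_vertices" for v
    using that by (simp add: interior_vertices_def)
  have "v - d \<in> mesh_graph_vertices D n" if "v \<in> interior_vertices" for v
    using interior_neighbour[OF that neighbours_minus[OF ab]] unfolding m[symmetric] by simp
  then show "edge_sources d \<subseteq> ?S"
    using int interior_neighbour[OF _ ab] unfolding edge_sources_def d_def[symmetric] by auto
  show "\<forall>x\<in>?S - edge_sources d. (f (x + d) - f x)\<^sup>2 = 0"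
  proof
    fix x assume x: "x \<in> ?S - edge_sources d"
    then have "x \<notin> interior_vertices" by (auto simp: edge_sources_def)
    moreover have "x + d \<notin> interior_vertices"
    proof
      assume "x + d \<in> interior_vertices"
      then have "(x + d) - d \<in> (\<lambda>v. v - d) ` interior_vertices" by (rule imageI)
      then show False using x by (simp add: edge_sources_def)
    qed
    ultimately have "f x = 0" "f (x + d) = 0"
      using x by (auto intro!: Hn_vertex_zero[OF f] simp: mesh_graph_vertices_def)
    then show "(f (x + d) - f x)\<^sup>2 = 0" by simp
  qed
qed

lemma edge_energy_minus:
  assumes f: "f \<in> Hn D n" and ab: "(a, b) \<in> neighbours"
  shows "edge_energy (lat n (of_int (- a)) (of_int (- b))) f = edge_energy (lat n (of_int a) (of_int b)) f"
  unfolding edge_energy_alt[OF f ab] edge_energy_alt[OF f neighbours_minus[OF ab]]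
  by (rule sum.reindex_bij_witness[where i = "\<lambda>x. x + lat n (of_int a) (of_int b)" and j = "\<lambda>x. x + lat n (of_int (- a)) (of_int (- b))"])
    (auto simp: lat_minus[symmetric] power2_commute)

text \<open>An ordered pair of adjacent vertices is a starting point with one of the six directions.
  Opposite directions have equal energy, whence the factor 2 that \<open>graph_dirichlet\<close>
  halves.\<close>

lemma graph_dirichlet_edge_energy:
  assumes f: "f \<in> Hn D n"
  shows "graph_dirichlet (mesh_graph_edges D n) (\<lambda>e. 1) f f =
    edge_energy (lat n 1 0) f + edge_energy (lat n 0 1) f + edge_energy (lat n (-1) 1) f"
proof -
  let ?V = "mesh_graph_vertices D n"
  let ?L = "\<lambda>e. lat n (of_int (fst e)) (of_int (snd e))"
  have V: "x \<in> mesh_vertices n" if "x \<in> ?V" for x using that by (simp add: mesh_graph_vertices_def)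
  have nb: "dist x y = 1 / real n \<longleftrightarrow> (\<exists>e\<in>neighbours. y = x + ?L e)" if "x \<in> ?V" "y \<in> ?V" for x y
    unfolding neighbour_iff[OF V[OF that(1)] V[OF that(2)]] by (simp add: case_prod_unfold)
  have E: "x \<noteq> y \<and> {x, y} \<in> mesh_graph_edges D n \<longleftrightarrow> x \<in> ?V \<and> y \<in> ?V \<and> dist x y = 1 / real n" for x y
    using n0 unfolding mesh_graph_edges_def by (auto simp: doubleton_eq_iff dist_commute)
  have inj: "e = e'" if "?L e = ?L e'" for e e' :: "int \<times> int"
  proof -
    have "xi1 n \<bullet> ?L e = xi1 n \<bullet> ?L e'" "xi2 n \<bullet> ?L e = xi2 n \<bullet> ?L e'"
      by (simp_all only: that)
    then show ?thesis by (simp add: prod_eq_iff)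
  qed
  have fin: "finite neighbours" by (simp add: neighbours_def)
  have "(\<Sum>(x, y) | x \<noteq> y \<and> {x, y} \<in> mesh_graph_edges D n. 1 * (f y - f x) * (f y - f x)) =
     (\<Sum>(e, x)\<in>(SIGMA e:neighbours. {x. x \<in> ?V \<and> x + ?L e \<in> ?V}). (f (x + ?L e) - f x)\<^sup>2)"
  proof (rule sym, rule sum.reindex_bij_betw[where h = "\<lambda>(e, x). (x, x + ?L e)", THEN trans[rotated]])
    show "bij_betw (\<lambda>(e, x). (x, x + ?L e)) (SIGMA e:neighbours. {x. x \<in> ?V \<and> x + ?L e \<in> ?V})
        {(x, y). x \<noteq> y \<and> {x, y} \<in> mesh_graph_edges D n}"
      unfolding E
    proof (rule bij_betw_imageI)
      show "inj_on (\<lambda>(e, x). (x, x + ?L e)) (SIGMA e:neighbours. {x. x \<in> ?V \<and> x + ?L e \<in> ?V})"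
      proof (rule inj_onI)
        fix z z' assume eq: "(case z of (e, x) \<Rightarrow> (x, x + ?L e)) = (case z' of (e, x) \<Rightarrow> (x, x + ?L e))"
        obtain e x e' x' where z: "z = (e, x)" "z' = (e', x')" by (cases z, cases z')
        have xx: "x = x'" "x + ?L e = x' + ?L e'" using eq unfolding z prod.case prod.inject by blast+
        have "?L e = ?L e'" using xx(2) unfolding xx(1) by (rule add_left_imp_eq)
        then show "z = z'" using inj[of e e'] xx(1) by (simp add: z)
      qed
      show "(\<lambda>(e, x). (x, x + ?L e)) ` (SIGMA e:neighbours. {x. x \<in> ?V \<and> x + ?L e \<in> ?V}) =
          {(x, y). x \<in> ?V \<and> y \<in> ?V \<and> dist x y = 1 / real n}"
      proof (intro equalityI subsetI)
        fix z assume "z \<in> {(x, y). x \<in> ?V \<and> y \<in> ?V \<and> dist x y = 1 / real n}"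
        then obtain x y where z: "z = (x, y)" "x \<in> ?V" "y \<in> ?V" "dist x y = 1 / real n" by auto
        then obtain e where "e \<in> neighbours" "y = x + ?L e" using nb by blast
        then show "z \<in> (\<lambda>(e, x). (x, x + ?L e)) ` (SIGMA e:neighbours. {x. x \<in> ?V \<and> x + ?L e \<in> ?V})"
          using z by (intro image_eqI[of _ _ "(e, x)"]) auto
      next
        fix z assume "z \<in> (\<lambda>(e, x). (x, x + ?L e)) ` (SIGMA e:neighbours. {x. x \<in> ?V \<and> x + ?L e \<in> ?V})"
        then obtain e x where z: "z = (x, x + ?L e)" "e \<in> neighbours" "x \<in> ?V" "x + ?L e \<in> ?V" by auto
        then show "z \<in> {(x, y). x \<in> ?V \<and> y \<in> ?V \<and> dist x y = 1 / real n}"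
          using nb[OF z(3,4)] by blast
      qed
    qed
  qed (simp add: case_prod_unfold power2_eq_square)
  also have "\<dots> = (\<Sum>e\<in>neighbours. edge_energy (?L e) f)"
  proof -
    have "finite {x. x \<in> ?V \<and> x + ?L e \<in> ?V}" for e by (rule finite_subset[OF _ finite_vertices]) auto
    then have "(\<Sum>(e, x)\<in>(SIGMA e:neighbours. {x. x \<in> ?V \<and> x + ?L e \<in> ?V}). (f (x + ?L e) - f x)\<^sup>2)
      = (\<Sum>e\<in>neighbours. \<Sum>x | x \<in> ?V \<and> x + ?L e \<in> ?V. (f (x + ?L e) - f x)\<^sup>2)"
      by (intro sum.Sigma[symmetric] fin) auto
    also have "\<dots> = (\<Sum>e\<in>neighbours. edge_energy (?L e) f)"
      by (intro sum.cong refl edge_energy_alt[OF f, symmetric]) simp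
    finally show ?thesis .
  qed
  also have "\<dots> = 2 * (edge_energy (lat n 1 0) f + edge_energy (lat n 0 1) f + edge_energy (lat n (-1) 1) f)"
    using edge_energy_minus[OF f, of 1 0] edge_energy_minus[OF f, of 0 1] edge_energy_minus[OF f, of "-1" 1]
    by (simp add: neighbours_def)
  finally show ?thesis by (simp add: graph_dirichlet_def)
qed

lemma dirichlet_eq_graph:
  "f \<in> Hn D n \<Longrightarrow> dirichlet D f f = graph_dirichlet (mesh_graph_edges D n) (\<lambda>e. 1) f f / sqrt 3"
  by (simp add: dirichlet_edge_energy graph_dirichlet_edge_energy)

text \<open>One direction already forces vanishing: the function is constant along each horizontal
  row of vertices, the row leaves the finite set of interior vertices, and outside that set the
  function is 0.\<close>

lemma edge_energy_zero_imp:
  assumes f: "f \<in> Hn D n" and 0: "edge_energy (lat n 1 0) f = 0"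
  shows "f = (\<lambda>x. 0)"
proof -
  have step: "f (w + lat n 1 0) = f w" if "w \<in> mesh_vertices n" for w
  proof (cases "w \<in> edge_sources (lat n 1 0)")
    case True
    then show ?thesis using 0 finite_edge_sources unfolding edge_energy_def
      by (subst (asm) sum_nonneg_eq_0_iff) auto
  next
    case False
    have d: "lat n 1 0 \<in> mesh_vertices n" using lat_vertex[of 1 0] by simp
    have "w + lat n 1 0 \<notin> interior_vertices"
    proof
      assume "w + lat n 1 0 \<in> interior_vertices"
      then have "(w + lat n 1 0) - lat n 1 0 \<in> (\<lambda>v. v - lat n 1 0) ` interior_vertices" by (rule imageI)
      then show False using False by (simp add: edge_sources_def)
    qed
    moreover have "w \<notin> interior_vertices" using False by (simp add: edge_sources_def)
    ultimately show ?thesis using Hn_vertex_zero[OF f] that mesh_vertices_add[OF that d] by simp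
  qed
  have line: "f (v + lat n (of_int (int k)) 0) = f v \<and> v + lat n (of_int (int k)) 0 \<in> mesh_vertices n" if v: "v \<in> mesh_vertices n" for v k
  proof (induction k)
    case 0
    have "lat n 0 0 = 0" by (simp add: lat_def)
    then show ?case using v by simp
  next
    case (Suc k)
    have "v + lat n (of_int (int (Suc k))) 0 = (v + lat n (of_int (int k)) 0) + lat n 1 0"
      by (simp add: lat_add add.assoc add.commute)
    moreover have "lat n 1 0 \<in> mesh_vertices n" using lat_vertex[of 1 0] by simp
    ultimately show ?case using Suc step mesh_vertices_add by metis
  qed
  have "f v = 0" if v: "v \<in> interior_vertices" for v
  proof -
    have "\<not> inj_on (\<lambda>k. v + lat n (of_int (int k)) 0) {k. v + lat n (of_int (int k)) 0 \<in> interior_vertices} \<or>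
        finite {k. v + lat n (of_int (int k)) 0 \<in> interior_vertices}"
      using finite_interior inj_on_finite[of "\<lambda>k. v + lat n (of_int (int k)) 0" "{k. v + lat n (of_int (int k)) 0 \<in> interior_vertices}" interior_vertices] by auto
    moreover have "inj_on (\<lambda>k. v + lat n (of_int (int k)) 0) {k. v + lat n (of_int (int k)) 0 \<in> interior_vertices}"
    proof (rule inj_onI)
      fix k l assume "v + lat n (of_int (int k)) 0 = v + lat n (of_int (int l)) 0"
      then have "xi1 n \<bullet> lat n (of_int (int k)) 0 = xi1 n \<bullet> lat n (of_int (int l)) 0" by simp
      then show "k = l" by simp
    qed
    ultimately have "finite {k. v + lat n (of_int (int k)) 0 \<in> interior_vertices}" by blast
    from ex_new_if_finite[OF infinite_UNIV_nat this]
    obtain k where "v + lat n (of_int (int k)) 0 \<notin> interior_vertices" by blast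
    then have "f (v + lat n (of_int (int k)) 0) = 0"
      using line[OF interior_vertex[OF v], of k] by (intro Hn_vertex_zero[OF f]) auto
    then show "f v = 0" using line[OF interior_vertex[OF v], of k] by simp
  qed
  then have "(\<Sum>v\<in>interior_vertices. f v * tent v x) = 0" for x by (intro sum.neutral) auto
  then show ?thesis by (intro ext) (rule Hn_expansion[OF f, THEN trans])
qed

lemma edge_energy_nonneg: "edge_energy d f \<ge> 0"
  unfolding edge_energy_def by (rule sum_nonneg) simp

lemma dirichlet_Hn_pos:
  assumes f: "f \<in> Hn D n" and "f \<noteq> (\<lambda>x. 0)"
  shows "dirichlet D f f > 0"
proof -
  have "edge_energy (lat n 1 0) f \<noteq> 0" using edge_energy_zero_imp[OF f] assms(2) by blast
  then have "edge_energy (lat n 1 0) f > 0" using edge_energy_nonneg[of "lat n 1 0" f] by simp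
  then show ?thesis
    unfolding dirichlet_edge_energy[OF f] using edge_energy_nonneg[of _ f] by (intro divide_pos_pos) (auto simp: add_pos_nonneg)
qed

lemma soft_field_lincomb2: "soft_field \<epsilon> (\<lambda>x. a * f x + b * g x) = (\<lambda>x. a *\<^sub>R soft_field \<epsilon> f x + b *\<^sub>R soft_field \<epsilon> g x)"
  unfolding soft_field_def by (simp add: scaleR_add_left sum.distrib scaleR_sum_right)

lemma function_inner_product_Hn: "function_inner_product (Hn D n) (dirichlet D)"
proof
  show "(\<lambda>x. a * f x + b * g x) \<in> Hn D n" if "f \<in> Hn D n" "g \<in> Hn D n" for f g a b
    by (rule Hn_lincomb2[OF that])
  show "(\<lambda>x. 0) \<in> Hn D n" by (rule Hn_zero)
  show "dirichlet D (\<lambda>x. a * f x + b * g x) h = a * dirichlet D f h + b * dirichlet D g h"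
    if "f \<in> Hn D n" "g \<in> Hn D n" "h \<in> Hn D n" for f g h a b
    using that Hn_lincomb2[OF that(1,2)]
    by (simp add: dirichlet_Hn soft_field_lincomb2 field_ip_lincomb2 Hn_bounded_field)
  show "dirichlet D f g = dirichlet D g f" for f g by (simp add: dirichlet_def inner_commute)
  show "0 < dirichlet D f f" if "f \<in> Hn D n" "f \<noteq> (\<lambda>x. 0)" for f by (rule dirichlet_Hn_pos[OF that])
qed

end

section \<open>The projected field\<close>

lemma centered_gaussian_char:
  assumes "prob_space M" "centered_gaussian M Y"
  shows "(CLINT \<omega>|M. iexp (Y \<omega>)) = of_real (exp (- (LINT \<omega>|M. (Y \<omega>)\<^sup>2) / 2))"
proof -
  interpret prob_space M by fact
  have Y[measurable]: "Y \<in> borel_measurable M" using assms(2) by (simp add: centered_gaussian_def)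
  from assms(2) consider "AE \<omega> in M. Y \<omega> = 0"
    | \<sigma> where "\<sigma> > 0" "distributed M lborel Y (\<lambda>x. ennreal (normal_density 0 \<sigma> x))"
    unfolding centered_gaussian_def by blast
  then show ?thesis
  proof cases
    case 1
    have "(CLINT \<omega>|M. iexp (Y \<omega>)) = (CLINT \<omega>|M. 1)" "(LINT \<omega>|M. (Y \<omega>)\<^sup>2) = (LINT \<omega>|M. 0)"
      by (rule integral_cong_AE; use 1 in auto)+
    then show ?thesis by (simp add: prob_space)
  next
    case 2
    have "expectation Y = 0" by (rule normal_distributed_expectation[OF 2])
    then have var: "(LINT \<omega>|M. (Y \<omega>)\<^sup>2) = \<sigma>\<^sup>2"
      using normal_distributed_variance[OF 2] by simp
    have "distributed M lborel (\<lambda>x. (Y x - 0) / \<sigma>) std_normal_density"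
      using normal_standard_normal_convert[OF 2(1), of Y 0] 2(2) by blast
    then have d: "distr M lborel (\<lambda>\<omega>. Y \<omega> / \<sigma>) = std_normal_distribution"
      by (simp add: distributed_def)
    have "(CLINT \<omega>|M. iexp (Y \<omega>)) = (CLINT \<omega>|M. iexp (\<sigma> * (Y \<omega> / \<sigma>)))" using 2(1) by simp
    also have "\<dots> = (CLINT x|distr M lborel (\<lambda>\<omega>. Y \<omega> / \<sigma>). iexp (\<sigma> * x))"
      by (rule integral_distr[symmetric]) auto
    also have "\<dots> = char std_normal_distribution \<sigma>" unfolding d char_def ..
    also have "\<dots> = of_real (exp (- \<sigma>\<^sup>2 / 2))" by (simp add: char_std_normal_distribution)
    finally show ?thesis unfolding var .
  qed
qed

lemma gff_prob_space: "gaussian_free_field M X \<Longrightarrow> prob_space M"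
  by (simp add: gaussian_free_field_def gaussian_hilbert_space_def)

lemma gff_measurable: "gaussian_free_field M X \<Longrightarrow> X u \<in> borel_measurable M"
  by (simp add: gaussian_free_field_def)

lemma gff_char:
  assumes "gaussian_free_field M X"
  shows "(CLINT \<omega>|M. iexp (X u \<omega>)) = of_real (exp (- (u \<bullet> u) / 2))"
proof -
  have "X u \<in> {Y \<in> borel_measurable M. \<exists>u. AE \<omega> in M. Y \<omega> = X u \<omega>}"
    using gff_measurable[OF assms] by auto
  then have "centered_gaussian M (X u)"
    using assms unfolding gaussian_free_field_def gaussian_hilbert_space_def by blast
  moreover have "(LINT \<omega>|M. (X u \<omega>)\<^sup>2) = u \<bullet> u"
    using assms unfolding gaussian_free_field_def power2_eq_square by blast
  ultimately show ?thesis using centered_gaussian_char[OF gff_prob_space[OF assms]] by metis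
qed

lemma gff_sum:
  assumes "gaussian_free_field M X" "finite I"
  shows "AE \<omega> in M. X (\<Sum>i\<in>I. t i *\<^sub>R u i) \<omega> = (\<Sum>i\<in>I. t i * X (u i) \<omega>)"
  using assms(2)
proof (induction I)
  case empty
  have "AE \<omega> in M. X (0 *\<^sub>R 0 + 0 *\<^sub>R 0) \<omega> = 0 * X 0 \<omega> + 0 * X 0 \<omega>"
    using assms(1) unfolding gaussian_free_field_def by blast
  then show ?case by simp
next
  case (insert i I)
  have "AE \<omega> in M. X (t i *\<^sub>R u i + 1 *\<^sub>R (\<Sum>i\<in>I. t i *\<^sub>R u i)) \<omega> = t i * X (u i) \<omega> + 1 * X (\<Sum>i\<in>I. t i *\<^sub>R u i) \<omega>"
    using assms(1) unfolding gaussian_free_field_def by blast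
  with insert.IH show ?case
    by eventually_elim (use insert.hyps in simp)
qed

text \<open>Joint Gaussianity is hidden in linearity: a linear combination of field variables is
  almost surely again a field variable, so the joint characteristic function is a one-dimensional
  one, and it factorises by orthonormality.\<close>

lemma gff_orthonormal_law:
  fixes I :: "'i set" and u :: "'i \<Rightarrow> 'h::{real_inner,complete_space}"
  assumes gff: "gaussian_free_field M X" and fin: "finite I"
    and on: "\<And>i j. i \<in> I \<Longrightarrow> j \<in> I \<Longrightarrow> u i \<bullet> u j = (if i = j then 1 else 0)"
  shows "distr M (\<Pi>\<^sub>M i\<in>I. borel) (\<lambda>\<omega>. \<lambda>i\<in>I. X (u i) \<omega>) = (\<Pi>\<^sub>M i\<in>I. std_normal_distribution)"
proof (rule joint_char_imp_distr_PiM[OF gff_prob_space[OF gff] fin])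
  note X[measurable] = gff_measurable[OF gff]
  show "real_distribution std_normal_distribution" by (rule real_dist_normal_dist)
  show "X (u i) \<in> borel_measurable M" for i by (rule X)
  fix t :: "'i \<Rightarrow> real"
  let ?v = "\<Sum>i\<in>I. t i *\<^sub>R u i"
  have "(CLINT \<omega>|M. iexp (\<Sum>i\<in>I. t i * X (u i) \<omega>)) = (CLINT \<omega>|M. iexp (X ?v \<omega>))"
  proof (rule integral_cong_AE)
    show "AE \<omega> in M. iexp (\<Sum>i\<in>I. t i * X (u i) \<omega>) = iexp (X ?v \<omega>)"
      using gff_sum[OF gff fin, of t u] by eventually_elim simp
  qed measurable
  also have "\<dots> = of_real (exp (- (?v \<bullet> ?v) / 2))" by (rule gff_char[OF gff])
  also have "?v \<bullet> ?v = (\<Sum>i\<in>I. (t i)\<^sup>2)"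
  proof -
    have "?v \<bullet> ?v = (\<Sum>i\<in>I. \<Sum>j\<in>I. t i * (t j * (u i \<bullet> u j)))"
      by (simp add: inner_sum_left inner_sum_right sum_distrib_left mult.left_commute inner_commute)
    also have "\<dots> = (\<Sum>i\<in>I. \<Sum>j\<in>I. if j = i then (t i)\<^sup>2 else 0)"
      by (intro sum.cong refl) (auto simp: on power2_eq_square)
    finally show ?thesis using fin by simp
  qed
  also have "of_real (exp (- (\<Sum>i\<in>I. (t i)\<^sup>2) / 2)) = (\<Prod>i\<in>I. of_real (exp (- (t i)\<^sup>2 / 2)) :: complex)"
    unfolding of_real_prod[symmetric] by (simp add: exp_sum[OF fin, symmetric] sum_negf sum_divide_distrib)
  also have "\<dots> = (\<Prod>i\<in>I. char std_normal_distribution (t i))" by (simp add: char_std_normal_distribution)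
  finally show "(CLINT \<omega>|M. iexp (\<Sum>i\<in>I. t i * X (u i) \<omega>)) = (\<Prod>i\<in>I. char std_normal_distribution (t i))" .
qed

lemma lincomb_measurable_borel:
  "finite I \<Longrightarrow> lincomb I b \<in> measurable (\<Pi>\<^sub>M i\<in>I. borel) (\<Pi>\<^sub>M x\<in>UNIV. borel)"
  using lincomb_measurable[of I b] measurable_cong_sets[OF sets_PiM_cong[OF refl sets_lborel] refl, of I] by blast

text \<open>The tents are indexed by points of the plane; transport along a bijection gives the
  basis indexed by natural numbers that the theorem asks for.\<close>

lemma finite_basis_reindex:
  assumes h: "bij_betw h J I" and b: "finite_basis V I b"
  shows "finite_basis V J (\<lambda>j. b (h j))"
proof -
  have l: "lincomb I b c = lincomb J (\<lambda>j. b (h j)) (\<lambda>j. c (h j))" for c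
    unfolding lincomb_def using sum.reindex_bij_betw[OF h, of "\<lambda>i. c i * b i _"] by simp
  have l': "lincomb J (\<lambda>j. b (h j)) c = lincomb I b (\<lambda>i. c (inv_into J h i))" for c
  proof -
    have "lincomb J (\<lambda>j. b (h j)) (\<lambda>j. c (inv_into J h (h j))) = lincomb J (\<lambda>j. b (h j)) c"
      unfolding lincomb_def using h by (intro ext sum.cong refl) (simp add: bij_betw_inv_into_left)
    then show ?thesis unfolding l by simp
  qed
  have "range (lincomb J (\<lambda>j. b (h j))) = range (lincomb I b)"
  proof
    show "range (lincomb J (\<lambda>j. b (h j))) \<subseteq> range (lincomb I b)" by (auto simp: l')
    show "range (lincomb I b) \<subseteq> range (lincomb J (\<lambda>j. b (h j)))" by (auto simp: l)
  qed
  moreover have "c j = 0" if "lincomb J (\<lambda>j. b (h j)) c = (\<lambda>x. 0)" "j \<in> J" for c j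
  proof -
    have "lincomb I b (\<lambda>i. c (inv_into J h i)) = (\<lambda>x. 0)" using that(1) by (simp add: l')
    then have "c (inv_into J h (h j)) = 0"
      using b that(2) bij_betwE[OF h] unfolding finite_basis_def by blast
    then show ?thesis using h that(2) by (simp add: bij_betw_inv_into_left)
  qed
  moreover have "finite J" using h b bij_betw_finite unfolding finite_basis_def by blast
  ultimately show ?thesis using b unfolding finite_basis_def by simp
qed

lemma finite_basis_scale:
  assumes b: "finite_basis V I b" and k: "k \<noteq> 0"
  shows "finite_basis V I (\<lambda>i x. k * b i x)"
proof -
  have l: "lincomb I (\<lambda>i x. k * b i x) c = lincomb I b (\<lambda>i. k * c i)" for c
    unfolding lincomb_def by (intro ext sum.cong) auto
  have l': "lincomb I b c = lincomb I (\<lambda>i x. k * b i x) (\<lambda>i. c i / k)" for c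
    unfolding l using k by simp
  have "range (lincomb I (\<lambda>i x. k * b i x)) = range (lincomb I b)"
  proof
    show "range (lincomb I (\<lambda>i x. k * b i x)) \<subseteq> range (lincomb I b)" by (auto simp: l)
    show "range (lincomb I b) \<subseteq> range (lincomb I (\<lambda>i x. k * b i x))" by (auto simp: l')
  qed
  moreover have "c i = 0" if "lincomb I (\<lambda>i x. k * b i x) c = (\<lambda>x. 0)" "i \<in> I" for c i
  proof -
    have "k * c i = 0" using b that unfolding l finite_basis_def by blast
    then show ?thesis using k by simp
  qed
  ultimately show ?thesis using b unfolding finite_basis_def by simp
qed

section \<open>Orthonormal expansion of the projected field\<close>

locale gff_mesh = mesh_domain +
  fixes \<iota> :: "(real^2 \<Rightarrow> real) \<Rightarrow> 'h::{real_inner,complete_space}"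
    and M :: "'w measure" and X :: "'h \<Rightarrow> 'w \<Rightarrow> real"
  assumes completion: "dirichlet_completion D \<iota>" and gff: "gaussian_free_field M X"
begin

sublocale function_inner_product "Hn D n" "dirichlet D"
  by (rule function_inner_product_Hn)

text \<open>One simultaneous choice for all mesh functions, since the preservation of inner products
  concerns pairs.\<close>

definition rep :: "(real^2 \<Rightarrow> real) \<Rightarrow> 'h" where
  "rep = (SOME U. (\<forall>f\<in>Hn D n. represents D \<iota> f (U f)) \<and> (\<forall>f\<in>Hn D n. \<forall>g\<in>Hn D n. U f \<bullet> U g = dirichlet D f g))"

lemma rep:
  shows rep_represents: "f \<in> Hn D n \<Longrightarrow> represents D \<iota> f (rep f)"
    and rep_inner: "f \<in> Hn D n \<Longrightarrow> g \<in> Hn D n \<Longrightarrow> rep f \<bullet> rep g = dirichlet D f g"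
proof -
  have "\<exists>U. (\<forall>f\<in>Hn D n. represents D \<iota> f (U f)) \<and> (\<forall>f\<in>Hn D n. \<forall>g\<in>Hn D n. U f \<bullet> U g = dirichlet D f g)"
    using represents_exists[OF completion] by metis
  from someI_ex[OF this, folded rep_def]
  show "f \<in> Hn D n \<Longrightarrow> represents D \<iota> f (rep f)"
    and "f \<in> Hn D n \<Longrightarrow> g \<in> Hn D n \<Longrightarrow> rep f \<bullet> rep g = dirichlet D f g" by blast+
qed

definition expansion :: "'i set \<Rightarrow> ('i \<Rightarrow> real^2 \<Rightarrow> real) \<Rightarrow> 'w \<Rightarrow> real^2 \<Rightarrow> real" where
  "expansion I e \<omega> = lincomb I e (\<lambda>i\<in>I. X (rep (e i)) \<omega>)"

lemma expansion_measurable: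
  assumes "finite I"
  shows "expansion I e \<in> measurable M (\<Pi>\<^sub>M x\<in>UNIV. borel)"
proof -
  have "(\<lambda>\<omega>. \<lambda>i\<in>I. X (rep (e i)) \<omega>) \<in> measurable M (\<Pi>\<^sub>M i\<in>I. borel)"
    by (intro measurable_restrict gff_measurable[OF gff])
  from measurable_compose[OF this lincomb_measurable_borel[OF assms]]
  show ?thesis unfolding expansion_def[abs_def] .
qed

lemma lincomb_closed: "finite_basis (Hn D n) I e \<Longrightarrow> lincomb I e c \<in> Hn D n"
  by (auto simp: finite_basis_def)

lemma basis_expansion:
  assumes "finite_basis (Hn D n) I e" "f \<in> Hn D n"
  obtains c where "f = lincomb I e c"
proof -
  have "f \<in> range (lincomb I e)" using assms by (simp add: finite_basis_def)
  then show ?thesis using that by blast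
qed

text \<open>The choice behind \<open>rep\<close> includes no linearity. It follows from preserved
  inner products, which determine the squared norm of the difference of the two sides to be
  0.\<close>

lemma rep_lincomb:
  assumes e: "finite_basis (Hn D n) I e" "orthonormal_on I e"
  shows "rep (lincomb I e c) = (\<Sum>i\<in>I. c i *\<^sub>R rep (e i))"
proof -
  have fin: "finite I" using e(1) by (simp add: finite_basis_def)
  let ?f = "lincomb I e c" and ?s = "\<Sum>i\<in>I. c i *\<^sub>R rep (e i)"
  have fV: "?f \<in> Hn D n" by (rule lincomb_closed[OF e(1)])
  have "rep ?f \<bullet> rep (e i) = c i" if "i \<in> I" for i
    using rep_inner[OF fV basis_closed[OF e(1) that]] orthonormal_lincomb(1)[OF e that] by simp
  then have fs: "rep ?f \<bullet> ?s = (\<Sum>i\<in>I. (c i)\<^sup>2)"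
    by (simp add: inner_sum_right power2_eq_square)
  have "rep (e i) \<bullet> ?s = c i" if i: "i \<in> I" for i
  proof -
    have "rep (e i) \<bullet> ?s = (\<Sum>j\<in>I. if j = i then c j else 0)"
      unfolding inner_sum_right using e(2) i
      by (intro sum.cong refl) (auto simp: rep_inner basis_closed[OF e(1)] orthonormal_on_def)
    then show ?thesis using fin i by simp
  qed
  then have ss: "?s \<bullet> ?s = (\<Sum>i\<in>I. (c i)\<^sup>2)"
    by (subst inner_sum_left) (simp add: power2_eq_square)
  have ff: "rep ?f \<bullet> rep ?f = (\<Sum>i\<in>I. (c i)\<^sup>2)"
    using rep_inner[OF fV fV] orthonormal_lincomb(2)[OF e] by simp
  have "(rep ?f - ?s) \<bullet> (rep ?f - ?s) = 0"
  proof -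
    have "(a - b) \<bullet> (a - b) = a \<bullet> a - 2 * (a \<bullet> b) + b \<bullet> b" for a b :: 'h
      by (simp add: inner_diff_left inner_diff_right inner_commute)
    from this[of "rep ?f" ?s] show ?thesis unfolding fs ss ff by simp
  qed
  then show ?thesis by simp
qed

text \<open>Pairing the expansion with f weights the coefficients by the coordinates of f; linearity
  of \<open>rep\<close> and almost sure linearity of \<open>X\<close> identify the result with
  \<open>X (rep f)\<close>.\<close>

lemma expansion_projection:
  assumes e: "finite_basis (Hn D n) I e" "orthonormal_on I e"
  shows "gff_mesh_projection D n \<iota> M X (expansion I e)"
  unfolding gff_mesh_projection_def
proof (intro conjI ballI)
  have fin: "finite I" using e(1) by (simp add: finite_basis_def)
  show "expansion I e \<in> measurable M (\<Pi>\<^sub>M x\<in>UNIV. borel)" by (rule expansion_measurable[OF fin])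
  show "expansion I e \<omega> \<in> Hn D n" for \<omega> unfolding expansion_def by (rule lincomb_closed[OF e(1)])
  fix f assume f: "f \<in> Hn D n"
  then obtain c where c: "f = lincomb I e c" by (rule basis_expansion[OF e(1)])
  have "dirichlet D (expansion I e \<omega>) f = (\<Sum>i\<in>I. c i * X (rep (e i)) \<omega>)" for \<omega>
  proof -
    have "dirichlet D (expansion I e \<omega>) f = dirichlet D f (expansion I e \<omega>)" by (rule B_sym)
    also have "\<dots> = (\<Sum>i\<in>I. c i * dirichlet D (e i) (expansion I e \<omega>))"
      unfolding c lincomb_def[of I e c] expansion_def
      by (intro B_sum fin basis_closed[OF e(1)] lincomb_closed[OF e(1)])
    also have "\<dots> = (\<Sum>i\<in>I. c i * X (rep (e i)) \<omega>)"
    proof (intro sum.cong refl)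
      fix i assume i: "i \<in> I"
      have "dirichlet D (e i) (expansion I e \<omega>) = dirichlet D (expansion I e \<omega>) (e i)" by (rule B_sym)
      also have "\<dots> = X (rep (e i)) \<omega>" unfolding expansion_def using orthonormal_lincomb(1)[OF e i] i by simp
      finally show "c i * dirichlet D (e i) (expansion I e \<omega>) = c i * X (rep (e i)) \<omega>" by simp
    qed
    finally show ?thesis .
  qed
  moreover have "AE \<omega> in M. X (rep f) \<omega> = (\<Sum>i\<in>I. c i * X (rep (e i)) \<omega>)"
    unfolding c rep_lincomb[OF e] by (rule gff_sum[OF gff fin])
  ultimately show "\<exists>u. represents D \<iota> f u \<and> (AE \<omega> in M. dirichlet D (expansion I e \<omega>) f = X u \<omega>)"
    using rep_represents[OF f] by (intro exI[of _ "rep f"]) auto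
qed

text \<open>Testing against a finite basis involves finitely many null sets, and pairing with an
  orthonormal basis reads off the coordinates of a mesh function.\<close>

lemma projection_eq_expansion:
  assumes e: "finite_basis (Hn D n) I e" "orthonormal_on I e"
    and hn: "gff_mesh_projection D n \<iota> M X hn"
  shows "AE \<omega> in M. hn \<omega> = expansion I e \<omega>"
proof -
  have fin: "finite I" using e(1) by (simp add: finite_basis_def)
  have "AE \<omega> in M. dirichlet D (hn \<omega>) (e i) = X (rep (e i)) \<omega>" if i: "i \<in> I" for i
  proof -
    have eV: "e i \<in> Hn D n" by (rule basis_closed[OF e(1) i])
    then obtain u where u: "represents D \<iota> (e i) u" "AE \<omega> in M. dirichlet D (hn \<omega>) (e i) = X u \<omega>"
      using hn unfolding gff_mesh_projection_def by blast
    have "u = rep (e i)" by (rule represents_unique[OF completion eV u(1) rep_represents[OF eV]])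
    then show ?thesis using u(2) by simp
  qed
  then have "AE \<omega> in M. \<forall>i\<in>I. dirichlet D (hn \<omega>) (e i) = X (rep (e i)) \<omega>"
    using fin by (simp add: AE_finite_all)
  then show ?thesis using AE_space
  proof eventually_elim
    case (elim \<omega>)
    then have "hn \<omega> \<in> Hn D n" using hn unfolding gff_mesh_projection_def by blast
    then obtain c where c: "hn \<omega> = lincomb I e c" by (rule basis_expansion[OF e(1)])
    have "c i = X (rep (e i)) \<omega>" if "i \<in> I" for i
      using elim(1) that orthonormal_lincomb(1)[OF e that, of c] unfolding c by auto
    then show "hn \<omega> = expansion I e \<omega>" unfolding c expansion_def lincomb_def by (intro ext sum.cong) auto
  qed
qed

lemma projection_law:
  assumes b: "finite_basis (Hn D n) I b" and hn: "gff_mesh_projection D n \<iota> M X hn"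
  shows "distr M (\<Pi>\<^sub>M x\<in>UNIV. borel) hn = boltzmann_law I b (\<lambda>f. dirichlet D f f)"
proof -
  have fin: "finite I" using b by (simp add: finite_basis_def)
  obtain e where e: "finite_basis (Hn D n) I e" "orthonormal_on I e"
      "boltzmann_law I e (\<lambda>f. dirichlet D f f) = boltzmann_law I b (\<lambda>f. dirichlet D f f)"
    using orthonormal_basis_exists[OF b] .
  have m: "(\<lambda>\<omega>. \<lambda>i\<in>I. X (rep (e i)) \<omega>) \<in> measurable M (\<Pi>\<^sub>M i\<in>I. borel)"
    by (intro measurable_restrict gff_measurable[OF gff])
  have hm: "hn \<in> measurable M (\<Pi>\<^sub>M x\<in>UNIV. borel)" using hn by (simp add: gff_mesh_projection_def)
  have "distr M (\<Pi>\<^sub>M x\<in>UNIV. borel) hn = distr M (\<Pi>\<^sub>M x\<in>UNIV. borel) (expansion I e)"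
    by (rule distr_cong_AE[OF refl refl projection_eq_expansion[OF e(1,2) hn] hm expansion_measurable[OF fin]])
  also have "\<dots> = distr M (\<Pi>\<^sub>M x\<in>UNIV. borel) (lincomb I e \<circ> (\<lambda>\<omega>. \<lambda>i\<in>I. X (rep (e i)) \<omega>))"
    by (simp add: expansion_def[abs_def] comp_def)
  also have "\<dots> = distr (distr M (\<Pi>\<^sub>M i\<in>I. borel) (\<lambda>\<omega>. \<lambda>i\<in>I. X (rep (e i)) \<omega>)) (\<Pi>\<^sub>M x\<in>UNIV. borel) (lincomb I e)"
    by (rule distr_distr[OF lincomb_measurable_borel[OF fin] m, symmetric])
  also have "distr M (\<Pi>\<^sub>M i\<in>I. borel) (\<lambda>\<omega>. \<lambda>i\<in>I. X (rep (e i)) \<omega>) = (\<Pi>\<^sub>M i\<in>I. std_normal_distribution)"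
    by (rule gff_orthonormal_law[OF gff fin])
      (use e(2) in \<open>auto simp: rep_inner basis_closed[OF e(1)] orthonormal_on_def\<close>)
  also have "distr (\<Pi>\<^sub>M i\<in>I. std_normal_distribution) (\<Pi>\<^sub>M x\<in>UNIV. borel) (lincomb I e) = boltzmann_law I b (\<lambda>f. dirichlet D f f)"
    using boltzmann_law_orthonormal[OF e(1,2)] e(3) by simp
  finally show ?thesis .
qed

text \<open>Values at graph vertices determine the energy, so a mesh function can be exchanged for
  the function that has the same vertex values and is 0 elsewhere.\<close>

lemma graph_dirichlet_cong:
  assumes "\<And>x. x \<in> mesh_graph_vertices D n \<Longrightarrow> f x = k * g x"
  shows "graph_dirichlet (mesh_graph_edges D n) (\<lambda>e. 1) f f = k\<^sup>2 * graph_dirichlet (mesh_graph_edges D n) (\<lambda>e. 1) g g"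
proof -
  have "(\<Sum>(x, y) | x \<noteq> y \<and> {x, y} \<in> mesh_graph_edges D n. 1 * (f y - f x) * (f y - f x)) =
      (\<Sum>(x, y) | x \<noteq> y \<and> {x, y} \<in> mesh_graph_edges D n. k\<^sup>2 * (1 * (g y - g x) * (g y - g x)))"
  proof (rule sum.cong[OF refl], clarify)
    fix x y assume "x \<noteq> y" "{x, y} \<in> mesh_graph_edges D n"
    then have "x \<in> mesh_graph_vertices D n" "y \<in> mesh_graph_vertices D n"
      unfolding mesh_graph_edges_def by (auto simp: doubleton_eq_iff)
    then show "1 * (f y - f x) * (f y - f x) = k\<^sup>2 * (1 * (g y - g x) * (g y - g x))"
      by (simp add: assms power2_eq_square algebra_simps)
  qed
  then show ?thesis unfolding graph_dirichlet_def
    by (simp add: sum_distrib_left case_prod_unfold)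
qed

text \<open>For tents multiplied by 3^(1/4) the squared factor sqrt 3 cancels the 1 / sqrt 3 of
  \<open>dirichlet_eq_graph\<close>, so the energy in coordinates is that of the crystal in its
  indicator basis.\<close>

lemma projection_vertex_law:
  assumes hn: "gff_mesh_projection D n \<iota> M X hn"
  shows "distr M (\<Pi>\<^sub>M v\<in>mesh_graph_vertices D n. borel) (\<lambda>\<omega>. \<lambda>v\<in>mesh_graph_vertices D n. hn \<omega> v) =
          distr (harmonic_crystal (mesh_graph_vertices D n) (mesh_graph_edges D n) (\<lambda>e. 1) (mesh_graph_boundary D n))
            (\<Pi>\<^sub>M v\<in>mesh_graph_vertices D n. borel)
            (\<lambda>\<phi>. \<lambda>v\<in>mesh_graph_vertices D n. 3 powr (1/4) * \<phi> v)"
proof -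
  let ?V = "mesh_graph_vertices D n" and ?I = interior_vertices and ?k = "3 powr (1/4) :: real"
  let ?P = "\<Pi>\<^sub>M x\<in>(UNIV :: (real^2) set). (borel :: real measure)" and ?PV = "\<Pi>\<^sub>M v\<in>mesh_graph_vertices D n. (borel :: real measure)"
  let ?b = "\<lambda>v x. ?k * tent v x" and ?\<delta> = "\<lambda>v. indicator {v} :: real^2 \<Rightarrow> real"
  let ?G = "\<lambda>\<phi>. graph_dirichlet (mesh_graph_edges D n) (\<lambda>e. 1) \<phi> \<phi>"
  have b: "finite_basis (Hn D n) ?I ?b" by (rule finite_basis_scale[OF tent_basis]) simp
  have hm: "hn \<in> measurable M ?P" using hn by (simp add: gff_mesh_projection_def)
  have r: "(\<lambda>\<phi>. \<lambda>v\<in>?V. c * \<phi> v) \<in> measurable ?P ?PV" for c :: real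
    by (intro measurable_restrict borel_measurable_times measurable_const measurable_component_singleton) auto
  have val: "lincomb ?I ?b c v = ?k * lincomb ?I ?\<delta> c v" if "v \<in> ?V" for c v
  proof -
    have v: "v \<in> mesh_vertices n" using that by (simp add: mesh_graph_vertices_def)
    have "lincomb ?I ?b c v = ?k * (\<Sum>w\<in>?I. c w * tent w v)"
      by (simp add: lincomb_def sum_distrib_left mult.left_commute)
    also have "(\<Sum>w\<in>?I. c w * tent w v) = (\<Sum>w\<in>?I. c w * ?\<delta> w v)"
      by (intro sum.cong refl) (simp add: tent_vertex[OF interior_vertex v] indicator_def)
    finally show ?thesis by (simp add: lincomb_def)
  qed
  have k2: "?k\<^sup>2 = sqrt 3"
    by (simp add: power2_eq_square powr_add[symmetric] powr_half_sqrt)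
  have Q: "dirichlet D (lincomb ?I ?b c) (lincomb ?I ?b c) = ?G (lincomb ?I ?\<delta> c)" for c
    using dirichlet_eq_graph[OF lincomb_closed[OF b, of c]]
      graph_dirichlet_cong[of "lincomb ?I ?b c" ?k "lincomb ?I ?\<delta> c"] val[of _ c] k2 by simp
  let ?\<mu> = "\<Pi>\<^sub>M i\<in>?I. (lborel :: real measure)"
  let ?p = "\<lambda>c. ennreal (exp (- ?G (lincomb ?I ?\<delta> c) / 2))"
  \<comment> \<open>The common law of the coordinates: the projected field is its image under the
    scaled tents, the crystal its image under the indicators.\<close>
  define \<nu> where "\<nu> = density ?\<mu> (\<lambda>c. ?p c / (\<integral>\<^sup>+ c'. ?p c' \<partial>?\<mu>))"
  have L: "lincomb ?I g \<in> measurable \<nu> ?P" for g :: "real^2 \<Rightarrow> real^2 \<Rightarrow> real"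
    unfolding \<nu>_def using lincomb_measurable[OF finite_interior, of g] by simp
  have bl: "boltzmann_law ?I ?b (\<lambda>f. dirichlet D f f) = distr \<nu> ?P (lincomb ?I ?b)"
    unfolding boltzmann_law_def Let_def Q \<nu>_def ..
  have hc: "harmonic_crystal ?V (mesh_graph_edges D n) (\<lambda>e. 1) (mesh_graph_boundary D n) = distr \<nu> ?P (lincomb ?I ?\<delta>)"
    unfolding harmonic_crystal_def boltzmann_law_def Let_def \<nu>_def interior_vertices_def[symmetric] ..
  \<comment> \<open>Restriction to the vertices is written with the factor 1 so that
    \<open>r\<close> covers it.\<close>
  have "distr M ?PV (\<lambda>\<omega>. \<lambda>v\<in>?V. hn \<omega> v) = distr (distr M ?P hn) ?PV (\<lambda>\<phi>. \<lambda>v\<in>?V. 1 * \<phi> v)"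
    using distr_distr[OF r[of 1] hm] by (simp add: comp_def)
  also have "\<dots> = distr \<nu> ?PV ((\<lambda>\<phi>. \<lambda>v\<in>?V. 1 * \<phi> v) \<circ> lincomb ?I ?b)"
    unfolding projection_law[OF b hn] bl by (rule distr_distr[OF r L])
  also have "(\<lambda>\<phi>. \<lambda>v\<in>?V. 1 * \<phi> v) \<circ> lincomb ?I ?b = (\<lambda>\<phi>. \<lambda>v\<in>?V. ?k * \<phi> v) \<circ> lincomb ?I ?\<delta>"
    by (auto simp: fun_eq_iff val)
  also have "distr \<nu> ?PV ((\<lambda>\<phi>. \<lambda>v\<in>?V. ?k * \<phi> v) \<circ> lincomb ?I ?\<delta>) = distr (distr \<nu> ?P (lincomb ?I ?\<delta>)) ?PV (\<lambda>\<phi>. \<lambda>v\<in>?V. ?k * \<phi> v)"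
    by (rule distr_distr[OF r L, symmetric])
  finally show ?thesis unfolding hc .
qed

end

theorem mainTheorem1:
  fixes D :: "(real^2) set" and n :: nat
    and \<iota> :: "(real^2 \<Rightarrow> real) \<Rightarrow> 'h::{real_inner,complete_space}"
    and M :: "'w measure" and X :: "'h \<Rightarrow> 'w \<Rightarrow> real"
  assumes "open D" and "connected D" and "D \<noteq> {}" and "bounded D" and "n \<ge> 1"
    and "dirichlet_completion D \<iota>"
    and "gaussian_free_field M X"
  shows
    "(\<exists>hn. gff_mesh_projection D n \<iota> M X hn \<and>
        (\<forall>hn'. gff_mesh_projection D n \<iota> M X hn' \<longrightarrow> (AE \<omega> in M. hn' \<omega> = hn \<omega>))) \<and>
     (\<forall>f\<in>Hn D n. \<forall>g\<in>Hn D n. (\<forall>v\<in>mesh_graph_vertices D n. f v = g v) \<longrightarrow> f = g) \<and>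
     (\<forall>hn. gff_mesh_projection D n \<iota> M X hn \<longrightarrow>
        (\<exists>(I::nat set) b. finite_basis (Hn D n) I b \<and>
           distr M (\<Pi>\<^sub>M x\<in>UNIV. borel) hn = boltzmann_law I b (\<lambda>f. dirichlet D f f)) \<and>
        distr M (\<Pi>\<^sub>M v\<in>mesh_graph_vertices D n. borel)
            (\<lambda>\<omega>. \<lambda>v\<in>mesh_graph_vertices D n. hn \<omega> v) =
          distr (harmonic_crystal (mesh_graph_vertices D n) (mesh_graph_edges D n) (\<lambda>e. 1)
                  (mesh_graph_boundary D n))
            (\<Pi>\<^sub>M v\<in>mesh_graph_vertices D n. borel)
            (\<lambda>\<phi>. \<lambda>v\<in>mesh_graph_vertices D n. 3 powr (1/4) * \<phi> v))"
proof -
  interpret gff_mesh n D \<iota> M X by unfold_locales fact+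
  obtain e where e: "finite_basis (Hn D n) interior_vertices e" "orthonormal_on interior_vertices e"
    by (rule orthonormal_basis_exists[OF tent_basis])
  obtain h where "bij_betw h {0..<card interior_vertices} interior_vertices"
    using ex_bij_betw_nat_finite[OF finite_interior] by blast
  note nat_basis = finite_basis_reindex[OF this tent_basis]
  show ?thesis
  proof (intro conjI allI impI ballI)
    show "\<exists>hn. gff_mesh_projection D n \<iota> M X hn \<and>
        (\<forall>hn'. gff_mesh_projection D n \<iota> M X hn' \<longrightarrow> (AE \<omega> in M. hn' \<omega> = hn \<omega>))"
      using expansion_projection[OF e] projection_eq_expansion[OF e] by blast
  next
    fix f g assume f: "f \<in> Hn D n" and g: "g \<in> Hn D n"
      and eq: "\<forall>v\<in>mesh_graph_vertices D n. f v = g v"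
    have "f v = g v" if "v \<in> interior_vertices" for v using eq that by (simp add: interior_vertices_def)
    then have "(\<Sum>v\<in>interior_vertices. f v * tent v x) = (\<Sum>v\<in>interior_vertices. g v * tent v x)" for x by simp
    then show "f = g"
      by (intro ext trans[OF Hn_expansion[OF f] trans[OF _ Hn_expansion[OF g, symmetric]]])
  next
    fix hn assume hn: "gff_mesh_projection D n \<iota> M X hn"
    show "\<exists>(I::nat set) b. finite_basis (Hn D n) I b \<and>
           distr M (\<Pi>\<^sub>M x\<in>UNIV. borel) hn = boltzmann_law I b (\<lambda>f. dirichlet D f f)"
      using nat_basis projection_law[OF nat_basis hn] by blast
    show "distr M (\<Pi>\<^sub>M v\<in>mesh_graph_vertices D n. borel) (\<lambda>\<omega>. \<lambda>v\<in>mesh_graph_vertices D n. hn \<omega> v) =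
          distr (harmonic_crystal (mesh_graph_vertices D n) (mesh_graph_edges D n) (\<lambda>e. 1)
                  (mesh_graph_boundary D n))
            (\<Pi>\<^sub>M v\<in>mesh_graph_vertices D n. borel)
            (\<lambda>\<phi>. \<lambda>v\<in>mesh_graph_vertices D n. 3 powr (1/4) * \<phi> v)"
      by (rule projection_vertex_law[OF hn])
  qed
qed

end
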